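(* Let $k$ be a commutative ring, $H$ a Hopf algebra over $k$ that is finitely generated and projective as a $k$-module, and $A$ a left $H$-module algebra. Assume that there exist finitely many elements $a_i\in A$ and $t_i\in\int_H^l$ such that $\sum_i t_i\cdot a_i=1_A$. Then the following assertions are equivalent: (1) $A$ is left FBN; (2) $A\# H$ is left FBN and $A$ is left noetherian; (3) $B=A^H$ is left FBN and $A$ is left noetherian.
   Context: $\int_H^l=\{t\in H\mid ht=\varepsilon(h)t\text{ for all }h\in H\}$ is the space of left integrals in $H$. $A\#H$ is the smash product: $A\otimes_kH$ as a $k$-module, with multiplication $(a\#h)(b\#h')=a(h_{(1)}\cdot b)\#h_{(2)}h'$ and unit $1_A\#1_H$. $A^H=\{a\in A\mid h\cdot a=\varepsilon(h)a\text{ for all }h\in H\}$ is the subalgebra of invariants. A ring $T$ is left bounded if every essential left ideal contains a non-zero two-sided ideal; left fully bounded if $T/P$ is left bounded for every two-sided prime ideal $P$ of $T$; left FBN if it is left fully bounded and left noetherian. *)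

theory Defs
  imports "HOL-Algebra.Module" "HOL-Algebra.Ring_Divisibility"
begin

section \<open>Left fully bounded noetherian rings\<close>

locale left_ideal = additive_subgroup I R + ring R for I and R (structure) +
  assumes left_closed: "\<lbrakk>a \<in> I; x \<in> carrier R\<rbrakk> \<Longrightarrow> x \<otimes> a \<in> I"

definition gen_left_ideal :: "('a, 'm) ring_scheme \<Rightarrow> 'a set \<Rightarrow> 'a set" where
  "gen_left_ideal R S = \<Inter>{I. left_ideal I R \<and> S \<subseteq> I}"

text \<open>The one-sided analogue of \<^locale>\<open>noetherian_ring\<close>, which only concerns two-sided ideals.\<close>

locale left_noetherian_ring = ring +
  assumes finitely_gen_left:
    "left_ideal I R \<Longrightarrow> \<exists>S \<subseteq> carrier R. finite S \<and> I = gen_left_ideal R S"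

definition essential_left_ideal :: "'a set \<Rightarrow> ('a, 'm) ring_scheme \<Rightarrow> bool" where
  "essential_left_ideal E R \<longleftrightarrow> left_ideal E R \<and>
     (\<forall>J. left_ideal J R \<and> J \<noteq> {\<zero>\<^bsub>R\<^esub>} \<longrightarrow> E \<inter> J \<noteq> {\<zero>\<^bsub>R\<^esub>})"

text \<open>\<^locale>\<open>primeideal\<close> requires a commutative ring and elementwise (complete) primality;
  here \<open>P\<close> is meant to be prime in the sense of noncommutative ring theory.\<close>

definition prime_two_sided_ideal :: "'a set \<Rightarrow> ('a, 'm) ring_scheme \<Rightarrow> bool" where
  "prime_two_sided_ideal P R \<longleftrightarrow> ideal P R \<and> P \<noteq> carrier R \<and>
     (\<forall>I J. ideal I R \<and> ideal J R \<and> (\<forall>a\<in>I. \<forall>b\<in>J. a \<otimes>\<^bsub>R\<^esub> b \<in> P) \<longrightarrow> I \<subseteq> P \<or> J \<subseteq> P)"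

definition left_bounded :: "('a, 'm) ring_scheme \<Rightarrow> bool" where
  "left_bounded R \<longleftrightarrow>
     (\<forall>E. essential_left_ideal E R \<longrightarrow> (\<exists>I. ideal I R \<and> I \<noteq> {\<zero>\<^bsub>R\<^esub>} \<and> I \<subseteq> E))"

definition left_fully_bounded :: "('a, 'm) ring_scheme \<Rightarrow> bool" where
  "left_fully_bounded R \<longleftrightarrow> (\<forall>P. prime_two_sided_ideal P R \<longrightarrow> left_bounded (R Quot P))"

definition left_FBN :: "('a, 'm) ring_scheme \<Rightarrow> bool" where
  "left_FBN R \<longleftrightarrow> left_fully_bounded R \<and> left_noetherian_ring R"


section \<open>Modules over a commutative ring\<close>

definition linear_maps ::
  "('k, 'l) ring_scheme \<Rightarrow> ('k, 'a, 'm) module_scheme \<Rightarrow> ('k, 'b, 'n) module_scheme \<Rightarrow> ('a \<Rightarrow> 'b) set" where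
  "linear_maps k M N = {f. f \<in> carrier M \<rightarrow> carrier N \<and>
     (\<forall>x\<in>carrier M. \<forall>y\<in>carrier M. f (x \<oplus>\<^bsub>M\<^esub> y) = f x \<oplus>\<^bsub>N\<^esub> f y) \<and>
     (\<forall>r\<in>carrier k. \<forall>x\<in>carrier M. f (r \<odot>\<^bsub>M\<^esub> x) = r \<odot>\<^bsub>N\<^esub> f x)}"

definition gen_submodule :: "('k, 'l) ring_scheme \<Rightarrow> ('k, 'a, 'm) module_scheme \<Rightarrow> 'a set \<Rightarrow> 'a set" where
  "gen_submodule k M S = \<Inter>{N. submodule N k M \<and> S \<subseteq> N}"

definition finitely_generated_module :: "('k, 'l) ring_scheme \<Rightarrow> ('k, 'a, 'm) module_scheme \<Rightarrow> bool" where
  "finitely_generated_module k M \<longleftrightarrow>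
     (\<exists>S \<subseteq> carrier M. finite S \<and> carrier M = gen_submodule k M S)"

text \<open>The free module on \<open>X\<close>: finitely supported functions, extended by zero outside \<open>X\<close>.
  As only the module structure is meant, the ring multiplication of the record is left unspecified.\<close>

definition free_module :: "('k, 'l) ring_scheme \<Rightarrow> 'x set \<Rightarrow> ('k, 'x \<Rightarrow> 'k) module" where
  "free_module k X =
     \<lparr>carrier = {f. range f \<subseteq> carrier k \<and> finite {x. f x \<noteq> \<zero>\<^bsub>k\<^esub>} \<and> {x. f x \<noteq> \<zero>\<^bsub>k\<^esub>} \<subseteq> X},
      mult = undefined, one = undefined,
      zero = (\<lambda>_. \<zero>\<^bsub>k\<^esub>), add = (\<lambda>f g x. f x \<oplus>\<^bsub>k\<^esub> g x),
      smult = (\<lambda>r f x. r \<otimes>\<^bsub>k\<^esub> f x)\<rparr>"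

definition free_basis :: "('k, 'l) ring_scheme \<Rightarrow> 'x \<Rightarrow> 'x \<Rightarrow> 'k" where
  "free_basis k x = (\<lambda>y. if y = x then \<one>\<^bsub>k\<^esub> else \<zero>\<^bsub>k\<^esub>)"

text \<open>Projective: a direct summand (retract) of a free module.  Taking the basis \<open>X\<close> among
  the sets over the type of elements of \<open>M\<close> is no restriction, since a projective \<open>M\<close> is a
  retract of the free module on \<open>carrier M\<close>.\<close>

definition projective_module :: "('k, 'l) ring_scheme \<Rightarrow> ('k, 'a, 'm) module_scheme \<Rightarrow> bool" where
  "projective_module k M \<longleftrightarrow>
     (\<exists>(X :: 'a set) i p. i \<in> linear_maps k M (free_module k X) \<and>
        p \<in> linear_maps k (free_module k X) M \<and> (\<forall>x\<in>carrier M. p (i x) = x))"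

definition quotient_module ::
  "('k, 'a, 'm) module_scheme \<Rightarrow> 'a set \<Rightarrow> ('k, 'a set) module" where
  "quotient_module M N =
     \<lparr>carrier = a_rcosets\<^bsub>M\<^esub> N, mult = undefined, one = undefined,
      zero = N, add = set_add M,
      smult = (\<lambda>r X. \<Union>x\<in>X. N +>\<^bsub>M\<^esub> (r \<odot>\<^bsub>M\<^esub> x))\<rparr>"


section \<open>Tensor products\<close>

definition tensor_relations ::
  "('k, 'l) ring_scheme \<Rightarrow> ('k, 'a, 'm) module_scheme \<Rightarrow> ('k, 'b, 'n) module_scheme \<Rightarrow>
   ('a \<times> 'b \<Rightarrow> 'k) set" where
  "tensor_relations k M N =
     (let F = free_module k (carrier M \<times> carrier N); e = free_basis k in
       {e (x \<oplus>\<^bsub>M\<^esub> x', y) \<ominus>\<^bsub>F\<^esub> (e (x, y) \<oplus>\<^bsub>F\<^esub> e (x', y)) | x x' y.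
          x \<in> carrier M \<and> x' \<in> carrier M \<and> y \<in> carrier N} \<union>
       {e (x, y \<oplus>\<^bsub>N\<^esub> y') \<ominus>\<^bsub>F\<^esub> (e (x, y) \<oplus>\<^bsub>F\<^esub> e (x, y')) | x y y'.
          x \<in> carrier M \<and> y \<in> carrier N \<and> y' \<in> carrier N} \<union>
       {e (r \<odot>\<^bsub>M\<^esub> x, y) \<ominus>\<^bsub>F\<^esub> r \<odot>\<^bsub>F\<^esub> e (x, y) | r x y.
          r \<in> carrier k \<and> x \<in> carrier M \<and> y \<in> carrier N} \<union>
       {e (x, r \<odot>\<^bsub>N\<^esub> y) \<ominus>\<^bsub>F\<^esub> r \<odot>\<^bsub>F\<^esub> e (x, y) | r x y.
          r \<in> carrier k \<and> x \<in> carrier M \<and> y \<in> carrier N})"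

definition tensor_kernel ::
  "('k, 'l) ring_scheme \<Rightarrow> ('k, 'a, 'm) module_scheme \<Rightarrow> ('k, 'b, 'n) module_scheme \<Rightarrow>
   ('a \<times> 'b \<Rightarrow> 'k) set" where
  "tensor_kernel k M N =
     gen_submodule k (free_module k (carrier M \<times> carrier N)) (tensor_relations k M N)"

definition tensor_module ::
  "('k, 'l) ring_scheme \<Rightarrow> ('k, 'a, 'm) module_scheme \<Rightarrow> ('k, 'b, 'n) module_scheme \<Rightarrow>
   ('k, ('a \<times> 'b \<Rightarrow> 'k) set) module" where
  "tensor_module k M N =
     quotient_module (free_module k (carrier M \<times> carrier N)) (tensor_kernel k M N)"

definition tensor ::
  "('k, 'l) ring_scheme \<Rightarrow> ('k, 'a, 'm) module_scheme \<Rightarrow> ('k, 'b, 'n) module_scheme \<Rightarrow>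
   'a \<Rightarrow> 'b \<Rightarrow> ('a \<times> 'b \<Rightarrow> 'k) set" where
  "tensor k M N x y =
     tensor_kernel k M N +>\<^bsub>free_module k (carrier M \<times> carrier N)\<^esub> free_basis k (x, y)"

text \<open>The linear map into \<open>P\<close> induced by a bilinear map \<open>f\<close>, sending \<open>\<Sum> x\<^sub>i \<otimes> y\<^sub>i\<close> to
  \<open>\<Sum> f x\<^sub>i y\<^sub>i\<close>.  For bilinear \<open>f\<close> the value does not depend on the representative of
  the coset \<open>X\<close>, so that the image below is a singleton.  Applied to \<open>X = \<Delta> h\<close> it expresses
  Sweedler notation: \<open>tensor_lift k P f (\<Delta> h)\<close> is \<open>\<Sum> f h\<^sub>1 h\<^sub>2\<close>.\<close>

definition tensor_lift ::
  "('k, 'l) ring_scheme \<Rightarrow> ('k, 'p, 'n) module_scheme \<Rightarrow> ('a \<Rightarrow> 'b \<Rightarrow> 'p) \<Rightarrow>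
   ('a \<times> 'b \<Rightarrow> 'k) set \<Rightarrow> 'p" where
  "tensor_lift k P f X =
     the_elem ((\<lambda>u. \<Oplus>\<^bsub>P\<^esub>z\<in>{z. u z \<noteq> \<zero>\<^bsub>k\<^esub>}. u z \<odot>\<^bsub>P\<^esub> f (fst z) (snd z)) ` X)"


section \<open>Hopf algebras, module algebras and smash products\<close>

text \<open>The locale \<^locale>\<open>algebra\<close> is restricted to commutative algebras.\<close>

locale assoc_algebra = module + ring M +
  assumes smult_mult_left: "\<lbrakk>a \<in> carrier R; x \<in> carrier M; y \<in> carrier M\<rbrakk> \<Longrightarrow>
      (a \<odot>\<^bsub>M\<^esub> x) \<otimes>\<^bsub>M\<^esub> y = a \<odot>\<^bsub>M\<^esub> (x \<otimes>\<^bsub>M\<^esub> y)"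
    and smult_mult_right: "\<lbrakk>a \<in> carrier R; x \<in> carrier M; y \<in> carrier M\<rbrakk> \<Longrightarrow>
      x \<otimes>\<^bsub>M\<^esub> (a \<odot>\<^bsub>M\<^esub> y) = a \<odot>\<^bsub>M\<^esub> (x \<otimes>\<^bsub>M\<^esub> y)"

text \<open>\<open>(a \<otimes> b) (c \<otimes> d) = a c \<otimes> b d\<close>\<close>

definition tensor_algebra ::
  "('k, 'l) ring_scheme \<Rightarrow> ('k, 'a, 'm) module_scheme \<Rightarrow> ('k, 'b, 'n) module_scheme \<Rightarrow>
   ('k, ('a \<times> 'b \<Rightarrow> 'k) set) module" where
  "tensor_algebra k A B = (tensor_module k A B)
     \<lparr>mult := (\<lambda>X Y.
        tensor_lift k (tensor_module k A B) (\<lambda>a b.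
          tensor_lift k (tensor_module k A B) (\<lambda>c d.
            tensor k A B (a \<otimes>\<^bsub>A\<^esub> c) (b \<otimes>\<^bsub>B\<^esub> d)) Y) X),
      one := tensor k A B \<one>\<^bsub>A\<^esub> \<one>\<^bsub>B\<^esub>\<rparr>"

text \<open>Coassociativity compares \<open>h\<^sub>1\<^sub>1 \<otimes> (h\<^sub>1\<^sub>2 \<otimes> h\<^sub>2)\<close> with
  \<open>h\<^sub>1 \<otimes> (h\<^sub>2\<^sub>1 \<otimes> h\<^sub>2\<^sub>2)\<close>, i.e. it includes the canonical
  reassociation \<open>(H \<otimes> H) \<otimes> H \<cong> H \<otimes> (H \<otimes> H)\<close>.\<close>

locale hopf_algebra = assoc_algebra k H for k :: "('k, 'l) ring_scheme" and H :: "('k, 'h, 'm) module_scheme" (structure) +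
  fixes \<Delta> :: "'h \<Rightarrow> ('h \<times> 'h \<Rightarrow> 'k) set" and \<epsilon> :: "'h \<Rightarrow> 'k" and S :: "'h \<Rightarrow> 'h"
  assumes comult_linear: "\<Delta> \<in> linear_maps k H (tensor_module k H H)"
    and comult_ring_hom: "\<Delta> \<in> ring_hom H (tensor_algebra k H H)"
    and counit_linear: "\<lbrakk>r \<in> carrier k; h \<in> carrier H\<rbrakk> \<Longrightarrow> \<epsilon> (r \<odot> h) = r \<otimes>\<^bsub>k\<^esub> \<epsilon> h"
    and counit_ring_hom: "\<epsilon> \<in> ring_hom H k"
    and antipode_linear: "S \<in> linear_maps k H H"
    and coassoc: "h \<in> carrier H \<Longrightarrow>
      (let T = tensor_module k H H; T3 = tensor_module k H T in
        tensor_lift k T3 (\<lambda>x y. tensor_lift k T3 (\<lambda>u v. tensor k H T u (tensor k H H v y)) (\<Delta> x)) (\<Delta> h)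
        = tensor_lift k T3 (\<lambda>x y. tensor k H T x (\<Delta> y)) (\<Delta> h))"
    and counit_left: "h \<in> carrier H \<Longrightarrow> tensor_lift k H (\<lambda>x y. \<epsilon> x \<odot> y) (\<Delta> h) = h"
    and counit_right: "h \<in> carrier H \<Longrightarrow> tensor_lift k H (\<lambda>x y. \<epsilon> y \<odot> x) (\<Delta> h) = h"
    and antipode_left: "h \<in> carrier H \<Longrightarrow> tensor_lift k H (\<lambda>x y. S x \<otimes> y) (\<Delta> h) = \<epsilon> h \<odot> \<one>"
    and antipode_right: "h \<in> carrier H \<Longrightarrow> tensor_lift k H (\<lambda>x y. x \<otimes> S y) (\<Delta> h) = \<epsilon> h \<odot> \<one>"

definition left_integrals ::
  "('k, 'h, 'm) module_scheme \<Rightarrow> ('h \<Rightarrow> 'k) \<Rightarrow> 'h set" where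
  "left_integrals H \<epsilon> = {t \<in> carrier H. \<forall>h\<in>carrier H. h \<otimes>\<^bsub>H\<^esub> t = \<epsilon> h \<odot>\<^bsub>H\<^esub> t}"

text \<open>The action \<open>h \<cdot> a\<close> is written \<open>act h a\<close>.\<close>

locale left_module_algebra = H: hopf_algebra k H \<Delta> \<epsilon> S + A: assoc_algebra k A
  for k :: "('k, 'l) ring_scheme" and H :: "('k, 'h, 'm) module_scheme" and \<Delta> \<epsilon> S
    and A :: "('k, 'a, 'n) module_scheme" +
  fixes act :: "'h \<Rightarrow> 'a \<Rightarrow> 'a"
  assumes act_closed: "\<lbrakk>h \<in> carrier H; a \<in> carrier A\<rbrakk> \<Longrightarrow> act h a \<in> carrier A"
    and act_add_left: "\<lbrakk>h \<in> carrier H; g \<in> carrier H; a \<in> carrier A\<rbrakk> \<Longrightarrow>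
      act (h \<oplus>\<^bsub>H\<^esub> g) a = act h a \<oplus>\<^bsub>A\<^esub> act g a"
    and act_add_right: "\<lbrakk>h \<in> carrier H; a \<in> carrier A; b \<in> carrier A\<rbrakk> \<Longrightarrow>
      act h (a \<oplus>\<^bsub>A\<^esub> b) = act h a \<oplus>\<^bsub>A\<^esub> act h b"
    and act_smult_left: "\<lbrakk>r \<in> carrier k; h \<in> carrier H; a \<in> carrier A\<rbrakk> \<Longrightarrow>
      act (r \<odot>\<^bsub>H\<^esub> h) a = r \<odot>\<^bsub>A\<^esub> act h a"
    and act_smult_right: "\<lbrakk>r \<in> carrier k; h \<in> carrier H; a \<in> carrier A\<rbrakk> \<Longrightarrow>
      act h (r \<odot>\<^bsub>A\<^esub> a) = r \<odot>\<^bsub>A\<^esub> act h a"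
    and act_one: "a \<in> carrier A \<Longrightarrow> act \<one>\<^bsub>H\<^esub> a = a"
    and act_mult: "\<lbrakk>h \<in> carrier H; g \<in> carrier H; a \<in> carrier A\<rbrakk> \<Longrightarrow>
      act (h \<otimes>\<^bsub>H\<^esub> g) a = act h (act g a)"
    and act_on_one: "h \<in> carrier H \<Longrightarrow> act h \<one>\<^bsub>A\<^esub> = \<epsilon> h \<odot>\<^bsub>A\<^esub> \<one>\<^bsub>A\<^esub>"
    and act_on_mult: "\<lbrakk>h \<in> carrier H; a \<in> carrier A; b \<in> carrier A\<rbrakk> \<Longrightarrow>
      act h (a \<otimes>\<^bsub>A\<^esub> b) = tensor_lift k A (\<lambda>x y. act x a \<otimes>\<^bsub>A\<^esub> act y b) (\<Delta> h)"

definition invariants ::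
  "('k, 'h, 'm) module_scheme \<Rightarrow> ('h \<Rightarrow> 'k) \<Rightarrow> ('k, 'a, 'n) module_scheme \<Rightarrow> ('h \<Rightarrow> 'a \<Rightarrow> 'a) \<Rightarrow>
   ('k, 'a, 'n) module_scheme" where
  "invariants H \<epsilon> A act =
     A\<lparr>carrier := {a \<in> carrier A. \<forall>h\<in>carrier H. act h a = \<epsilon> h \<odot>\<^bsub>A\<^esub> a}\<rparr>"

text \<open>\<open>(a # h) (b # g) = a (h\<^sub>1 \<cdot> b) # h\<^sub>2 g\<close>, extended bilinearly\<close>

definition smash_product ::
  "('k, 'l) ring_scheme \<Rightarrow> ('k, 'a, 'm) module_scheme \<Rightarrow> ('k, 'h, 'n) module_scheme \<Rightarrow>
   ('h \<Rightarrow> ('h \<times> 'h \<Rightarrow> 'k) set) \<Rightarrow> ('h \<Rightarrow> 'a \<Rightarrow> 'a) \<Rightarrow> ('k, ('a \<times> 'h \<Rightarrow> 'k) set) module" where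
  "smash_product k A H \<Delta> act = (tensor_module k A H)
     \<lparr>mult := (\<lambda>X Y.
        tensor_lift k (tensor_module k A H) (\<lambda>a h.
          tensor_lift k (tensor_module k A H) (\<lambda>b g.
            tensor_lift k (tensor_module k A H) (\<lambda>x y.
              tensor k A H (a \<otimes>\<^bsub>A\<^esub> act x b) (y \<otimes>\<^bsub>H\<^esub> g)) (\<Delta> h)) Y) X),
      one := tensor k A H \<one>\<^bsub>A\<^esub> \<one>\<^bsub>H\<^esub>\<rparr>"

end

theory Submission
  imports Defs "HOL-Algebra.Subrings"
begin

text \<open>
  For a left noetherian ring, being left fully bounded is equivalent to Gabriel's condition: for every
  left ideal \<open>X\<close> finitely many elements \<open>f\<close> suffice to detect that \<open>s f \<in> X\<close> for all \<open>f\<close>.  One direction of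
  this equivalence passes through any ring homomorphism \<open>B \<rightarrow> S\<close> that makes \<open>S\<close> a finitely generated left
  \<open>B\<close>-module: if \<open>B\<close> is left FBN, then \<open>S\<close> satisfies Gabriel's condition.  Applied to \<open>A \<rightarrow> A # H\<close> and
  \<open>A\<^sup>H \<rightarrow> A\<close> this gives (1) to (2) and (3) to (1).  For (2) to (3), the condition descends from
  \<open>A # H\<close> to \<open>A\<^sup>H\<close> along the \<open>A # H\<close>-module \<open>A\<close>, by means of the elements of trace one.

  That \<open>A\<close> is finitely generated over \<open>A\<^sup>H\<close> comes from the left ideal of \<open>A # H\<close> generated by all \<open>t x\<close>
  with \<open>t\<close> an integral and \<open>x \<in> A\<close>: a finite set of such generators spans all \<open>t y\<close> over \<open>A\<^sup>H\<close>, and \<open>y\<close> is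
  recovered from the \<open>t y\<close> because \<open>1\<close> is a sum of elements \<open>f (t\<^sub>2) t\<^sub>1\<close> with integrals \<open>t\<close> and
  functionals \<open>f\<close> on \<open>H\<close>.
\<close>

section \<open>Noetherian modules along a ring homomorphism\<close>

text \<open>Full boundedness speaks of prime ideals, and the primes of \<open>A\<close>,
  \<open>A # H\<close> and \<open>A\<^sup>H\<close> are hard to compare directly. Gabriel's
  condition mentions only left ideals and products, so it can travel along homomorphisms and
  modules. The price is a relative form of Cauchon's theorem: boundedness is used in one ring, and
  the finite set is found in another. Over a commutative ring \<open>k\<close> the integrals of
  \<open>H\<close> need not form a free module of rank one, so in general a family of them is
  needed. A finite dual basis replaces a basis of \<open>H\<close>, and the integrals come from a
  trace formula indexed by it. The formula contains \<open>S\<close> twice and never an inverse of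
  \<open>S\<close>. The given \<open>a i\<close> and \<open>t i\<close> yield a right
  \<open>A\<^sup>H\<close>-linear retraction of \<open>A\<close> onto \<open>A\<^sup>H\<close>,
  which brings back to \<open>A\<^sup>H\<close> what is generated over a larger ring. Between two
  integrals an element \<open>r\<close> of \<open>A # H\<close> acts as an invariant:
  \<open>t r t' = (t \<cdot> (r \<cdot> 1)) t'\<close>. This identity turns finite generation over
  \<open>A # H\<close> into finite generation over \<open>A\<^sup>H\<close>.\<close>

definition hom_submodule ::
  "('b, 'm) ring_scheme \<Rightarrow> ('s, 'n) ring_scheme \<Rightarrow> ('b \<Rightarrow> 's) \<Rightarrow> 's set \<Rightarrow> bool" where
  "hom_submodule B S \<phi> N \<longleftrightarrow> N \<subseteq> carrier S \<and> \<zero>\<^bsub>S\<^esub> \<in> N \<and> (\<forall>x\<in>N. \<forall>y\<in>N. x \<oplus>\<^bsub>S\<^esub> y \<in> N) \<and>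
     (\<forall>b\<in>carrier B. \<forall>x\<in>N. \<phi> b \<otimes>\<^bsub>S\<^esub> x \<in> N)"

text \<open>Generation is tested against submodules instead of being spelled out by linear
  combinations: to prove a property on all of \<open>N\<close>, take for \<open>N'\<close> the set
  of elements that have it and check the property on \<open>F\<close>.\<close>

definition hom_generates ::
  "('b, 'm) ring_scheme \<Rightarrow> ('s, 'n) ring_scheme \<Rightarrow> ('b \<Rightarrow> 's) \<Rightarrow> 's set \<Rightarrow> 's set \<Rightarrow> bool" where
  "hom_generates B S \<phi> F N \<longleftrightarrow> (\<forall>N'. hom_submodule B S \<phi> N' \<and> F \<subseteq> N' \<longrightarrow> N \<subseteq> N')"

definition hom_noetherian ::
  "('b, 'm) ring_scheme \<Rightarrow> ('s, 'n) ring_scheme \<Rightarrow> ('b \<Rightarrow> 's) \<Rightarrow> bool" where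
  "hom_noetherian B S \<phi> \<longleftrightarrow>
     (\<forall>N. hom_submodule B S \<phi> N \<longrightarrow> (\<exists>F\<subseteq>N. finite F \<and> hom_generates B S \<phi> F N))"

definition hom_span ::
  "('b, 'm) ring_scheme \<Rightarrow> ('s, 'n) ring_scheme \<Rightarrow> ('b \<Rightarrow> 's) \<Rightarrow> 's set \<Rightarrow> 's set" where
  "hom_span B S \<phi> F = \<Inter>{N. hom_submodule B S \<phi> N \<and> F \<subseteq> N}"

lemma hom_submoduleI:
  assumes "N \<subseteq> carrier S" "\<zero>\<^bsub>S\<^esub> \<in> N" "\<And>x y. x \<in> N \<Longrightarrow> y \<in> N \<Longrightarrow> x \<oplus>\<^bsub>S\<^esub> y \<in> N"
    "\<And>b x. b \<in> carrier B \<Longrightarrow> x \<in> N \<Longrightarrow> \<phi> b \<otimes>\<^bsub>S\<^esub> x \<in> N"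
  shows "hom_submodule B S \<phi> N"
  using assms unfolding hom_submodule_def by blast

lemma hom_submoduleD:
  assumes "hom_submodule B S \<phi> N"
  shows "N \<subseteq> carrier S" "\<zero>\<^bsub>S\<^esub> \<in> N" "\<And>x y. x \<in> N \<Longrightarrow> y \<in> N \<Longrightarrow> x \<oplus>\<^bsub>S\<^esub> y \<in> N"
    "\<And>b x. b \<in> carrier B \<Longrightarrow> x \<in> N \<Longrightarrow> \<phi> b \<otimes>\<^bsub>S\<^esub> x \<in> N" "\<And>x. x \<in> N \<Longrightarrow> x \<in> carrier S"
  using assms unfolding hom_submodule_def by blast+

lemma (in ring) id_ring_hom_ring: "ring_hom_ring R R id"
  by (intro ring_hom_ringI2 ring_axioms id_ring_hom)

text \<open>Additive inverses are multiples by \<open>\<ominus> \<one>\<close>, so closure under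
  addition and left multiplication is enough.\<close>

lemma (in ring) left_ideal_iff_hom_submodule:
  "left_ideal I R \<longleftrightarrow> hom_submodule R R id I"
proof
  assume "left_ideal I R"
  then interpret left_ideal I R .
  show "hom_submodule R R id I"
    by (rule hom_submoduleI) (auto simp: left_closed)
next
  assume I: "hom_submodule R R id I"
  note D = hom_submoduleD[OF I]
  have neg: "\<ominus> x \<in> I" if "x \<in> I" for x
    using D(4)[of "\<ominus> \<one>" x] D(5)[OF that] that by (simp add: l_minus)
  have "subgroup I (add_monoid R)"
    by (rule add.subgroupI) (use D neg in \<open>auto simp flip: a_inv_def\<close>)
  then show "left_ideal I R"
    by unfold_locales (use D in \<open>auto intro: additive_subgroupI simp: additive_subgroup_def subgroup_def\<close>)
qed

section \<open>Submodules of \<open>S\<close> over \<open>R\<close>, spans and maximal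
  elements\<close>

context ring_hom_ring
begin

abbreviation action (infixl \<open>\<bullet>\<close> 70) where "b \<bullet> x \<equiv> h b \<otimes>\<^bsub>S\<^esub> x"
abbreviation "submod \<equiv> hom_submodule R S h"
abbreviation "generates \<equiv> hom_generates R S h"
abbreviation "spanned \<equiv> hom_span R S h"

lemma hom_submodule_minus:
  assumes "submod N" "x \<in> N"
  shows "\<ominus>\<^bsub>S\<^esub> x \<in> N"
proof -
  have "x \<in> carrier S" using assms hom_submoduleD by metis
  then have "(\<ominus> \<one>) \<bullet> x = \<ominus>\<^bsub>S\<^esub> x"
    by (simp add: S.l_minus)
  then show ?thesis using hom_submoduleD(4)[OF assms(1), of "\<ominus> \<one>" x] assms(2) by simp
qed

lemma hom_submodule_diff:
  assumes "submod N" "x \<in> N" "y \<in> N"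
  shows "x \<ominus>\<^bsub>S\<^esub> y \<in> N"
  using hom_submoduleD(3)[OF assms(1,2)] hom_submodule_minus[OF assms(1,3)]
  by (simp add: a_minus_def)

lemma hom_submodule_restrict: "hom_submodule S S id N \<Longrightarrow> submod N"
  unfolding hom_submodule_def by auto

text \<open>This is the annihilator of the image of \<open>U\<close> in \<open>S / N\<close>: a left
  ideal for any set \<open>U\<close>, and a two-sided one as soon as \<open>U\<close> is a
  submodule.\<close>

lemma hom_submodule_residual:
  assumes "submod N" "U \<subseteq> carrier S"
  shows "hom_submodule R R id {r \<in> carrier R. \<forall>u\<in>U. r \<bullet> u \<in> N}"
proof (rule hom_submoduleI)
  let ?N = "{r \<in> carrier R. \<forall>u\<in>U. r \<bullet> u \<in> N}"
  note D = hom_submoduleD[OF assms(1)] and U = subsetD[OF assms(2)]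
  show "\<zero> \<in> ?N" using D(2) U by simp
  show "x \<oplus> y \<in> ?N" if "x \<in> ?N" "y \<in> ?N" for x y
    using that D(3) U by (simp add: S.l_distr)
  show "id b \<otimes> x \<in> ?N" if "b \<in> carrier R" "x \<in> ?N" for b x
    using that D(4) U by (simp add: S.m_assoc)
qed auto

lemma hom_submodule_carrier: "submod (carrier S)"
  by (rule hom_submoduleI) auto

lemma hom_submodule_Int:
  "\<lbrakk>submod N; submod N'\<rbrakk> \<Longrightarrow> submod (N \<inter> N')"
  unfolding hom_submodule_def by blast

lemma hom_span_properties:
  assumes "F \<subseteq> carrier S"
  shows "submod (spanned F)" "F \<subseteq> spanned F"
    "generates F (spanned F)"
proof -
  show "submod (spanned F)"
  proof (rule hom_submoduleI)
    show "spanned F \<subseteq> carrier S"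
      using hom_submodule_carrier assms unfolding hom_span_def by blast
  qed (auto simp: hom_span_def dest: hom_submoduleD)
  show "F \<subseteq> spanned F" "generates F (spanned F)"
    unfolding hom_span_def hom_generates_def by blast+
qed

lemma hom_submodule_set_add:
  assumes "submod N" "submod N'"
  shows "submod {x \<oplus>\<^bsub>S\<^esub> y | x y. x \<in> N \<and> y \<in> N'}"
proof -
  note D = hom_submoduleD[OF assms(1)] and D' = hom_submoduleD[OF assms(2)]
  show ?thesis
  proof (rule hom_submoduleI)
    show "{x \<oplus>\<^bsub>S\<^esub> y | x y. x \<in> N \<and> y \<in> N'} \<subseteq> carrier S"
      using D D' by auto
    show "\<zero>\<^bsub>S\<^esub> \<in> {x \<oplus>\<^bsub>S\<^esub> y | x y. x \<in> N \<and> y \<in> N'}"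
      using D(2) D'(2) by (force intro: S.r_zero[symmetric])
  next
    fix u v assume "u \<in> {x \<oplus>\<^bsub>S\<^esub> y | x y. x \<in> N \<and> y \<in> N'}" "v \<in> {x \<oplus>\<^bsub>S\<^esub> y | x y. x \<in> N \<and> y \<in> N'}"
    then obtain x y x' y' where *: "u = x \<oplus>\<^bsub>S\<^esub> y" "v = x' \<oplus>\<^bsub>S\<^esub> y'" "x \<in> N" "x' \<in> N" "y \<in> N'" "y' \<in> N'"
      by blast
    then have "u \<oplus>\<^bsub>S\<^esub> v = (x \<oplus>\<^bsub>S\<^esub> x') \<oplus>\<^bsub>S\<^esub> (y \<oplus>\<^bsub>S\<^esub> y')"
      using D(5) D'(5) by (simp add: S.a_ac)
    with * D(3) D'(3) show "u \<oplus>\<^bsub>S\<^esub> v \<in> {x \<oplus>\<^bsub>S\<^esub> y | x y. x \<in> N \<and> y \<in> N'}" by blast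
  next
    fix b u assume b: "b \<in> carrier R" and "u \<in> {x \<oplus>\<^bsub>S\<^esub> y | x y. x \<in> N \<and> y \<in> N'}"
    then obtain x y where *: "u = x \<oplus>\<^bsub>S\<^esub> y" "x \<in> N" "y \<in> N'" by blast
    then have "b \<bullet> u = b \<bullet> x \<oplus>\<^bsub>S\<^esub> b \<bullet> y"
      using D(5) D'(5) b by (simp add: S.r_distr)
    with * b D(4) D'(4) show "b \<bullet> u \<in> {x \<oplus>\<^bsub>S\<^esub> y | x y. x \<in> N \<and> y \<in> N'}" by blast
  qed
qed

lemma hom_submodule_multiples:
  assumes N: "hom_submodule R R id J" and g: "g \<in> carrier S"
  shows "submod {b \<bullet> g | b. b \<in> J}"
proof -
  note D = hom_submoduleD[OF N, simplified]
  show ?thesis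
  proof (rule hom_submoduleI)
    show "{b \<bullet> g | b. b \<in> J} \<subseteq> carrier S" using D(5) g by auto
    have "\<zero>\<^bsub>S\<^esub> = \<zero> \<bullet> g" using g by simp
    then show "\<zero>\<^bsub>S\<^esub> \<in> {b \<bullet> g | b. b \<in> J}" using D(2) by blast
  next
    fix u v assume "u \<in> {b \<bullet> g | b. b \<in> J}" "v \<in> {b \<bullet> g | b. b \<in> J}"
    then obtain b c where *: "u = b \<bullet> g" "v = c \<bullet> g" "b \<in> J" "c \<in> J" by blast
    then have "u \<oplus>\<^bsub>S\<^esub> v = (b \<oplus> c) \<bullet> g" using D(5) g by (simp add: S.l_distr)
    with D(3) * show "u \<oplus>\<^bsub>S\<^esub> v \<in> {b \<bullet> g | b. b \<in> J}" by blast
  next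
    fix c u assume c: "c \<in> carrier R" and "u \<in> {b \<bullet> g | b. b \<in> J}"
    then obtain b where *: "u = b \<bullet> g" "b \<in> J" by blast
    then have "c \<bullet> u = (c \<otimes> b) \<bullet> g" using D(5) g c by (simp add: S.m_assoc)
    with D(4)[OF c] * show "c \<bullet> u \<in> {b \<bullet> g | b. b \<in> J}" by blast
  qed
qed

text \<open>Zorn's lemma applies because the union of a nonempty chain is a submodule whose finitely
  many generators already lie in one member of the chain; that member is then the whole
  union.\<close>

lemma hom_noetherian_maximal:
  assumes noeth: "hom_noetherian R S h" and C: "\<And>N. N \<in> C \<Longrightarrow> submod N" and "C \<noteq> {}"
  obtains W where "W \<in> C" "\<And>N. N \<in> C \<Longrightarrow> W \<subseteq> N \<Longrightarrow> N = W"
proof -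
  have "\<exists>W\<in>C. \<forall>N\<in>C. W \<subseteq> N \<longrightarrow> N = W"
  proof (rule subset_Zorn)
    fix K assume K: "subset.chain C K"
    show "\<exists>U\<in>C. \<forall>X\<in>K. X \<subseteq> U"
    proof (cases "K = {}")
      case True then show ?thesis using \<open>C \<noteq> {}\<close> by blast
    next
      case False
      have KC: "K \<subseteq> C" and lin: "\<And>X Y. X \<in> K \<Longrightarrow> Y \<in> K \<Longrightarrow> X \<subseteq> Y \<or> Y \<subseteq> X"
        using K by (auto simp: subset_chain_def)
      note D = hom_submoduleD[OF C[OF subsetD[OF KC]]]
      have "submod (\<Union>K)"
      proof (rule hom_submoduleI)
        show "\<Union>K \<subseteq> carrier S" using D(1) by blast
        show "\<zero>\<^bsub>S\<^esub> \<in> \<Union>K" using D(2) False by blast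
        show "x \<oplus>\<^bsub>S\<^esub> y \<in> \<Union>K" if xy: "x \<in> \<Union>K" "y \<in> \<Union>K" for x y
        proof -
          obtain X Y where XY: "X \<in> K" "x \<in> X" "Y \<in> K" "y \<in> Y" using xy by blast
          from lin[OF XY(1,3)] show ?thesis
          proof
            assume "X \<subseteq> Y" then show ?thesis using D(3)[OF XY(3)] XY by blast
          next
            assume "Y \<subseteq> X" then show ?thesis using D(3)[OF XY(1)] XY by blast
          qed
        qed
        show "b \<bullet> x \<in> \<Union>K" if "b \<in> carrier R" "x \<in> \<Union>K" for b x
          using that D(4) by blast
      qed
      then obtain F where F: "F \<subseteq> \<Union>K" "finite F" "generates F (\<Union>K)"
        using noeth unfolding hom_noetherian_def by blast
      have "\<exists>X\<in>K. F \<subseteq> X"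
        using F(2,1)
      proof (induction F)
        case empty then show ?case using False by blast
      next
        case (insert x F)
        then obtain X Y where "X \<in> K" "F \<subseteq> X" "Y \<in> K" "x \<in> Y" by blast
        then show ?case using lin[of X Y] by blast
      qed
      then obtain X where "X \<in> K" "F \<subseteq> X" by blast
      then have "\<Union>K \<subseteq> X" using F(3) C KC unfolding hom_generates_def by blast
      then show ?thesis using \<open>X \<in> K\<close> KC by blast
    qed
  qed
  then show ?thesis using that by blast
qed

text \<open>The generators supplied by noetherianness need not lie in \<open>Z\<close>. A maximal
  span of a finite subset of \<open>Z\<close> does better: it absorbs every further element of
  \<open>Z\<close>.\<close>

lemma hom_noetherian_finite_subset:
  assumes noeth: "hom_noetherian R S h" and Z: "Z \<subseteq> carrier S" and gen: "generates Z N"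
  obtains F where "F \<subseteq> Z" "finite F" "generates F N"
proof -
  let ?C = "{spanned F | F. F \<subseteq> Z \<and> finite F}"
  have sub: "submod X" if "X \<in> ?C" for X
    using that hom_span_properties(1) Z by (force dest: subset_trans)
  have "?C \<noteq> {}" by blast
  from hom_noetherian_maximal[OF noeth sub this]
  obtain W where W: "W \<in> ?C" and max: "\<And>N. N \<in> ?C \<Longrightarrow> W \<subseteq> N \<Longrightarrow> N = W" by blast
  then obtain F where F: "W = spanned F" "F \<subseteq> Z" "finite F" by blast
  have "z \<in> W" if "z \<in> Z" for z
  proof -
    have "spanned (insert z F) = W"
    proof (rule max)
      show "spanned (insert z F) \<in> ?C" using F that by blast
      show "W \<subseteq> spanned (insert z F)" unfolding F(1) hom_span_def by blast
    qed
    moreover have "z \<in> spanned (insert z F)"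
      using hom_span_properties(2)[of "insert z F"] F(2) Z that by blast
    ultimately show ?thesis by blast
  qed
  then have "N \<subseteq> W" using gen sub[OF W] unfolding hom_generates_def by blast
  then have "generates F N" unfolding F(1) hom_generates_def hom_span_def by blast
  with F that show ?thesis by blast
qed

lemma hom_span_insert:
  assumes "g \<in> carrier S" "G \<subseteq> carrier S"
  shows "spanned (insert g G) \<subseteq> {b \<bullet> g \<oplus>\<^bsub>S\<^esub> w | b w. b \<in> carrier R \<and> w \<in> spanned G}"
proof -
  note G = hom_span_properties[OF assms(2)]
  let ?N = "{x \<oplus>\<^bsub>S\<^esub> w | x w. x \<in> {b \<bullet> g | b. b \<in> carrier R} \<and> w \<in> spanned G}"
  have N: "submod ?N"
    by (intro hom_submodule_set_add hom_submodule_multiples G(1) assms(1)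
        ring_hom_ring.hom_submodule_carrier R.id_ring_hom_ring)
  have "g = \<one> \<bullet> g \<oplus>\<^bsub>S\<^esub> \<zero>\<^bsub>S\<^esub>" using assms(1) by simp
  then have "g \<in> ?N" using hom_submoduleD(2)[OF G(1)] by blast
  moreover have "x \<in> ?N" if "x \<in> G" for x
  proof -
    have "x = \<zero> \<bullet> g \<oplus>\<^bsub>S\<^esub> x" using assms that by auto
    then show ?thesis using G(2) that by blast
  qed
  ultimately have "insert g G \<subseteq> ?N" by blast
  with N have "spanned (insert g G) \<subseteq> ?N" unfolding hom_span_def by blast
  then show ?thesis by blast
qed

text \<open>Induction on \<open>G\<close>, as for extensions of noetherian modules: a submodule of
  the span of \<open>insert g G\<close> is controlled by its intersection with the span of
  \<open>G\<close> and by the left ideal of coefficients that \<open>g\<close> takes in it.\<close>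

lemma hom_noetherian_of_finite:
  assumes noeth: "hom_noetherian R R id" and "finite G" "G \<subseteq> carrier S"
    and gen: "generates G (carrier S)"
  shows "hom_noetherian R S h"
proof -
  have "\<forall>N. submod N \<and> N \<subseteq> spanned G \<longrightarrow> (\<exists>F\<subseteq>N. finite F \<and> generates F N)"
    using assms(2,3)
  proof (induction G)
    case empty
    have "submod {\<zero>\<^bsub>S\<^esub>}" by (rule hom_submoduleI) auto
    then have *: "spanned {} \<subseteq> {\<zero>\<^bsub>S\<^esub>}" unfolding hom_span_def by blast
    show ?case
    proof (intro allI impI, elim conjE)
      fix N assume "submod N" "N \<subseteq> spanned {}"
      then have "N \<subseteq> {\<zero>\<^bsub>S\<^esub>}" using * by blast
      then have "generates {} N"
        unfolding hom_generates_def hom_submodule_def by blast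
      then show "\<exists>F\<subseteq>N. finite F \<and> generates F N" by blast
    qed
  next
    case (insert g G)
    then have g: "g \<in> carrier S" and G: "G \<subseteq> carrier S" by auto
    note W = hom_span_properties(1)[OF G]
    note DW = hom_submoduleD[OF W]
    let ?W = "spanned G"
    show ?case
    proof (intro allI impI, elim conjE)
      fix N assume N: "submod N" and NW: "N \<subseteq> spanned (insert g G)"
      note DN = hom_submoduleD[OF N]
      \<comment> \<open>The coefficients of \<open>g\<close> in \<open>N'\<close> modulo the span of
        \<open>G\<close>. They are defined for every \<open>N'\<close>, since they are needed for
        \<open>N\<close> and for \<open>N \<inter> N'\<close>.\<close>
      define J where "J N' = {b \<in> carrier R. \<exists>w\<in>?W. b \<bullet> g \<oplus>\<^bsub>S\<^esub> w \<in> N'}" for N'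
      have J: "hom_submodule R R id (J N')" if N': "submod N'" for N'
      proof (rule hom_submoduleI)
        note D = hom_submoduleD[OF N']
        show "J N' \<subseteq> carrier R" by (auto simp: J_def)
        have "\<zero> \<bullet> g \<oplus>\<^bsub>S\<^esub> \<zero>\<^bsub>S\<^esub> \<in> N'" using g D(2) by simp
        then show "\<zero> \<in> J N'" using DW(2) by (auto simp: J_def)
      next
        fix x y assume "x \<in> J N'" "y \<in> J N'"
        then obtain w v where *: "x \<in> carrier R" "y \<in> carrier R" "w \<in> ?W" "v \<in> ?W"
            "x \<bullet> g \<oplus>\<^bsub>S\<^esub> w \<in> N'" "y \<bullet> g \<oplus>\<^bsub>S\<^esub> v \<in> N'" by (auto simp: J_def)
        have "(x \<oplus> y) \<bullet> g \<oplus>\<^bsub>S\<^esub> (w \<oplus>\<^bsub>S\<^esub> v) = (x \<bullet> g \<oplus>\<^bsub>S\<^esub> w) \<oplus>\<^bsub>S\<^esub> (y \<bullet> g \<oplus>\<^bsub>S\<^esub> v)"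
          using * DW(5) g by (simp add: S.l_distr S.a_ac)
        then have "(x \<oplus> y) \<bullet> g \<oplus>\<^bsub>S\<^esub> (w \<oplus>\<^bsub>S\<^esub> v) \<in> N'"
          using hom_submoduleD(3)[OF N'] * by simp
        then show "x \<oplus> y \<in> J N'" using DW(3) * by (auto simp: J_def)
      next
        fix b x assume b: "b \<in> carrier R" and "x \<in> J N'"
        then obtain w where *: "x \<in> carrier R" "w \<in> ?W" "x \<bullet> g \<oplus>\<^bsub>S\<^esub> w \<in> N'" by (auto simp: J_def)
        have "(b \<otimes> x) \<bullet> g \<oplus>\<^bsub>S\<^esub> b \<bullet> w = b \<bullet> (x \<bullet> g \<oplus>\<^bsub>S\<^esub> w)"
          using * DW(5) g b by (simp add: S.r_distr S.m_assoc)
        then have "(b \<otimes> x) \<bullet> g \<oplus>\<^bsub>S\<^esub> b \<bullet> w \<in> N'"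
          using hom_submoduleD(4)[OF N' b] * by simp
        then show "id b \<otimes> x \<in> J N'" using DW(4) * b by (auto simp: J_def)
      qed
      obtain Fj where Fj: "Fj \<subseteq> J N" "finite Fj" "hom_generates R R id Fj (J N)"
        using noeth J[OF N] unfolding hom_noetherian_def by blast
      have "\<forall>b\<in>Fj. \<exists>w\<in>?W. b \<bullet> g \<oplus>\<^bsub>S\<^esub> w \<in> N" using Fj(1) by (auto simp: J_def)
      then obtain w where w: "\<And>b. b \<in> Fj \<Longrightarrow> w b \<in> ?W" "\<And>b. b \<in> Fj \<Longrightarrow> b \<bullet> g \<oplus>\<^bsub>S\<^esub> w b \<in> N"
        by metis
      obtain F where F: "F \<subseteq> N \<inter> ?W" "finite F" "generates F (N \<inter> ?W)"
        using insert.IH[OF G] hom_submodule_Int[OF N W] by (metis Int_lower2)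
      let ?F = "(\<lambda>b. b \<bullet> g \<oplus>\<^bsub>S\<^esub> w b) ` Fj \<union> F"
      have "generates ?F N"
        unfolding hom_generates_def
      proof (intro allI impI subsetI, elim conjE)
        fix N' n assume N': "submod N'" and FN': "?F \<subseteq> N'" and n: "n \<in> N"
        have I: "submod (N \<inter> N')" using hom_submodule_Int[OF N N'] .
        have "Fj \<subseteq> J (N \<inter> N')"
        proof
          fix b assume b: "b \<in> Fj"
          then have "b \<bullet> g \<oplus>\<^bsub>S\<^esub> w b \<in> N \<inter> N'" using w(2) FN' by blast
          then show "b \<in> J (N \<inter> N')" using b Fj(1) w(1) unfolding J_def by blast
        qed
        then have JJ: "J N \<subseteq> J (N \<inter> N')" using Fj(3) J[OF I] unfolding hom_generates_def by blast
        have NN': "N \<inter> ?W \<subseteq> N'" using F(3) FN' N' unfolding hom_generates_def by blast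
        obtain b v where b: "b \<in> carrier R" "v \<in> ?W" "n = b \<bullet> g \<oplus>\<^bsub>S\<^esub> v"
          using n NW hom_span_insert[OF g G] by blast
        then have "b \<in> J N" using n by (auto simp: J_def)
        then obtain u where u: "u \<in> ?W" "b \<bullet> g \<oplus>\<^bsub>S\<^esub> u \<in> N \<inter> N'" using JJ by (auto simp: J_def)
        let ?m = "b \<bullet> g \<oplus>\<^bsub>S\<^esub> u"
        have c: "b \<bullet> g \<in> carrier S" "u \<in> carrier S" "v \<in> carrier S" using b u g DW(5) by auto
        then have "n \<ominus>\<^bsub>S\<^esub> ?m = v \<ominus>\<^bsub>S\<^esub> u"
          unfolding b(3) by (simp add: a_minus_def S.minus_add S.a_ac S.r_neg S.r_neg1 S.r_neg2)
        moreover have "n \<ominus>\<^bsub>S\<^esub> ?m \<in> N" using hom_submodule_diff[OF N] n u(2) by blast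
        moreover have "v \<ominus>\<^bsub>S\<^esub> u \<in> ?W" using hom_submodule_diff[OF W] b u by blast
        ultimately have "n \<ominus>\<^bsub>S\<^esub> ?m \<in> N'" using NN' by auto
        then have "(n \<ominus>\<^bsub>S\<^esub> ?m) \<oplus>\<^bsub>S\<^esub> ?m \<in> N'" using hom_submoduleD(3)[OF N'] u(2) by blast
        moreover have "(n \<ominus>\<^bsub>S\<^esub> ?m) \<oplus>\<^bsub>S\<^esub> ?m = n"
          using c DN(5)[OF n] by (simp add: a_minus_def S.a_assoc S.l_neg)
        ultimately show "n \<in> N'" by simp
      qed
      moreover have "?F \<subseteq> N" "finite ?F" using F Fj(2) w(2) by auto
      ultimately show "\<exists>F\<subseteq>N. finite F \<and> generates F N" by blast
    qed
  qed
  moreover have "carrier S \<subseteq> spanned G"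
    using gen hom_span_properties[OF assms(3)] unfolding hom_generates_def by blast
  ultimately show ?thesis
    unfolding hom_noetherian_def by (meson hom_submoduleD(1) subset_trans)
qed

end

section \<open>Left noetherian rings in terms of submodules\<close>

lemma (in ring) left_noetherian_iff: "left_noetherian_ring R \<longleftrightarrow> hom_noetherian R R id"
proof
  assume "left_noetherian_ring R"
  then interpret N: left_noetherian_ring R .
  show "hom_noetherian R R id"
    unfolding hom_noetherian_def
  proof (intro allI impI)
    fix I assume I: "hom_submodule R R id I"
    then obtain F where F: "F \<subseteq> carrier R" "finite F" "I = gen_left_ideal R F"
      using N.finitely_gen_left left_ideal_iff_hom_submodule by blast
    have "F \<subseteq> I" "hom_generates R R id F I"
      unfolding F(3) gen_left_ideal_def hom_generates_def left_ideal_iff_hom_submodule by blast+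
    then show "\<exists>F\<subseteq>I. finite F \<and> hom_generates R R id F I" using F(2) by blast
  qed
next
  assume N: "hom_noetherian R R id"
  show "left_noetherian_ring R"
  proof
    fix I assume "left_ideal I R"
    then have I: "hom_submodule R R id I" by (simp add: left_ideal_iff_hom_submodule)
    then obtain F where F: "F \<subseteq> I" "finite F" "hom_generates R R id F I"
      using N unfolding hom_noetherian_def by blast
    have "I = gen_left_ideal R F"
      unfolding gen_left_ideal_def left_ideal_iff_hom_submodule
      using F I unfolding hom_generates_def by blast
    then show "\<exists>S\<subseteq>carrier R. finite S \<and> I = gen_left_ideal R S"
      using F hom_submoduleD(1)[OF I] by blast
  qed
qed

lemma (in ring_hom_ring) hom_noetherian_imp_left_noetherian:
  assumes "hom_noetherian R S h"
  shows "hom_noetherian S S id"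
  unfolding hom_noetherian_def
proof (intro allI impI)
  note sub = hom_submodule_restrict
  fix N assume N: "hom_submodule S S id N"
  then obtain F where "F \<subseteq> N" "finite F" "hom_generates R S h F N"
    using sub assms unfolding hom_noetherian_def by blast
  then show "\<exists>F\<subseteq>N. finite F \<and> hom_generates S S id F N"
    using sub unfolding hom_generates_def by blast
qed

section \<open>Bounded rings and Gabriel's condition\<close>

lemma (in ring) ideal_iff_hom_submodule:
  "ideal I R \<longleftrightarrow> hom_submodule R R id I \<and> (\<forall>a\<in>I. \<forall>x\<in>carrier R. a \<otimes> x \<in> I)"
proof
  assume "ideal I R"
  then interpret ideal I R .
  show "hom_submodule R R id I \<and> (\<forall>a\<in>I. \<forall>x\<in>carrier R. a \<otimes> x \<in> I)"
    using I_l_closed I_r_closed by (simp add: hom_submodule_def subset_iff)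
next
  assume I: "hom_submodule R R id I \<and> (\<forall>a\<in>I. \<forall>x\<in>carrier R. a \<otimes> x \<in> I)"
  then interpret left_ideal I R by (simp add: left_ideal_iff_hom_submodule)
  show "ideal I R"
    using I by unfold_locales (auto simp: left_closed)
qed

lemma ideal_hom_submodule:
  assumes "ideal I R" shows "hom_submodule R R id I"
  using assms ring.ideal_iff_hom_submodule ideal.axioms(2) by blast

text \<open>Left boundedness of a quotient \<open>R / K\<close>, expressed by left ideals of \<open>R\<close> containing \<open>K\<close>.\<close>

definition left_bounded_over :: "('a, 'm) ring_scheme \<Rightarrow> 'a set \<Rightarrow> bool" where
  "left_bounded_over R K \<longleftrightarrow>
     (\<forall>E. hom_submodule R R id E \<and> K \<subseteq> E \<and>
        (\<forall>J. hom_submodule R R id J \<and> K \<subset> J \<longrightarrow> \<not> E \<inter> J \<subseteq> K) \<longrightarrow>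
        (\<exists>I. ideal I R \<and> K \<subset> I \<and> I \<subseteq> E))"

context ring_hom_ring
begin

lemma hom_submodule_vimage_id:
  assumes "hom_submodule S S id N"
  shows "hom_submodule R R id {x \<in> carrier R. h x \<in> N}"
  using hom_submoduleD[OF assms] by (auto intro!: hom_submoduleI)

lemma hom_submodule_image_id:
  assumes "hom_submodule R R id N" and surj: "carrier S = h ` carrier R"
  shows "hom_submodule S S id (h ` N)"
proof -
  note D = hom_submoduleD[OF assms(1), simplified]
  show ?thesis
  proof (rule hom_submoduleI)
    show "h ` N \<subseteq> carrier S" using D(5) by auto
    show "\<zero>\<^bsub>S\<^esub> \<in> h ` N" using D(2) hom_zero by (metis image_eqI)
  next
    fix x y assume "x \<in> h ` N" "y \<in> h ` N"
    then obtain a b where *: "a \<in> N" "b \<in> N" "x = h a" "y = h b" by blast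
    then have "x \<oplus>\<^bsub>S\<^esub> y = h (a \<oplus> b)" using D(5) by simp
    then show "x \<oplus>\<^bsub>S\<^esub> y \<in> h ` N" using D(3) * by blast
  next
    fix x y assume "x \<in> carrier S" "y \<in> h ` N"
    then obtain a b where *: "a \<in> carrier R" "b \<in> N" "x = h a" "y = h b" using surj by blast
    then have "id x \<otimes>\<^bsub>S\<^esub> y = h (a \<otimes> b)" using D(5) by simp
    then show "id x \<otimes>\<^bsub>S\<^esub> y \<in> h ` N" using D(4) * by blast
  qed
qed

text \<open>The correspondence between left ideals of \<open>S\<close> and left ideals of
  \<open>R\<close> above the kernel. With an arbitrary surjection, the cosets of a quotient ring
  enter only in the computation of the kernel.\<close>

lemma left_bounded_surj_iff:
  assumes surj: "carrier S = h ` carrier R"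
  shows "left_bounded S \<longleftrightarrow> left_bounded_over R {x \<in> carrier R. h x = \<zero>\<^bsub>S\<^esub>}"
    (is "_ \<longleftrightarrow> left_bounded_over R ?K")
proof
  assume lb: "left_bounded S"
  show "left_bounded_over R ?K"
    unfolding left_bounded_over_def
  proof (intro allI impI, elim conjE)
    fix E assume E: "hom_submodule R R id E" and KE: "?K \<subseteq> E"
      and ess: "\<forall>J. hom_submodule R R id J \<and> ?K \<subset> J \<longrightarrow> \<not> E \<inter> J \<subseteq> ?K"
    have "essential_left_ideal (h ` E) S"
      unfolding essential_left_ideal_def S.left_ideal_iff_hom_submodule
    proof (intro conjI allI impI)
      show "hom_submodule S S id (h ` E)" by (rule hom_submodule_image_id[OF E surj])
      fix J assume "hom_submodule S S id J \<and> J \<noteq> {\<zero>\<^bsub>S\<^esub>}"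
      then have J: "hom_submodule S S id J" and "J \<noteq> {\<zero>\<^bsub>S\<^esub>}" by auto
      let ?J = "{x \<in> carrier R. h x \<in> J}"
      obtain y where y: "y \<in> J" "y \<noteq> \<zero>\<^bsub>S\<^esub>" using \<open>J \<noteq> {\<zero>\<^bsub>S\<^esub>}\<close> hom_submoduleD(2)[OF J] by blast
      then obtain x where "x \<in> carrier R" "y = h x" using hom_submoduleD(5)[OF J] surj by blast
      then have "?K \<subset> ?J" using y hom_submoduleD(2)[OF J] by force
      then have "\<not> E \<inter> ?J \<subseteq> ?K" using ess hom_submodule_vimage_id[OF J] by blast
      then obtain x where "x \<in> E" "x \<in> ?J" "h x \<noteq> \<zero>\<^bsub>S\<^esub>" by blast
      then show "h ` E \<inter> J \<noteq> {\<zero>\<^bsub>S\<^esub>}" by blast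
    qed
    then obtain I where I: "ideal I S" "I \<noteq> {\<zero>\<^bsub>S\<^esub>}" "I \<subseteq> h ` E"
      using lb unfolding left_bounded_def by blast
    let ?I = "{x \<in> carrier R. h x \<in> I}"
    note IS = ideal_hom_submodule[OF I(1)]
    have "ideal ?I R"
      using hom_submodule_vimage_id[OF IS] I(1)[unfolded S.ideal_iff_hom_submodule]
      unfolding R.ideal_iff_hom_submodule by auto
    moreover have "?K \<subset> ?I"
    proof -
      obtain y where y: "y \<in> I" "y \<noteq> \<zero>\<^bsub>S\<^esub>" using I(2) hom_submoduleD(2)[OF IS] by blast
      then obtain x where "x \<in> carrier R" "y = h x" using hom_submoduleD(5)[OF IS] surj by blast
      then show ?thesis using y hom_submoduleD(2)[OF IS] by force
    qed
    moreover have "?I \<subseteq> E"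
    proof
      fix x assume x: "x \<in> ?I"
      then obtain e where e: "e \<in> E" "h x = h e" using I(3) by blast
      have ec: "e \<in> carrier R" using hom_submoduleD(5)[OF E e(1)] .
      have "h (x \<ominus> e) = \<zero>\<^bsub>S\<^esub>" using e ec x by (simp add: a_minus_def S.r_neg)
      then have "x \<ominus> e \<in> E" using KE x ec by auto
      then have "(x \<ominus> e) \<oplus> e \<in> E" using hom_submoduleD(3)[OF E] e(1) by blast
      then show "x \<in> E" using x ec by (simp add: a_minus_def R.a_assoc R.l_neg)
    qed
    ultimately show "\<exists>I. ideal I R \<and> ?K \<subset> I \<and> I \<subseteq> E" by blast
  qed
next
  assume lb: "left_bounded_over R ?K"
  show "left_bounded S"
    unfolding left_bounded_def
  proof (intro allI impI)
    fix E assume "essential_left_ideal E S"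
    then have E: "hom_submodule S S id E"
      and ess: "\<And>J. hom_submodule S S id J \<Longrightarrow> J \<noteq> {\<zero>\<^bsub>S\<^esub>} \<Longrightarrow> E \<inter> J \<noteq> {\<zero>\<^bsub>S\<^esub>}"
      unfolding essential_left_ideal_def S.left_ideal_iff_hom_submodule by blast+
    let ?E = "{x \<in> carrier R. h x \<in> E}"
    have "\<not> ?E \<inter> J \<subseteq> ?K" if J: "hom_submodule R R id J" "?K \<subset> J" for J
    proof -
      obtain x where x: "x \<in> J" "x \<notin> ?K" using J(2) by blast
      then have "h ` J \<noteq> {\<zero>\<^bsub>S\<^esub>}" using hom_submoduleD(5)[OF J(1)] by blast
      from ess[OF hom_submodule_image_id[OF J(1) surj] this]
      obtain y where "y \<in> E" "y \<in> h ` J" "y \<noteq> \<zero>\<^bsub>S\<^esub>"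
        using hom_submoduleD(2)[OF E] hom_submoduleD(2)[OF hom_submodule_image_id[OF J(1) surj]] by blast
      then show ?thesis using hom_submoduleD(5)[OF J(1)] by blast
    qed
    moreover have "?K \<subseteq> ?E" using hom_submoduleD(2)[OF E] by auto
    ultimately obtain I where I: "ideal I R" "?K \<subset> I" "I \<subseteq> ?E"
      using lb[unfolded left_bounded_over_def, rule_format, of ?E] hom_submodule_vimage_id[OF E] by blast
    note IR = ideal_hom_submodule[OF I(1)]
    have "ideal (h ` I) S"
      unfolding S.ideal_iff_hom_submodule
    proof (intro conjI ballI)
      show "hom_submodule S S id (h ` I)" by (rule hom_submodule_image_id[OF IR surj])
      fix a x assume "a \<in> h ` I" "x \<in> carrier S"
      then obtain b y where *: "b \<in> I" "a = h b" "y \<in> carrier R" "x = h y" using surj by blast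
      then have "a \<otimes>\<^bsub>S\<^esub> x = h (b \<otimes> y)" using hom_submoduleD(5)[OF IR] by simp
      then show "a \<otimes>\<^bsub>S\<^esub> x \<in> h ` I" using I(1) * unfolding R.ideal_iff_hom_submodule by blast
    qed
    moreover have "h ` I \<noteq> {\<zero>\<^bsub>S\<^esub>}" using I(2) hom_submoduleD(5)[OF IR] by blast
    moreover have "h ` I \<subseteq> E" using I(3) by blast
    ultimately show "\<exists>I. ideal I S \<and> I \<noteq> {\<zero>\<^bsub>S\<^esub>} \<and> I \<subseteq> E" by blast
  qed
qed

end

lemma (in ideal) left_bounded_quotient_iff:
  "left_bounded (R Quot I) \<longleftrightarrow> left_bounded_over R I"
proof -
  interpret Q: ring_hom_ring R "R Quot I" "(+>) I" by (rule rcos_ring_hom_ring)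
  have "carrier (R Quot I) = (+>) I ` carrier R"
    by (auto simp: FactRing_def A_RCOSETS_def' a_r_coset_def')
  moreover have "{x \<in> carrier R. I +> x = \<zero>\<^bsub>R Quot I\<^esub>} = I"
  proof -
    have "I +> x = I \<longleftrightarrow> x \<in> I" if "x \<in> carrier R" for x
      using that rcos_const_imp_mem a_rcos_const by blast
    then have "{x \<in> carrier R. I +> x = I} = I" using a_Hcarr by blast
    moreover have "\<zero>\<^bsub>R Quot I\<^esub> = I" unfolding FactRing_def by simp
    ultimately show ?thesis by (simp only:)
  qed
  ultimately show ?thesis using Q.left_bounded_surj_iff[OF \<open>_ = (+>) I ` _\<close>] by metis
qed

lemma left_fully_bounded_iff:
  "left_fully_bounded R \<longleftrightarrow> (\<forall>P. prime_two_sided_ideal P R \<longrightarrow> left_bounded_over R P)"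
proof -
  have "left_bounded (R Quot P) \<longleftrightarrow> left_bounded_over R P" if "prime_two_sided_ideal P R" for P
    using that ideal.left_bounded_quotient_iff[of P R] unfolding prime_two_sided_ideal_def by blast
  then show ?thesis by (simp add: left_fully_bounded_def)
qed

section \<open>Gabriel's condition and full boundedness\<close>

lemma (in ring_hom_ring) hom_submodule_ideal_colon:
  assumes I: "ideal I R" and N: "submod N"
  shows "submod {y \<in> carrier S. \<forall>i\<in>I. i \<bullet> y \<in> N}"
proof (rule hom_submoduleI)
  let ?W = "{y \<in> carrier S. \<forall>i\<in>I. i \<bullet> y \<in> N}"
  note DI = hom_submoduleD(5)[OF ideal_hom_submodule[OF I]] and DN = hom_submoduleD[OF N]
  show "\<zero>\<^bsub>S\<^esub> \<in> ?W" using DI DN(2) by simp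
  show "x \<oplus>\<^bsub>S\<^esub> y \<in> ?W" if "x \<in> ?W" "y \<in> ?W" for x y
    using that DI DN(3) by (simp add: S.r_distr)
  show "b \<bullet> x \<in> ?W" if b: "b \<in> carrier R" and x: "x \<in> ?W" for b x
  proof -
    have "i \<bullet> (b \<bullet> x) = (i \<otimes> b) \<bullet> x" if "i \<in> I" for i
      using DI[OF that] b x by (simp add: S.m_assoc)
    then show ?thesis using b x ideal.I_r_closed[OF I _ b] by simp
  qed
qed auto

text \<open>Every finitely generated left module has the same annihilator as one of its finite subsets;
  it is enough to consider the cyclic modules \<open>R / X\<close>.\<close>

definition gabriel_condition :: "('a, 'm) ring_scheme \<Rightarrow> bool" where
  "gabriel_condition R \<longleftrightarrow>
     (\<forall>X. hom_submodule R R id X \<longrightarrow> (\<exists>F\<subseteq>carrier R. finite F \<and>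
        (\<forall>s\<in>carrier R. (\<forall>f\<in>F. s \<otimes>\<^bsub>R\<^esub> f \<in> X) \<longrightarrow> (\<forall>t\<in>carrier R. s \<otimes>\<^bsub>R\<^esub> t \<in> X))))"

text \<open>The largest two-sided ideal \<open>I\<close> inside \<open>E\<close> consists of the
  \<open>s\<close> with \<open>s R\<close> in \<open>E\<close>. Gabriel's condition describes it by
  finitely many conditions \<open>s \<otimes> f \<in> E\<close>, each of which cuts out a left ideal
  essential modulo \<open>P\<close>; a finite intersection of such left ideals is still larger than
  \<open>P\<close>.\<close>

theorem (in ring) gabriel_condition_imp_left_fully_bounded:
  assumes "gabriel_condition R"
  shows "left_fully_bounded R"
  unfolding left_fully_bounded_iff left_bounded_over_def
proof (intro allI impI, elim conjE)
  fix P E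
  assume "prime_two_sided_ideal P R" and E: "hom_submodule R R id E" and PE: "P \<subseteq> E"
    and ess: "\<forall>J. hom_submodule R R id J \<and> P \<subset> J \<longrightarrow> \<not> E \<inter> J \<subseteq> P"
  then have P: "ideal P R" "P \<noteq> carrier R" by (auto simp: prime_two_sided_ideal_def)
  note PS = ideal_hom_submodule[OF P(1)]
  note DP = hom_submoduleD[OF PS, simplified] and DE = hom_submoduleD[OF E, simplified]
  obtain F where F: "F \<subseteq> carrier R" "finite F"
    "\<And>s. s \<in> carrier R \<Longrightarrow> (\<forall>f\<in>F. s \<otimes> f \<in> E) \<Longrightarrow> (\<forall>t\<in>carrier R. s \<otimes> t \<in> E)"
  proof -
    from assms[unfolded gabriel_condition_def, rule_format, OF E] that show ?thesis by metis
  qed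
  have Pr: "p \<otimes> x \<in> P" if "p \<in> P" "x \<in> carrier R" for p x
    using ideal.I_r_closed[OF P(1)] that by blast
  interpret idhom: ring_hom_ring R R id by (rule id_ring_hom_ring)
  define I where "I = {s \<in> carrier R. \<forall>t\<in>carrier R. s \<otimes> t \<in> E}"
  have "ideal I R"
    unfolding ideal_iff_hom_submodule
  proof (intro conjI ballI)
    show "hom_submodule R R id I"
      using idhom.hom_submodule_residual[OF E subset_refl] by (simp add: I_def)
    show "a \<otimes> x \<in> I" if "a \<in> I" "x \<in> carrier R" for a x
      using that by (auto simp: I_def m_assoc)
  qed
  moreover have "I \<subseteq> E"
  proof
    fix x assume "x \<in> I"
    then have "x \<in> carrier R" "x \<otimes> \<one> \<in> E" unfolding I_def using one_closed by blast+
    then show "x \<in> E" by simp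
  qed
  moreover have "P \<subseteq> I"
    using Pr PE DP(5) by (auto simp: I_def)
  moreover have "I \<noteq> P"
  proof -
    \<comment> \<open>Quantifying over all \<open>J\<close> above \<open>P\<close> states
      essentiality of the finite intersection, which is the form that the induction on
      \<open>F\<close> needs.\<close>
    have "\<exists>x\<in>J. x \<notin> P \<and> (\<forall>f\<in>F. x \<otimes> f \<in> E)"
      if "hom_submodule R R id J" "P \<subset> J" for J
      using F(2,1) that
    proof (induction F arbitrary: J)
      case empty then show ?case by blast
    next
      case (insert f F)
      then have f: "f \<in> carrier R" and FR: "F \<subseteq> carrier R" by auto
      note DJ = hom_submoduleD[OF insert.prems(2), simplified]
      let ?J = "{x \<in> J. \<forall>f\<in>F. x \<otimes> f \<in> E}"
      have "?J = J \<inter> {x \<in> carrier R. \<forall>f\<in>F. id x \<otimes> f \<in> E}" using DJ(5) by auto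
      then have J': "hom_submodule R R id ?J"
        using idhom.hom_submodule_Int[OF insert.prems(2) idhom.hom_submodule_residual[OF E FR]] by simp
      have PJ': "P \<subseteq> ?J" using insert.prems(3) Pr PE FR by blast
      obtain x where x: "x \<in> ?J" "x \<notin> P" using insert.IH[OF FR insert.prems(2,3)] by blast
      show ?case
      proof (cases "x \<otimes> f \<in> P")
        case True then show ?thesis using x PE by blast
      next
        case False
        let ?K = "{y \<oplus> p | y p. y \<in> {id b \<otimes> f | b. b \<in> ?J} \<and> p \<in> P}"
        have K: "hom_submodule R R id ?K"
          by (rule idhom.hom_submodule_set_add[OF idhom.hom_submodule_multiples[OF J' f] PS])
        have "p = id \<zero> \<otimes> f \<oplus> p" if "p \<in> P" for p using f DP(5)[OF that] by simp
        then have "P \<subseteq> ?K" using hom_submoduleD(2)[OF J'] by blast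
        moreover have "x \<otimes> f \<in> ?K"
        proof -
          have "x \<otimes> f = id x \<otimes> f \<oplus> \<zero>" using x(1) DJ(5) f by simp
          then show ?thesis using x(1) DP(2) by blast
        qed
        ultimately have "P \<subset> ?K" using False by blast
        then have "\<not> E \<inter> ?K \<subseteq> P" using ess K by blast
        then obtain y p where y: "y \<in> ?J" "p \<in> P" "y \<otimes> f \<oplus> p \<in> E" "y \<otimes> f \<oplus> p \<notin> P" by auto
        have c: "y \<in> carrier R" "p \<in> carrier R" using y DJ(5) DP(5) by auto
        have "(y \<otimes> f \<oplus> p) \<ominus> p \<in> E" using idhom.hom_submodule_diff[OF E y(3)] y(2) PE by blast
        moreover have "(y \<otimes> f \<oplus> p) \<ominus> p = y \<otimes> f" using c f by (simp add: a_minus_def a_assoc r_neg)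
        ultimately have "y \<otimes> f \<in> E" by simp
        moreover have "y \<notin> P" using Pr[of y f] y f DP(3) by blast
        ultimately show ?thesis using y(1) by blast
      qed
    qed
    from this[OF idhom.hom_submodule_carrier]
    obtain x where "x \<in> carrier R" "x \<notin> P" "\<forall>f\<in>F. x \<otimes> f \<in> E" using P(2) DP(1) by blast
    then have "x \<in> I" "x \<notin> P" using F(3) by (auto simp: I_def)
    then show ?thesis by blast
  qed
  ultimately show "\<exists>I. ideal I R \<and> P \<subset> I \<and> I \<subseteq> E" by blast
qed


theorem (in ring_hom_ring) left_fully_bounded_imp_gabriel_condition:
  assumes noethR: "hom_noetherian R R id" and lfb: "left_fully_bounded R"
    and noeth: "hom_noetherian R S h"
  shows "gabriel_condition S"
  unfolding gabriel_condition_def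
proof (intro allI impI)
  fix X assume X: "hom_submodule S S id X"
  note DX = hom_submoduleD[OF X, simplified]
  define C where "C = {s \<in> carrier S. \<forall>t\<in>carrier S. s \<otimes>\<^bsub>S\<^esub> t \<in> X}"
  define ann where "ann F = {s \<in> carrier S. \<forall>f\<in>F. s \<otimes>\<^bsub>S\<^esub> f \<in> X}" for F
  interpret idR: ring_hom_ring R R id by (rule R.id_ring_hom_ring)
  have ann: "submod (ann F)" if "F \<subseteq> carrier S" for F
    using hom_submodule_restrict[OF ring_hom_ring.hom_submodule_residual[OF S.id_ring_hom_ring X that]]
    by (simp add: ann_def)
  have C_ann: "C = ann (carrier S)" by (simp add: C_def ann_def)
  have C: "submod C" unfolding C_ann by (rule ann) simp
  note DC = hom_submoduleD[OF C]
  have CX: "c \<otimes>\<^bsub>S\<^esub> t \<in> X" if "c \<in> C" "t \<in> carrier S" for c t using that by (auto simp: C_def)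
  have Cr: "c \<otimes>\<^bsub>S\<^esub> t \<in> C" if "c \<in> C" "t \<in> carrier S" for c t
    using that by (auto simp: C_def S.m_assoc)
  \<comment> \<open>The heart of the proof: above \<open>C\<close>, a single condition
    \<open>m\<close> already detects \<open>C\<close> on some nontrivial part \<open>U\<close> of
    \<open>L\<close>. If this fails, every set \<open>ann {m}\<close> is essential in
    \<open>L\<close> modulo \<open>C\<close>, and boundedness at a suitable prime \<open>P\<close>
    is contradicted.\<close>
  have step: "\<exists>m U. m \<in> carrier S \<and> submod U \<and> U \<subseteq> L \<and> \<not> U \<subseteq> C \<and> U \<inter> ann {m} \<subseteq> C"
    if L: "submod L" "\<not> L \<subseteq> C" for L
  proof (rule ccontr)
    assume neg: "\<not> ?thesis"
    have meets: "\<exists>x\<in>U. x \<otimes>\<^bsub>S\<^esub> m \<in> X \<and> x \<notin> C"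
      if "submod U" "U \<subseteq> L" "\<not> U \<subseteq> C" "m \<in> carrier S" for U m
    proof -
      from neg that obtain x where "x \<in> U" "x \<in> ann {m}" "x \<notin> C" by blast
      then show ?thesis by (auto simp: ann_def)
    qed
    define ker where "ker U = {r \<in> carrier R. \<forall>u\<in>U. r \<bullet> u \<in> C}" for U
    \<comment> \<open>A maximal annihilator of a nontrivial submodule modulo \<open>C\<close>,
      chosen because it is prime, as for associated primes.\<close>
    let ?C = "{ker U | U. submod U \<and> U \<subseteq> L \<and> \<not> U \<subseteq> C}"
    have ker: "hom_submodule R R id (ker U)" if U: "submod U" for U
      unfolding ker_def by (rule hom_submodule_residual[OF C hom_submoduleD(1)[OF U]])
    have sub: "hom_submodule R R id N" if "N \<in> ?C" for N using ker that by blast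
    have "?C \<noteq> {}" using L by blast
    from idR.hom_noetherian_maximal[OF noethR sub this]
    obtain P where P: "P \<in> ?C" and max: "\<And>N. N \<in> ?C \<Longrightarrow> P \<subseteq> N \<Longrightarrow> N = P" by blast
    then obtain U where U: "submod U" "U \<subseteq> L" "\<not> U \<subseteq> C" and PU: "P = ker U" by blast
    note DU = hom_submoduleD[OF U(1)]
    have idealP: "ideal P R"
      unfolding R.ideal_iff_hom_submodule
    proof (intro conjI ballI)
      show "hom_submodule R R id P" unfolding PU by (rule ker[OF U(1)])
      show "a \<otimes> x \<in> P" if "a \<in> P" "x \<in> carrier R" for a x
        using that DU(4,5) by (simp add: PU ker_def S.m_assoc)
    qed
    have "\<one> \<notin> P"
      using U(3) DU(5) by (auto simp: PU ker_def subset_iff)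
    then have "P \<noteq> carrier R" by blast
    have primeP: "prime_two_sided_ideal P R"
      unfolding prime_two_sided_ideal_def
    proof (intro conjI allI impI)
      fix I J assume "ideal I R \<and> ideal J R \<and> (\<forall>a\<in>I. \<forall>b\<in>J. a \<otimes> b \<in> P)"
      then have I: "ideal I R" and J: "ideal J R" and IJ: "\<And>a b. a \<in> I \<Longrightarrow> b \<in> J \<Longrightarrow> a \<otimes> b \<in> P" by auto
      note DI = hom_submoduleD[OF ideal_hom_submodule[OF I]] and DJ = hom_submoduleD[OF ideal_hom_submodule[OF J]]
      show "I \<subseteq> P \<or> J \<subseteq> P"
      proof (rule disjCI)
        assume JP: "\<not> J \<subseteq> P"
        \<comment> \<open>If \<open>J\<close> is not inside \<open>P\<close>, the submodule spanned
          by \<open>J U\<close> is nontrivial modulo \<open>C\<close>. Its annihilator contains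
          \<open>P\<close>, hence equals \<open>P\<close> by maximality, and \<open>I\<close>
          annihilates it.\<close>
        let ?Z = "{j \<bullet> u | j u. j \<in> J \<and> u \<in> U}"
        have ZU: "?Z \<subseteq> U" using DU(4) DJ(5) by blast
        then have ZS: "?Z \<subseteq> carrier S" using DU(1) by blast
        define V where "V = spanned ?Z"
        note V = hom_span_properties[OF ZS, folded V_def]
        have VU: "V \<subseteq> U" using V(3) U(1) ZU unfolding hom_generates_def by blast
        have "\<not> V \<subseteq> C"
        proof
          assume "V \<subseteq> C"
          have "j \<in> P" if j: "j \<in> J" for j
          proof -
            have "j \<bullet> u \<in> C" if "u \<in> U" for u
              using j that V(2) \<open>V \<subseteq> C\<close> by blast
            then show ?thesis using DJ(5)[OF j] by (simp add: PU ker_def)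
          qed
          then show False using JP by blast
        qed
        then have "ker V \<in> ?C" using V(1) VU U(2) by blast
        moreover have "P \<subseteq> ker V" using VU by (auto simp: PU ker_def)
        ultimately have PV: "ker V = P" using max by blast
        let ?W = "{y \<in> carrier S. \<forall>i\<in>I. i \<bullet> y \<in> C}"
        have "submod ?W" by (rule hom_submodule_ideal_colon[OF I C])
        moreover have "?Z \<subseteq> ?W"
        proof
          fix z assume "z \<in> ?Z"
          then obtain j u where z: "z = j \<bullet> u" "j \<in> J" "u \<in> U" by blast
          have "i \<bullet> z \<in> C" if i: "i \<in> I" for i
          proof -
            have "i \<bullet> z = (i \<otimes> j) \<bullet> u"
              using DI(5)[OF i] DJ(5) DU(5) z by (simp add: S.m_assoc)
            then show ?thesis using IJ[OF i z(2)] z(3) by (simp add: PU ker_def)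
          qed
          then show "z \<in> ?W" using z ZS \<open>z \<in> ?Z\<close> by blast
        qed
        ultimately have "V \<subseteq> ?W" using V(3) unfolding hom_generates_def by blast
        then have "I \<subseteq> ker V" using DI(5) by (auto simp: ker_def)
        then show "I \<subseteq> P" by (simp add: PV)
      qed
    qed (fact idealP \<open>P \<noteq> carrier R\<close>)+
    have bounded: "left_bounded_over R P" using lfb primeP by (simp add: left_fully_bounded_iff)
    have one: "\<exists>I. ideal I R \<and> P \<subset> I \<and> (\<forall>i\<in>I. i \<bullet> (u \<otimes>\<^bsub>S\<^esub> f) \<in> X)"
      if u: "u \<in> U" and f: "f \<in> carrier S" for u f
    proof -
      let ?E = "{r \<in> carrier R. r \<bullet> (u \<otimes>\<^bsub>S\<^esub> f) \<in> X}"
      have uS: "u \<in> carrier S" by (rule DU(5)[OF u])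
      have E: "hom_submodule R R id ?E"
        using hom_submodule_residual[OF hom_submodule_restrict[OF X], of "{u \<otimes>\<^bsub>S\<^esub> f}"] uS f by simp
      have PE: "P \<subseteq> ?E"
      proof
        fix p assume p: "p \<in> P"
        then have "p \<bullet> u \<in> C" "p \<in> carrier R" using u by (auto simp: PU ker_def)
        then show "p \<in> ?E" using CX[of "p \<bullet> u" f] f uS by (simp add: S.m_assoc)
      qed
      \<comment> \<open>Essentiality of \<open>?E\<close> over \<open>P\<close>. When
        \<open>J u\<close> is trivial modulo \<open>C\<close>, all of \<open>J\<close> lies in
        \<open>?E\<close>; otherwise the assumption \<open>meets\<close>, applied to
        \<open>J u\<close>, gives an element of \<open>J\<close> in \<open>?E\<close> outside
        \<open>P\<close>.\<close>
      have "\<not> ?E \<inter> J \<subseteq> P" if J: "hom_submodule R R id J" "P \<subset> J" for J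
      proof (cases "\<forall>j\<in>J. j \<bullet> u \<in> C")
        case True
        have "J \<subseteq> ?E"
        proof
          fix j assume j: "j \<in> J"
          then show "j \<in> ?E" using True hom_submoduleD(5)[OF J(1) j] CX[of "j \<bullet> u" f] f uS
            by (simp add: S.m_assoc)
        qed
        then show ?thesis using J(2) by blast
      next
        case False
        let ?V = "{j \<bullet> u | j. j \<in> J}"
        have V: "submod ?V" by (rule hom_submodule_multiples[OF J(1) uS])
        have "?V \<subseteq> U" using DU(4) hom_submoduleD(5)[OF J(1)] u by blast
        then have VL: "?V \<subseteq> L" using U(2) by blast
        have VC: "\<not> ?V \<subseteq> C" using False by blast
        obtain x where x: "x \<in> ?V" "x \<otimes>\<^bsub>S\<^esub> f \<in> X" "x \<notin> C"
          using meets[OF V VL VC f] by blast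
        then obtain j where j: "j \<in> J" "x = j \<bullet> u" by blast
        have jR: "j \<in> carrier R" by (rule hom_submoduleD(5)[OF J(1) j(1)])
        have "j \<in> ?E" using x(2) j jR uS f by (simp add: S.m_assoc)
        moreover have "j \<notin> P" using x(3) j(2) u by (auto simp: PU ker_def)
        ultimately show ?thesis using j(1) by blast
      qed
      then obtain I where "ideal I R" "P \<subset> I" "I \<subseteq> ?E"
        using bounded[unfolded left_bounded_over_def, rule_format, of ?E] E PE by blast
      then show ?thesis by blast
    qed
    \<comment> \<open>The ideal found in \<open>one\<close> depends on \<open>u\<close> and
      \<open>f\<close>. As the products span a finitely generated module, finitely many ideals have
      to be intersected, and primality keeps the intersection larger than \<open>P\<close>. The
      result annihilates \<open>U\<close> modulo \<open>C\<close>, although \<open>P\<close> is the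
      full annihilator of \<open>U\<close>.\<close>
    let ?Z = "{u \<otimes>\<^bsub>S\<^esub> f | u f. u \<in> U \<and> f \<in> carrier S}"
    have ZS: "?Z \<subseteq> carrier S" using DU(5) by blast
    obtain G where G: "G \<subseteq> ?Z" "finite G" "generates G (spanned ?Z)"
      using hom_noetherian_finite_subset[OF noeth ZS hom_span_properties(3)[OF ZS]] by blast
    have "\<exists>I. ideal I R \<and> P \<subset> I \<and> (\<forall>i\<in>I. \<forall>g\<in>G. i \<bullet> g \<in> X)"
      using G(2,1)
    proof (induction G)
      case empty
      show ?case
        using R.oneideal idealP \<open>P \<noteq> carrier R\<close> hom_submoduleD(1)[OF ideal_hom_submodule[OF idealP]] by blast
    next
      case (insert g G)
      then obtain I where I: "ideal I R" "P \<subset> I" "\<forall>i\<in>I. \<forall>g\<in>G. i \<bullet> g \<in> X" by blast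
      from insert.prems obtain u f where g: "g = u \<otimes>\<^bsub>S\<^esub> f" "u \<in> U" "f \<in> carrier S" by blast
      obtain J where J: "ideal J R" "P \<subset> J" "\<forall>i\<in>J. i \<bullet> (u \<otimes>\<^bsub>S\<^esub> f) \<in> X"
        using one[OF g(2,3)] by blast
      have "\<not> I \<inter> J \<subseteq> P"
      proof
        assume IJP: "I \<inter> J \<subseteq> P"
        have "a \<otimes> b \<in> P" if "a \<in> I" "b \<in> J" for a b
          using that IJP ideal.I_r_closed[OF I(1)] ideal.I_l_closed[OF J(1)]
            hom_submoduleD(5)[OF ideal_hom_submodule[OF I(1)]] hom_submoduleD(5)[OF ideal_hom_submodule[OF J(1)]]
          by blast
        then have "I \<subseteq> P \<or> J \<subseteq> P"
          using primeP I(1) J(1) unfolding prime_two_sided_ideal_def by blast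
        then show False using I(2) J(2) by blast
      qed
      then have "P \<subset> I \<inter> J" using I(2) J(2) by blast
      moreover have "ideal (I \<inter> J) R" by (rule R.i_intersect[OF I(1) J(1)])
      ultimately show ?case using I(3) J(3) g(1) by blast
    qed
    then obtain I where I: "ideal I R" "P \<subset> I" and IG: "\<And>i g. i \<in> I \<Longrightarrow> g \<in> G \<Longrightarrow> i \<bullet> g \<in> X"
      by blast
    note DI = hom_submoduleD[OF ideal_hom_submodule[OF I(1)]]
    let ?W = "{y \<in> carrier S. \<forall>i\<in>I. i \<bullet> y \<in> X}"
    have W: "submod ?W"
      by (rule hom_submodule_ideal_colon[OF I(1) hom_submodule_restrict[OF X]])
    have "G \<subseteq> ?W" using IG G(1) ZS by blast
    then have "spanned ?Z \<subseteq> ?W" using G(3) W unfolding hom_generates_def by blast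
    then have ZW: "?Z \<subseteq> ?W" using hom_span_properties(2)[OF ZS] by blast
    have "i \<in> P" if i: "i \<in> I" for i
    proof -
      have "i \<bullet> u \<in> C" if u: "u \<in> U" for u
      proof -
        have "i \<bullet> u \<otimes>\<^bsub>S\<^esub> t \<in> X" if t: "t \<in> carrier S" for t
        proof -
          have "u \<otimes>\<^bsub>S\<^esub> t \<in> ?W" using u t ZW by blast
          then show ?thesis using i t DU(5)[OF u] DI(5)[OF i] by (simp add: S.m_assoc)
        qed
        then show ?thesis using DU(5)[OF u] DI(5)[OF i] by (simp add: C_def)
      qed
      then show ?thesis using DI(5)[OF i] by (simp add: PU ker_def)
    qed
    then show False using I(2) by blast
  qed
  \<comment> \<open>The local statement \<open>step\<close> is globalised by a maximal
    \<open>W\<close> on which finitely many conditions \<open>F\<close> detect \<open>C\<close>.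
    Applied to \<open>ann F\<close>, it would enlarge \<open>W\<close> by \<open>U\<close> and
    \<open>F\<close> by \<open>m\<close>.\<close>
  let ?C = "{W. submod W \<and> (\<exists>F\<subseteq>carrier S. finite F \<and> W \<inter> ann F \<subseteq> C)}"
  have sub: "submod N" if "N \<in> ?C" for N using that by blast
  have "C \<in> ?C" using C by blast
  then have "?C \<noteq> {}" by blast
  from hom_noetherian_maximal[OF noeth sub this]
  obtain W where "W \<in> ?C" and max: "\<And>N. N \<in> ?C \<Longrightarrow> W \<subseteq> N \<Longrightarrow> N = W" by blast
  then obtain F where W: "submod W" and F: "F \<subseteq> carrier S" "finite F" "W \<inter> ann F \<subseteq> C"
    by blast
  note DW = hom_submoduleD[OF W] and DF = hom_submoduleD[OF ann[OF F(1)]]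
  have "ann F \<subseteq> C"
  proof (rule ccontr)
    assume "\<not> ann F \<subseteq> C"
    then obtain m U where m: "m \<in> carrier S" and U: "submod U" "U \<subseteq> ann F" "\<not> U \<subseteq> C"
        "U \<inter> ann {m} \<subseteq> C"
      using step[OF ann[OF F(1)]] by blast
    note DU = hom_submoduleD[OF U(1)]
    let ?V = "{w \<oplus>\<^bsub>S\<^esub> u | w u. w \<in> W \<and> u \<in> U}"
    have V: "submod ?V" by (rule hom_submodule_set_add[OF W U(1)])
    have "?V \<inter> ann (insert m F) \<subseteq> C"
    proof
      fix x assume "x \<in> ?V \<inter> ann (insert m F)"
      then obtain w u where x: "x = w \<oplus>\<^bsub>S\<^esub> u" "w \<in> W" "u \<in> U" and xF: "x \<in> ann F" and xm: "x \<otimes>\<^bsub>S\<^esub> m \<in> X"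
        by (auto simp: ann_def)
      have c: "w \<in> carrier S" "u \<in> carrier S" using x DW(5) DU(5) by auto
      have "x \<ominus>\<^bsub>S\<^esub> u \<in> ann F" using hom_submodule_diff[OF ann[OF F(1)] xF] x(3) U(2) by blast
      moreover have "x \<ominus>\<^bsub>S\<^esub> u = w" using c x(1) by (simp add: a_minus_def S.a_assoc S.r_neg)
      ultimately have wC: "w \<in> C" using F(3) x(2) by blast
      then have "w \<otimes>\<^bsub>S\<^esub> m \<in> X" using CX m by blast
      then have "x \<otimes>\<^bsub>S\<^esub> m \<ominus>\<^bsub>S\<^esub> w \<otimes>\<^bsub>S\<^esub> m \<in> X"
        using ring_hom_ring.hom_submodule_diff[OF S.id_ring_hom_ring X xm] by simp
      moreover have "x \<otimes>\<^bsub>S\<^esub> m \<ominus>\<^bsub>S\<^esub> w \<otimes>\<^bsub>S\<^esub> m = u \<otimes>\<^bsub>S\<^esub> m"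
        using c m x(1) by (simp add: a_minus_def S.l_distr S.a_ac S.r_neg S.r_neg1)
      ultimately have "u \<in> ann {m}" using c by (simp add: ann_def)
      then have "u \<in> C" using U(4) x(3) by blast
      then show "x \<in> C" using wC DC(3) x(1) by simp
    qed
    moreover have "insert m F \<subseteq> carrier S" "finite (insert m F)" using m F by auto
    ultimately have "?V \<in> ?C" using V unfolding mem_Collect_eq by blast
    moreover have "W \<subseteq> ?V"
    proof
      fix w assume w: "w \<in> W"
      then have "w = w \<oplus>\<^bsub>S\<^esub> \<zero>\<^bsub>S\<^esub>" using DW(5) by simp
      then show "w \<in> ?V" using w DU(2) by blast
    qed
    ultimately have VW: "?V = W" by (rule max)
    have "U \<subseteq> W"
    proof
      fix u assume u: "u \<in> U"
      then have "u = \<zero>\<^bsub>S\<^esub> \<oplus>\<^bsub>S\<^esub> u" using DU(5) by simp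
      then show "u \<in> W" using u DW(2) VW by blast
    qed
    then show False using U(2,3) F(3) by blast
  qed
  then have "\<forall>s\<in>carrier S. (\<forall>f\<in>F. s \<otimes>\<^bsub>S\<^esub> f \<in> X) \<longrightarrow> (\<forall>t\<in>carrier S. s \<otimes>\<^bsub>S\<^esub> t \<in> X)"
    by (auto simp: ann_def C_def)
  then show "\<exists>F\<subseteq>carrier S. finite F \<and>
      (\<forall>s\<in>carrier S. (\<forall>f\<in>F. s \<otimes>\<^bsub>S\<^esub> f \<in> X) \<longrightarrow> (\<forall>t\<in>carrier S. s \<otimes>\<^bsub>S\<^esub> t \<in> X))"
    using F(1,2) by blast
qed

section \<open>Linear maps and tensor products\<close>

lemma linear_mapsI:
  assumes "\<And>x. x \<in> carrier M \<Longrightarrow> f x \<in> carrier N"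
    "\<And>x y. x \<in> carrier M \<Longrightarrow> y \<in> carrier M \<Longrightarrow> f (x \<oplus>\<^bsub>M\<^esub> y) = f x \<oplus>\<^bsub>N\<^esub> f y"
    "\<And>r x. r \<in> carrier k \<Longrightarrow> x \<in> carrier M \<Longrightarrow> f (r \<odot>\<^bsub>M\<^esub> x) = r \<odot>\<^bsub>N\<^esub> f x"
  shows "f \<in> linear_maps k M N"
  using assms unfolding linear_maps_def by auto

lemma linear_mapsD:
  assumes "f \<in> linear_maps k M N"
  shows "x \<in> carrier M \<Longrightarrow> f x \<in> carrier N"
    "x \<in> carrier M \<Longrightarrow> y \<in> carrier M \<Longrightarrow> f (x \<oplus>\<^bsub>M\<^esub> y) = f x \<oplus>\<^bsub>N\<^esub> f y"
    "r \<in> carrier k \<Longrightarrow> x \<in> carrier M \<Longrightarrow> f (r \<odot>\<^bsub>M\<^esub> x) = r \<odot>\<^bsub>N\<^esub> f x"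
  using assms unfolding linear_maps_def by auto

lemma linear_maps_zero:
  assumes "module k M" "module k N" "f \<in> linear_maps k M N"
  shows "f \<zero>\<^bsub>M\<^esub> = \<zero>\<^bsub>N\<^esub>"
proof -
  interpret M: module k M by fact
  interpret N: module k N by fact
  have "f (\<zero>\<^bsub>k\<^esub> \<odot>\<^bsub>M\<^esub> \<zero>\<^bsub>M\<^esub>) = \<zero>\<^bsub>k\<^esub> \<odot>\<^bsub>N\<^esub> f \<zero>\<^bsub>M\<^esub>"
    by (rule linear_mapsD(3)[OF assms(3)]) auto
  then show ?thesis using linear_mapsD(1)[OF assms(3), of "\<zero>\<^bsub>M\<^esub>"] by simp
qed

lemma linear_maps_minus:
  assumes "module k M" "module k N" "f \<in> linear_maps k M N" "x \<in> carrier M" "y \<in> carrier M"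
  shows "f (x \<ominus>\<^bsub>M\<^esub> y) = f x \<ominus>\<^bsub>N\<^esub> f y"
proof -
  interpret M: module k M by fact
  interpret N: module k N by fact
  have "f (x \<ominus>\<^bsub>M\<^esub> y) \<oplus>\<^bsub>N\<^esub> f y = f x"
    using assms(4,5) linear_mapsD(2)[OF assms(3), of "x \<ominus>\<^bsub>M\<^esub> y" y]
    by (simp add: a_minus_def M.a_assoc M.l_neg)
  moreover have "(f (x \<ominus>\<^bsub>M\<^esub> y) \<oplus>\<^bsub>N\<^esub> f y) \<ominus>\<^bsub>N\<^esub> f y = f (x \<ominus>\<^bsub>M\<^esub> y)"
    using assms(4,5) linear_mapsD(1)[OF assms(3)] by (simp add: a_minus_def N.a_assoc N.r_neg)
  ultimately show ?thesis by simp
qed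

lemma linear_maps_finsum:
  assumes "module k M" "module k N" "f \<in> linear_maps k M N" "g \<in> I \<rightarrow> carrier M"
  shows "f (\<Oplus>\<^bsub>M\<^esub>i\<in>I. g i) = (\<Oplus>\<^bsub>N\<^esub>i\<in>I. f (g i))"
proof -
  interpret M: module k M by fact
  interpret N: module k N by fact
  show ?thesis
    using assms(4)
  proof (induction I rule: infinite_finite_induct)
    case (insert x F)
    then have "g \<in> F \<rightarrow> carrier M" "g x \<in> carrier M" by auto
    then show ?case
      using insert linear_mapsD[OF assms(3)] by (simp add: Pi_iff)
  qed (auto simp: linear_maps_zero[OF assms(1-3)])
qed

lemma linear_maps_comp:
  "\<lbrakk>f \<in> linear_maps k N P; g \<in> linear_maps k M N\<rbrakk> \<Longrightarrow> (\<lambda>x. f (g x)) \<in> linear_maps k M P"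
  by (intro linear_mapsI) (simp_all add: linear_mapsD)

definition bilinear_map ::
  "('k, 'l) ring_scheme \<Rightarrow> ('k, 'a, 'm) module_scheme \<Rightarrow> ('k, 'b, 'n) module_scheme \<Rightarrow>
   ('k, 'p, 'q) module_scheme \<Rightarrow> ('a \<Rightarrow> 'b \<Rightarrow> 'p) \<Rightarrow> bool" where
  "bilinear_map k M N P f \<longleftrightarrow> (\<forall>x\<in>carrier M. f x \<in> linear_maps k N P) \<and>
     (\<forall>y\<in>carrier N. (\<lambda>x. f x y) \<in> linear_maps k M P)"

lemma bilinear_mapI:
  "\<lbrakk>\<And>x. x \<in> carrier M \<Longrightarrow> (\<lambda>y. f x y) \<in> linear_maps k N P;
    \<And>y. y \<in> carrier N \<Longrightarrow> (\<lambda>x. f x y) \<in> linear_maps k M P\<rbrakk> \<Longrightarrow> bilinear_map k M N P f"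
  unfolding bilinear_map_def by auto

lemma bilinear_mapD:
  assumes "bilinear_map k M N P f"
  shows "x \<in> carrier M \<Longrightarrow> f x \<in> linear_maps k N P"
    "y \<in> carrier N \<Longrightarrow> (\<lambda>x. f x y) \<in> linear_maps k M P"
    "x \<in> carrier M \<Longrightarrow> y \<in> carrier N \<Longrightarrow> f x y \<in> carrier P"
  using assms unfolding bilinear_map_def linear_maps_def by auto

lemma bilinear_map_comp:
  "\<lbrakk>bilinear_map k M N P f; g \<in> linear_maps k P Q\<rbrakk> \<Longrightarrow> bilinear_map k M N Q (\<lambda>x y. g (f x y))"
  by (rule bilinear_mapI; rule linear_maps_comp[of g k P Q], assumption, erule (1) bilinear_mapD)

subsection \<open>Free modules\<close>

lemma (in cring) free_module_is_module: "module R (free_module R X)"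
proof -
  let ?F = "free_module R X"
  have F: "f \<in> carrier ?F \<longleftrightarrow> range f \<subseteq> carrier R \<and> finite {x. f x \<noteq> \<zero>} \<and> {x. f x \<noteq> \<zero>} \<subseteq> X" for f
    by (simp add: free_module_def)
  have c: "f x \<in> carrier R" if "f \<in> carrier ?F" for f x using that F by auto
  have sub: "f \<in> carrier ?F" if "range f \<subseteq> carrier R" "{x. f x \<noteq> \<zero>} \<subseteq> {x. g x \<noteq> \<zero>} \<union> {x. g' x \<noteq> \<zero>}"
    "g \<in> carrier ?F" "g' \<in> carrier ?F" for f g g'
    using that finite_subset[OF that(2)] unfolding F by blast
  have add: "(\<lambda>x. f x \<oplus> g x) \<in> carrier ?F" if "f \<in> carrier ?F" "g \<in> carrier ?F" for f g
    by (rule sub[OF _ _ that]) (use that c in auto)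
  have smul: "(\<lambda>x. r \<otimes> f x) \<in> carrier ?F" if "r \<in> carrier R" "f \<in> carrier ?F" for f r
    by (rule sub[OF _ _ that(2) that(2)]) (use that c in auto)
  have ops: "add ?F = (\<lambda>f g x. f x \<oplus> g x)" "zero ?F = (\<lambda>_. \<zero>)" "smult ?F = (\<lambda>r f x. r \<otimes> f x)"
    by (simp_all add: free_module_def)
  show ?thesis
  proof (rule moduleI)
    show "abelian_group ?F"
    proof (rule abelian_groupI)
      show "\<exists>g\<in>carrier ?F. g \<oplus>\<^bsub>?F\<^esub> f = \<zero>\<^bsub>?F\<^esub>" if f: "f \<in> carrier ?F" for f
      proof
        show "(\<lambda>x. (\<ominus> \<one>) \<otimes> f x) \<in> carrier ?F" by (rule smul) (use f in auto)
        show "(\<lambda>x. (\<ominus> \<one>) \<otimes> f x) \<oplus>\<^bsub>?F\<^esub> f = \<zero>\<^bsub>?F\<^esub>"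
          using c[OF f] by (simp add: ops l_minus l_neg)
      qed
      show "\<zero>\<^bsub>?F\<^esub> \<in> carrier ?F" by (auto simp: F ops)
    qed (auto simp: ops add c a_ac)
  qed (use c in \<open>auto simp: ops smul is_cring l_distr r_distr m_assoc\<close>)
qed

lemma (in cring) free_basis_in_carrier: "x \<in> X \<Longrightarrow> free_basis R x \<in> carrier (free_module R X)"
  by (auto simp: free_module_def free_basis_def intro: finite_subset[of _ "{x}"])

lemma (in cring) free_module_induct [consumes 1, case_names zero add]:
  assumes u: "u \<in> carrier (free_module R X)"
    and zero: "Q \<zero>\<^bsub>free_module R X\<^esub>"
    and add: "\<And>r x u. \<lbrakk>r \<in> carrier R; x \<in> X; u \<in> carrier (free_module R X); Q u\<rbrakk> \<Longrightarrow>
      Q (r \<odot>\<^bsub>free_module R X\<^esub> free_basis R x \<oplus>\<^bsub>free_module R X\<^esub> u)"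
  shows "Q u"
proof -
  let ?F = "free_module R X"
  have "Q u" if "finite Z" "{x. u x \<noteq> \<zero>} \<subseteq> Z" "u \<in> carrier ?F" for Z u
    using that
  proof (induction Z arbitrary: u)
    case empty
    then have "u = \<zero>\<^bsub>?F\<^esub>" by (auto simp: free_module_def)
    then show ?case using zero by simp
  next
    case (insert z Z)
    show ?case
    proof (cases "u z = \<zero>")
      case True
      then have "{x. u x \<noteq> \<zero>} \<subseteq> Z" using insert.prems by auto
      then show ?thesis using insert.IH insert.prems by blast
    next
      case False
      have u: "range u \<subseteq> carrier R" "finite {x. u x \<noteq> \<zero>}" "{x. u x \<noteq> \<zero>} \<subseteq> X"
        using insert.prems(2) by (auto simp: free_module_def)
      let ?v = "u(z := \<zero>)"
      have "{x. ?v x \<noteq> \<zero>} \<subseteq> {x. u x \<noteq> \<zero>}" by auto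
      then have v: "?v \<in> carrier ?F"
        using u finite_subset[of "{x. ?v x \<noteq> \<zero>}" "{x. u x \<noteq> \<zero>}"] by (auto simp: free_module_def)
      have "Q ?v"
        by (rule insert.IH[OF _ v]) (use insert.prems in auto)
      then have "Q (u z \<odot>\<^bsub>?F\<^esub> free_basis R z \<oplus>\<^bsub>?F\<^esub> ?v)"
        using False u v by (intro add) auto
      moreover have "u z \<odot>\<^bsub>?F\<^esub> free_basis R z \<oplus>\<^bsub>?F\<^esub> ?v = u"
        using u(1) by (auto simp: free_module_def free_basis_def fun_eq_iff image_subset_iff)
      ultimately show ?thesis by simp
    qed
  qed
  then show ?thesis using u by (auto simp: free_module_def)
qed

text \<open>The sum inside \<open>tensor_lift\<close> before passing to cosets;
  \<open>tensor_lift\<close> is the constant value of \<open>free_lift\<close> on a coset.\<close>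

definition free_lift ::
  "('k, 'l) ring_scheme \<Rightarrow> ('k, 'p, 'n) module_scheme \<Rightarrow> ('x \<Rightarrow> 'p) \<Rightarrow> ('x \<Rightarrow> 'k) \<Rightarrow> 'p" where
  "free_lift k P f u = (\<Oplus>\<^bsub>P\<^esub>z\<in>{z. u z \<noteq> \<zero>\<^bsub>k\<^esub>}. u z \<odot>\<^bsub>P\<^esub> f z)"

text \<open>Supports differ between \<open>u\<close>, \<open>v\<close> and their sum, so additivity
  is checked over a common finite index set.\<close>

lemma (in module) free_lift_superset:
  assumes "f \<in> X \<rightarrow> carrier M" "u \<in> carrier (free_module R X)" "finite Z" "{z. u z \<noteq> \<zero>} \<subseteq> Z" "Z \<subseteq> X"
  shows "free_lift R M f u = (\<Oplus>\<^bsub>M\<^esub>z\<in>Z. u z \<odot>\<^bsub>M\<^esub> f z)"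
  unfolding free_lift_def
proof (rule M.add.finprod_mono_neutral_cong_left)
  have u: "range u \<subseteq> carrier R" using assms(2) by (simp add: free_module_def)
  show "(\<lambda>z. u z \<odot>\<^bsub>M\<^esub> f z) \<in> Z \<rightarrow> carrier M"
    using u assms(1,5) by (intro funcsetI smult_closed) auto
  show "\<And>z. z \<in> Z - {z. u z \<noteq> \<zero>} \<Longrightarrow> u z \<odot>\<^bsub>M\<^esub> f z = \<zero>\<^bsub>M\<^esub>"
    using assms(1,5) by (auto simp: Pi_iff subset_iff)
qed (use assms in auto)

lemma (in module) free_lift_linear:
  assumes f: "f \<in> X \<rightarrow> carrier M"
  shows "free_lift R M f \<in> linear_maps R (free_module R X) M"
proof (rule linear_mapsI)
  let ?F = "free_module R X"
  interpret F: module R ?F by (rule R.free_module_is_module)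
  have c: "u z \<in> carrier R" "finite {x. u x \<noteq> \<zero>}" "{x. u x \<noteq> \<zero>} \<subseteq> X" if "u \<in> carrier ?F" for u z
    using that by (auto simp: free_module_def)
  have fc: "f z \<in> carrier M" if "z \<in> X" for z using f that by auto
  show "free_lift R M f u \<in> carrier M" if "u \<in> carrier ?F" for u
    unfolding free_lift_def using c[OF that] fc by (intro M.finsum_closed funcsetI smult_closed) auto
  show "free_lift R M f (u \<oplus>\<^bsub>?F\<^esub> v) = free_lift R M f u \<oplus>\<^bsub>M\<^esub> free_lift R M f v"
    if u: "u \<in> carrier ?F" and v: "v \<in> carrier ?F" for u v
  proof -
    let ?Z = "{x. u x \<noteq> \<zero>} \<union> {x. v x \<noteq> \<zero>}"
    have Z: "finite ?Z" "?Z \<subseteq> X" using c(2,3)[OF u] c(2,3)[OF v] by auto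
    have uv: "(u \<oplus>\<^bsub>?F\<^esub> v) z = u z \<oplus> v z" for z by (simp add: free_module_def)
    have "free_lift R M f (u \<oplus>\<^bsub>?F\<^esub> v) = (\<Oplus>\<^bsub>M\<^esub>z\<in>?Z. (u \<oplus>\<^bsub>?F\<^esub> v) z \<odot>\<^bsub>M\<^esub> f z)"
      by (rule free_lift_superset[OF f]) (use u v Z in \<open>auto simp: uv\<close>)
    also have "\<dots> = (\<Oplus>\<^bsub>M\<^esub>z\<in>?Z. u z \<odot>\<^bsub>M\<^esub> f z \<oplus>\<^bsub>M\<^esub> v z \<odot>\<^bsub>M\<^esub> f z)"
      using Z(2) c(1)[OF u] c(1)[OF v] fc
      by (intro M.finsum_cong' funcsetI) (auto simp: uv smult_l_distr)
    also have "\<dots> = (\<Oplus>\<^bsub>M\<^esub>z\<in>?Z. u z \<odot>\<^bsub>M\<^esub> f z) \<oplus>\<^bsub>M\<^esub> (\<Oplus>\<^bsub>M\<^esub>z\<in>?Z. v z \<odot>\<^bsub>M\<^esub> f z)"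
      using Z(2) c(1)[OF u] c(1)[OF v] fc by (intro M.finsum_addf funcsetI smult_closed) auto
    also have "\<dots> = free_lift R M f u \<oplus>\<^bsub>M\<^esub> free_lift R M f v"
      using free_lift_superset[OF f u Z(1) _ Z(2)] free_lift_superset[OF f v Z(1) _ Z(2)] by simp
    finally show ?thesis .
  qed
  show "free_lift R M f (r \<odot>\<^bsub>?F\<^esub> u) = r \<odot>\<^bsub>M\<^esub> free_lift R M f u"
    if r: "r \<in> carrier R" and u: "u \<in> carrier ?F" for r u
  proof -
    let ?Z = "{x. u x \<noteq> \<zero>}"
    have ru: "(r \<odot>\<^bsub>?F\<^esub> u) z = r \<otimes> u z" for z by (simp add: free_module_def)
    have "free_lift R M f (r \<odot>\<^bsub>?F\<^esub> u) = (\<Oplus>\<^bsub>M\<^esub>z\<in>?Z. (r \<odot>\<^bsub>?F\<^esub> u) z \<odot>\<^bsub>M\<^esub> f z)"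
      by (rule free_lift_superset[OF f]) (use r u c[OF u] in \<open>auto simp: ru\<close>)
    also have "\<dots> = (\<Oplus>\<^bsub>M\<^esub>z\<in>?Z. r \<odot>\<^bsub>M\<^esub> (u z \<odot>\<^bsub>M\<^esub> f z))"
      using c[OF u] fc r by (intro M.finsum_cong' funcsetI) (auto simp: ru smult_assoc1)
    also have "\<dots> = r \<odot>\<^bsub>M\<^esub> free_lift R M f u"
      unfolding free_lift_def
      using c[OF u] fc r by (intro finsum_smult_ldistr[symmetric] funcsetI smult_closed) auto
    finally show ?thesis .
  qed
qed

lemma (in module) free_lift_basis:
  assumes "f \<in> X \<rightarrow> carrier M" "x \<in> X"
  shows "free_lift R M f (free_basis R x) = f x"
proof -
  have "free_lift R M f (free_basis R x) = (\<Oplus>\<^bsub>M\<^esub>z\<in>{x}. free_basis R x z \<odot>\<^bsub>M\<^esub> f z)"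
    by (rule free_lift_superset[OF assms(1) R.free_basis_in_carrier[OF assms(2)]])
      (use assms(2) in \<open>auto simp: free_basis_def\<close>)
  then show ?thesis using assms by (auto simp: free_basis_def Pi_iff)
qed

subsection \<open>Quotient modules\<close>

lemma (in module)
  assumes N: "submodule N R M"
  shows quotient_module_carrier: "carrier (quotient_module M N) = (\<lambda>x. N +>\<^bsub>M\<^esub> x) ` carrier M"
    and quotient_module_add: "\<lbrakk>x \<in> carrier M; y \<in> carrier M\<rbrakk> \<Longrightarrow>
      (N +>\<^bsub>M\<^esub> x) \<oplus>\<^bsub>quotient_module M N\<^esub> (N +>\<^bsub>M\<^esub> y) = N +>\<^bsub>M\<^esub> (x \<oplus>\<^bsub>M\<^esub> y)"
    and quotient_module_smult: "\<lbrakk>r \<in> carrier R; x \<in> carrier M\<rbrakk> \<Longrightarrow>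
      r \<odot>\<^bsub>quotient_module M N\<^esub> (N +>\<^bsub>M\<^esub> x) = N +>\<^bsub>M\<^esub> (r \<odot>\<^bsub>M\<^esub> x)"
    and quotient_module_zero: "\<zero>\<^bsub>quotient_module M N\<^esub> = N +>\<^bsub>M\<^esub> \<zero>\<^bsub>M\<^esub>"
    and quotient_module_eq_iff: "\<lbrakk>x \<in> carrier M; y \<in> carrier M\<rbrakk> \<Longrightarrow>
      N +>\<^bsub>M\<^esub> x = N +>\<^bsub>M\<^esub> y \<longleftrightarrow> x \<ominus>\<^bsub>M\<^esub> y \<in> N"
    and quotient_module_is_module: "module R (quotient_module M N)"
proof -
  let ?Q = "quotient_module M N"
  interpret N: submodule N R M by (rule N)
  interpret S: additive_subgroup N M by (intro additive_subgroup.intro N.subgroup_axioms)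
  interpret A: abelian_subgroup N M
    by (rule abelian_subgroupI3[OF S.additive_subgroup_axioms M.abelian_group_axioms])
  show carr: "carrier ?Q = (\<lambda>x. N +>\<^bsub>M\<^esub> x) ` carrier M"
    by (auto simp: quotient_module_def A_RCOSETS_def' a_r_coset_def')
  show add: "(N +>\<^bsub>M\<^esub> x) \<oplus>\<^bsub>?Q\<^esub> (N +>\<^bsub>M\<^esub> y) = N +>\<^bsub>M\<^esub> (x \<oplus>\<^bsub>M\<^esub> y)"
    if "x \<in> carrier M" "y \<in> carrier M" for x y
    using that by (simp add: quotient_module_def A.a_rcos_sum)
  show zero: "\<zero>\<^bsub>?Q\<^esub> = N +>\<^bsub>M\<^esub> \<zero>\<^bsub>M\<^esub>"
    using S.a_subset by (simp add: quotient_module_def)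
  have self: "x \<in> N +>\<^bsub>M\<^esub> x" if "x \<in> carrier M" for x by (rule A.a_rcos_self[OF that])
  show eq: "N +>\<^bsub>M\<^esub> x = N +>\<^bsub>M\<^esub> y \<longleftrightarrow> x \<ominus>\<^bsub>M\<^esub> y \<in> N" if x: "x \<in> carrier M" and y: "y \<in> carrier M" for x y
  proof -
    have "x \<ominus>\<^bsub>M\<^esub> y \<in> N \<longleftrightarrow> x \<in> N +>\<^bsub>M\<^esub> y"
      using A.a_rcos_module[OF y x] by (simp add: a_minus_def)
    also have "\<dots> \<longleftrightarrow> N +>\<^bsub>M\<^esub> x = N +>\<^bsub>M\<^esub> y"
      using self[OF x] A.a_repr_independence'[OF _ y] by metis
    finally show ?thesis by simp
  qed
  show smul: "r \<odot>\<^bsub>?Q\<^esub> (N +>\<^bsub>M\<^esub> x) = N +>\<^bsub>M\<^esub> (r \<odot>\<^bsub>M\<^esub> x)" if r: "r \<in> carrier R" and x: "x \<in> carrier M" for r x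
  proof -
    have "N +>\<^bsub>M\<^esub> (r \<odot>\<^bsub>M\<^esub> y) = N +>\<^bsub>M\<^esub> (r \<odot>\<^bsub>M\<^esub> x)" if y: "y \<in> N +>\<^bsub>M\<^esub> x" for y
    proof -
      have yM: "y \<in> carrier M" using y x by (rule A.a_elemrcos_carrier[rotated])
      then have "y \<ominus>\<^bsub>M\<^esub> x \<in> N" using A.a_rcos_module[OF x yM] y by (simp add: a_minus_def)
      then have "r \<odot>\<^bsub>M\<^esub> (y \<ominus>\<^bsub>M\<^esub> x) \<in> N" using r by auto
      then have "r \<odot>\<^bsub>M\<^esub> y \<ominus>\<^bsub>M\<^esub> r \<odot>\<^bsub>M\<^esub> x \<in> N"
        using r x yM by (simp add: a_minus_def smult_r_distr smult_r_minus)
      then show ?thesis using eq r x yM by simp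
    qed
    then have "(\<Union>y\<in>N +>\<^bsub>M\<^esub> x. N +>\<^bsub>M\<^esub> (r \<odot>\<^bsub>M\<^esub> y)) = N +>\<^bsub>M\<^esub> (r \<odot>\<^bsub>M\<^esub> x)"
      using self[OF x] by blast
    then show ?thesis by (simp add: quotient_module_def)
  qed
  show "module R ?Q"
  proof (rule moduleI)
    show "abelian_group ?Q"
    proof (rule abelian_groupI)
      show "\<exists>Y\<in>carrier ?Q. Y \<oplus>\<^bsub>?Q\<^esub> X = \<zero>\<^bsub>?Q\<^esub>" if XQ: "X \<in> carrier ?Q" for X
      proof -
        obtain x where x: "x \<in> carrier M" "X = N +>\<^bsub>M\<^esub> x" using XQ carr by auto
        then have "(N +>\<^bsub>M\<^esub> \<ominus>\<^bsub>M\<^esub> x) \<oplus>\<^bsub>?Q\<^esub> X = \<zero>\<^bsub>?Q\<^esub>" by (simp add: add zero M.l_neg)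
        then show ?thesis using carr x by auto
      qed
    qed (auto simp: carr add zero M.a_ac)
  qed (auto simp: carr add smul R.is_cring smult_l_distr smult_r_distr smult_assoc1)
qed

subsection \<open>Tensor products\<close>

locale two_modules = M: module k M + N: module k N
  for k :: "('k, 'l) ring_scheme"
    and M :: "('k, 'a, 'm) module_scheme" and N :: "('k, 'b, 'n) module_scheme"
begin

abbreviation "F \<equiv> free_module k (carrier M \<times> carrier N)"
abbreviation "K \<equiv> tensor_kernel k M N"
abbreviation "T \<equiv> tensor_module k M N"
abbreviation tensor_elem (infixl \<open>\<otimes>\<^sub>t\<close> 75) where "x \<otimes>\<^sub>t y \<equiv> tensor k M N x y"

sublocale F: module k F by (rule M.R.free_module_is_module)

lemma basis_closed: "\<lbrakk>x \<in> carrier M; y \<in> carrier N\<rbrakk> \<Longrightarrow> free_basis k (x, y) \<in> carrier F"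
  by (rule M.R.free_basis_in_carrier) auto

lemma tensor_relations_closed: "tensor_relations k M N \<subseteq> carrier F"
  unfolding tensor_relations_def Let_def by (auto simp: basis_closed)

lemma tensor_kernel_submodule: "submodule K k F" and tensor_relations_kernel: "tensor_relations k M N \<subseteq> K"
proof -
  let ?S = "{L. submodule L k F \<and> tensor_relations k M N \<subseteq> L}"
  have car: "carrier F \<in> ?S" using F.carrier_is_submodule tensor_relations_closed by auto
  have E: "L \<subseteq> carrier F" "\<zero>\<^bsub>F\<^esub> \<in> L" "\<And>a. a \<in> L \<Longrightarrow> \<ominus>\<^bsub>F\<^esub> a \<in> L"
    "\<And>a b. a \<in> L \<Longrightarrow> b \<in> L \<Longrightarrow> a \<oplus>\<^bsub>F\<^esub> b \<in> L"
    "\<And>a x. a \<in> carrier k \<Longrightarrow> x \<in> L \<Longrightarrow> a \<odot>\<^bsub>F\<^esub> x \<in> L" if "L \<in> ?S" for L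
    using F.submoduleE[of L] subgroup.one_closed[OF submodule.axioms(1), of L k F] that by auto
  show "submodule K k F"
    unfolding tensor_kernel_def gen_submodule_def
  proof (rule F.submoduleI)
    show "\<Inter>?S \<subseteq> carrier F" using car by blast
    show "\<zero>\<^bsub>F\<^esub> \<in> \<Inter>?S" using E(2) by blast
    show "\<ominus>\<^bsub>F\<^esub> a \<in> \<Inter>?S" if "a \<in> \<Inter>?S" for a using E(3) that by blast
    show "a \<oplus>\<^bsub>F\<^esub> b \<in> \<Inter>?S" if "a \<in> \<Inter>?S" "b \<in> \<Inter>?S" for a b using E(4) that by blast
    show "a \<odot>\<^bsub>F\<^esub> x \<in> \<Inter>?S" if "a \<in> carrier k" "x \<in> \<Inter>?S" for a x using E(5) that by blast
  qed
  show "tensor_relations k M N \<subseteq> K"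
    unfolding tensor_kernel_def gen_submodule_def by blast
qed

lemma tensor_module_is_module: "module k T"
  unfolding tensor_module_def by (rule F.quotient_module_is_module[OF tensor_kernel_submodule])

sublocale T: module k T by (rule tensor_module_is_module)

lemma coset_eq:
  assumes "u \<ominus>\<^bsub>F\<^esub> v \<in> tensor_relations k M N" "u \<in> carrier F" "v \<in> carrier F"
  shows "K +>\<^bsub>F\<^esub> u = K +>\<^bsub>F\<^esub> v"
  using F.quotient_module_eq_iff[OF tensor_kernel_submodule assms(2,3)] assms(1) tensor_relations_kernel
  by blast

lemma tensor_closed [simp]: "\<lbrakk>x \<in> carrier M; y \<in> carrier N\<rbrakk> \<Longrightarrow> x \<otimes>\<^sub>t y \<in> carrier T"
  unfolding tensor_module_def tensor_def F.quotient_module_carrier[OF tensor_kernel_submodule]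
  using basis_closed by blast

lemma coset_add:
  "\<lbrakk>u \<in> carrier F; v \<in> carrier F\<rbrakk> \<Longrightarrow> (K +>\<^bsub>F\<^esub> u) \<oplus>\<^bsub>T\<^esub> (K +>\<^bsub>F\<^esub> v) = K +>\<^bsub>F\<^esub> (u \<oplus>\<^bsub>F\<^esub> v)"
  unfolding tensor_module_def by (rule F.quotient_module_add[OF tensor_kernel_submodule])

lemma coset_smult:
  "\<lbrakk>r \<in> carrier k; v \<in> carrier F\<rbrakk> \<Longrightarrow> r \<odot>\<^bsub>T\<^esub> (K +>\<^bsub>F\<^esub> v) = K +>\<^bsub>F\<^esub> (r \<odot>\<^bsub>F\<^esub> v)"
  unfolding tensor_module_def by (rule F.quotient_module_smult[OF tensor_kernel_submodule])

lemma tensor_relations_intros: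
  "\<lbrakk>x \<in> carrier M; x' \<in> carrier M; y \<in> carrier N\<rbrakk> \<Longrightarrow>
    free_basis k (x \<oplus>\<^bsub>M\<^esub> x', y) \<ominus>\<^bsub>F\<^esub> (free_basis k (x, y) \<oplus>\<^bsub>F\<^esub> free_basis k (x', y)) \<in> tensor_relations k M N"
  "\<lbrakk>x \<in> carrier M; y \<in> carrier N; y' \<in> carrier N\<rbrakk> \<Longrightarrow>
    free_basis k (x, y \<oplus>\<^bsub>N\<^esub> y') \<ominus>\<^bsub>F\<^esub> (free_basis k (x, y) \<oplus>\<^bsub>F\<^esub> free_basis k (x, y')) \<in> tensor_relations k M N"
  "\<lbrakk>r \<in> carrier k; x \<in> carrier M; y \<in> carrier N\<rbrakk> \<Longrightarrow>
    free_basis k (r \<odot>\<^bsub>M\<^esub> x, y) \<ominus>\<^bsub>F\<^esub> r \<odot>\<^bsub>F\<^esub> free_basis k (x, y) \<in> tensor_relations k M N"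
  "\<lbrakk>r \<in> carrier k; x \<in> carrier M; y \<in> carrier N\<rbrakk> \<Longrightarrow>
    free_basis k (x, r \<odot>\<^bsub>N\<^esub> y) \<ominus>\<^bsub>F\<^esub> r \<odot>\<^bsub>F\<^esub> free_basis k (x, y) \<in> tensor_relations k M N"
  unfolding tensor_relations_def Let_def by blast+

lemma tensor_bilinear: "bilinear_map k M N T (tensor k M N)"
proof (intro bilinear_mapI linear_mapsI)
  fix x y y' assume *: "x \<in> carrier M" "y \<in> carrier N" "y' \<in> carrier N"
  show "x \<otimes>\<^sub>t (y \<oplus>\<^bsub>N\<^esub> y') = x \<otimes>\<^sub>t y \<oplus>\<^bsub>T\<^esub> x \<otimes>\<^sub>t y'"
    unfolding tensor_def
    by (subst coset_add; (rule coset_eq)?) (simp_all add: * basis_closed tensor_relations_intros)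
next
  fix x y r assume *: "x \<in> carrier M" "y \<in> carrier N" "r \<in> carrier k"
  show "x \<otimes>\<^sub>t (r \<odot>\<^bsub>N\<^esub> y) = r \<odot>\<^bsub>T\<^esub> (x \<otimes>\<^sub>t y)"
    unfolding tensor_def
    by (subst coset_smult; (rule coset_eq)?) (simp_all add: * basis_closed tensor_relations_intros)
  show "(r \<odot>\<^bsub>M\<^esub> x) \<otimes>\<^sub>t y = r \<odot>\<^bsub>T\<^esub> (x \<otimes>\<^sub>t y)"
    unfolding tensor_def
    by (subst coset_smult; (rule coset_eq)?) (simp_all add: * basis_closed tensor_relations_intros)
next
  fix x x' y assume *: "x \<in> carrier M" "x' \<in> carrier M" "y \<in> carrier N"
  show "(x \<oplus>\<^bsub>M\<^esub> x') \<otimes>\<^sub>t y = x \<otimes>\<^sub>t y \<oplus>\<^bsub>T\<^esub> x' \<otimes>\<^sub>t y"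
    unfolding tensor_def
    by (subst coset_add; (rule coset_eq)?) (simp_all add: * basis_closed tensor_relations_intros)
qed auto

text \<open>Scalars are absorbed by the left factor and zero is itself a pure tensor, so neither
  needs a case of its own.\<close>

lemma tensor_induct [consumes 1, case_names tensor add]:
  assumes X: "X \<in> carrier T"
    and pure: "\<And>x y. \<lbrakk>x \<in> carrier M; y \<in> carrier N\<rbrakk> \<Longrightarrow> Q (x \<otimes>\<^sub>t y)"
    and add: "\<And>X Y. \<lbrakk>X \<in> carrier T; Y \<in> carrier T; Q X; Q Y\<rbrakk> \<Longrightarrow> Q (X \<oplus>\<^bsub>T\<^esub> Y)"
  shows "Q X"
proof -
  obtain u where u: "u \<in> carrier F" "X = K +>\<^bsub>F\<^esub> u"
    using X unfolding tensor_module_def F.quotient_module_carrier[OF tensor_kernel_submodule] by blast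
  have "Q (K +>\<^bsub>F\<^esub> u)"
    using u(1)
  proof (induction u rule: M.R.free_module_induct)
    case zero
    have "K +>\<^bsub>F\<^esub> \<zero>\<^bsub>F\<^esub> = \<zero>\<^bsub>T\<^esub>"
      unfolding tensor_module_def by (rule F.quotient_module_zero[OF tensor_kernel_submodule, symmetric])
    also have "\<dots> = \<zero>\<^bsub>M\<^esub> \<otimes>\<^sub>t \<zero>\<^bsub>N\<^esub>"
      using linear_maps_zero[OF N.module_axioms T.module_axioms bilinear_mapD(1)[OF tensor_bilinear], of "\<zero>\<^bsub>M\<^esub>"]
      by simp
    finally show ?case using pure by simp
  next
    case (add r z u)
    obtain x y where z: "z = (x, y)" "x \<in> carrier M" "y \<in> carrier N" using add.hyps(2) by blast
    have b: "free_basis k z \<in> carrier F" using z basis_closed by simp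
    have "K +>\<^bsub>F\<^esub> (r \<odot>\<^bsub>F\<^esub> free_basis k z) = r \<odot>\<^bsub>T\<^esub> (x \<otimes>\<^sub>t y)"
      using coset_smult[OF add.hyps(1) b] unfolding z(1) tensor_def by simp
    also have "\<dots> = (r \<odot>\<^bsub>M\<^esub> x) \<otimes>\<^sub>t y"
      using linear_mapsD(3)[OF bilinear_mapD(2)[OF tensor_bilinear z(3)] add.hyps(1) z(2)] by simp
    finally have e: "K +>\<^bsub>F\<^esub> (r \<odot>\<^bsub>F\<^esub> free_basis k z) = (r \<odot>\<^bsub>M\<^esub> x) \<otimes>\<^sub>t y" .
    have "Q ((r \<odot>\<^bsub>M\<^esub> x) \<otimes>\<^sub>t y)" using z add.hyps(1) by (intro pure) auto
    moreover have "K +>\<^bsub>F\<^esub> u \<in> carrier T"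
      unfolding tensor_module_def F.quotient_module_carrier[OF tensor_kernel_submodule] using add.hyps by blast
    ultimately have "Q ((r \<odot>\<^bsub>M\<^esub> x) \<otimes>\<^sub>t y \<oplus>\<^bsub>T\<^esub> (K +>\<^bsub>F\<^esub> u))"
      using assms(3)[of "(r \<odot>\<^bsub>M\<^esub> x) \<otimes>\<^sub>t y" "K +>\<^bsub>F\<^esub> u"] add.IH z add.hyps(1) by simp
    then show ?case using coset_add[of "r \<odot>\<^bsub>F\<^esub> free_basis k z" u] add.hyps b e by simp
  qed
  then show ?thesis using u by simp
qed

text \<open>Bilinearity of \<open>f\<close> says exactly that the lift to the free module vanishes
  on the tensor relations, hence on the submodule they generate. It is therefore constant on cosets,
  and \<open>the_elem\<close> is applied to a singleton.\<close>

lemma tensor_lift_coset: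
  assumes P: "module k P" and f: "bilinear_map k M N P f" and u: "u \<in> carrier F"
  shows "tensor_lift k P f (K +>\<^bsub>F\<^esub> u) = free_lift k P (\<lambda>z. f (fst z) (snd z)) u"
proof -
  interpret P: module k P by (rule P)
  let ?f = "\<lambda>z. f (fst z) (snd z)"
  let ?L = "free_lift k P ?f"
  have fc: "?f \<in> carrier M \<times> carrier N \<rightarrow> carrier P" using bilinear_mapD(3)[OF f] by auto
  note L = P.free_lift_linear[OF fc]
  note Lm = linear_maps_minus[OF F.module_axioms P L] and LD = linear_mapsD[OF L]
  have Lb: "?L (free_basis k (x, y)) = f x y" if "x \<in> carrier M" "y \<in> carrier N" for x y
    using P.free_lift_basis[OF fc, of "(x, y)"] that by simp
  have bi: "f (x \<oplus>\<^bsub>M\<^esub> x') y = f x y \<oplus>\<^bsub>P\<^esub> f x' y" if "x \<in> carrier M" "x' \<in> carrier M" "y \<in> carrier N" for x x' y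
    using linear_mapsD[OF bilinear_mapD(2)[OF f]] that by auto
  have bi': "f x (y \<oplus>\<^bsub>N\<^esub> y') = f x y \<oplus>\<^bsub>P\<^esub> f x y'" if "x \<in> carrier M" "y \<in> carrier N" "y' \<in> carrier N" for x y y'
    using linear_mapsD[OF bilinear_mapD(1)[OF f]] that by auto
  have bi'': "f (r \<odot>\<^bsub>M\<^esub> x) y = r \<odot>\<^bsub>P\<^esub> f x y" "f x (r \<odot>\<^bsub>N\<^esub> y) = r \<odot>\<^bsub>P\<^esub> f x y"
    if "x \<in> carrier M" "y \<in> carrier N" "r \<in> carrier k" for x y r
    using linear_mapsD[OF bilinear_mapD(1)[OF f]] linear_mapsD[OF bilinear_mapD(2)[OF f]] that by auto
  let ?D = "{u \<in> carrier F. ?L u = \<zero>\<^bsub>P\<^esub>}"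
  have Pm: "x \<ominus>\<^bsub>P\<^esub> x = \<zero>\<^bsub>P\<^esub>" if "x \<in> carrier P" for x
    using that by (simp add: a_minus_def P.r_neg)
  have "submodule ?D k F"
  proof (rule F.submoduleI)
    show "\<ominus>\<^bsub>F\<^esub> a \<in> ?D" if "a \<in> ?D" for a
      using that Lm[of "\<zero>\<^bsub>F\<^esub>" a] linear_maps_zero[OF F.module_axioms P L] by (simp add: a_minus_def)
  qed (auto simp: LD linear_maps_zero[OF F.module_axioms P L])
  moreover have "tensor_relations k M N \<subseteq> ?D"
    unfolding tensor_relations_def Let_def
    by (auto simp: basis_closed Lm LD Lb bi bi' bi'' bilinear_mapD(3)[OF f] Pm)
  ultimately have KD: "K \<subseteq> ?D" unfolding tensor_kernel_def gen_submodule_def by blast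
  have "?L v = ?L u" if v: "v \<in> K +>\<^bsub>F\<^esub> u" for v
  proof -
    obtain w where w: "w \<in> K" "v = w \<oplus>\<^bsub>F\<^esub> u" using v by (auto simp: a_r_coset_def')
    then have "w \<in> carrier F" "?L w = \<zero>\<^bsub>P\<^esub>" using KD by auto
    then show ?thesis using w u LD by simp
  qed
  moreover have "u \<in> K +>\<^bsub>F\<^esub> u"
  proof -
    have "u = \<zero>\<^bsub>F\<^esub> \<oplus>\<^bsub>F\<^esub> u" using u by simp
    moreover have "\<zero>\<^bsub>F\<^esub> \<in> K"
      using subgroup.one_closed[OF submodule.axioms(1)[OF tensor_kernel_submodule]] by simp
    ultimately show ?thesis by (auto simp: a_r_coset_def')
  qed
  ultimately have "?L ` (K +>\<^bsub>F\<^esub> u) = {?L u}" by blast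
  then show ?thesis by (simp add: tensor_lift_def free_lift_def)
qed

lemma
  assumes P: "module k P" and f: "bilinear_map k M N P f"
  shows tensor_lift_linear: "tensor_lift k P f \<in> linear_maps k T P"
    and tensor_lift_tensor: "\<lbrakk>x \<in> carrier M; y \<in> carrier N\<rbrakk> \<Longrightarrow> tensor_lift k P f (x \<otimes>\<^sub>t y) = f x y"
proof -
  interpret P: module k P by (rule P)
  let ?f = "\<lambda>z. f (fst z) (snd z)"
  have fc: "?f \<in> carrier M \<times> carrier N \<rightarrow> carrier P" using bilinear_mapD(3)[OF f] by auto
  note LD = linear_mapsD[OF P.free_lift_linear[OF fc]]
  have car: "carrier T = (\<lambda>u. K +>\<^bsub>F\<^esub> u) ` carrier F"
    unfolding tensor_module_def by (rule F.quotient_module_carrier[OF tensor_kernel_submodule])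
  show "tensor_lift k P f \<in> linear_maps k T P"
    by (rule linear_mapsI)
      (auto simp: car coset_add coset_smult tensor_lift_coset[OF P f] LD)
  show "tensor_lift k P f (x \<otimes>\<^sub>t y) = f x y" if "x \<in> carrier M" "y \<in> carrier N"
    using that tensor_lift_coset[OF P f basis_closed[OF that]] P.free_lift_basis[OF fc, of "(x, y)"]
    by (simp add: tensor_def)
qed

lemma linear_eqI:
  assumes "f \<in> linear_maps k T P" "g \<in> linear_maps k T P"
    and "\<And>x y. \<lbrakk>x \<in> carrier M; y \<in> carrier N\<rbrakk> \<Longrightarrow> f (x \<otimes>\<^sub>t y) = g (x \<otimes>\<^sub>t y)" and "X \<in> carrier T"
  shows "f X = g X"
  using assms(4)
  by (induction X rule: tensor_induct) (simp_all add: assms(3) linear_mapsD(2)[OF assms(1)] linear_mapsD(2)[OF assms(2)])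

lemma tensor_linear:
  "\<lbrakk>f \<in> linear_maps k L M; y \<in> carrier N\<rbrakk> \<Longrightarrow> (\<lambda>x. f x \<otimes>\<^sub>t y) \<in> linear_maps k L T"
  "\<lbrakk>x \<in> carrier M; g \<in> linear_maps k L N\<rbrakk> \<Longrightarrow> (\<lambda>y. x \<otimes>\<^sub>t g y) \<in> linear_maps k L T"
  using linear_maps_comp[OF bilinear_mapD(2)[OF tensor_bilinear]]
    linear_maps_comp[OF bilinear_mapD(1)[OF tensor_bilinear]] by blast+

lemma tensor_lift_closed:
  "\<lbrakk>module k P; bilinear_map k M N P f; X \<in> carrier T\<rbrakk> \<Longrightarrow> tensor_lift k P f X \<in> carrier P"
  using linear_mapsD(1)[OF tensor_lift_linear] by blast

text \<open>Functions in a Sweedler sum typically agree only on the carriers. Bilinearity of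
  \<open>g\<close> is not assumed but inherited from \<open>f\<close>, so it has to be checked for
  one side only.\<close>

lemma tensor_lift_cong:
  assumes P: "module k P" and f: "bilinear_map k M N P f" and X: "X \<in> carrier T"
    and eq: "\<And>x y. \<lbrakk>x \<in> carrier M; y \<in> carrier N\<rbrakk> \<Longrightarrow> f x y = g x y"
  shows "tensor_lift k P f X = tensor_lift k P g X"
proof -
  have g: "bilinear_map k M N P g"
  proof (intro bilinear_mapI linear_mapsI)
    fix x assume x: "x \<in> carrier M"
    note D = linear_mapsD[OF bilinear_mapD(1)[OF f x]]
    show "g x y \<in> carrier P" if "y \<in> carrier N" for y using D(1) that x by (simp flip: eq)
    show "g x (y \<oplus>\<^bsub>N\<^esub> z) = g x y \<oplus>\<^bsub>P\<^esub> g x z" if "y \<in> carrier N" "z \<in> carrier N" for y z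
      using D(2) that x by (simp flip: eq)
    show "g x (r \<odot>\<^bsub>N\<^esub> y) = r \<odot>\<^bsub>P\<^esub> g x y" if "r \<in> carrier k" "y \<in> carrier N" for r y
      using D(3) that x by (simp flip: eq)
  next
    fix y assume y: "y \<in> carrier N"
    note D = linear_mapsD[OF bilinear_mapD(2)[OF f y]]
    show "g x y \<in> carrier P" if "x \<in> carrier M" for x using D(1) that y by (simp flip: eq)
    show "g (x \<oplus>\<^bsub>M\<^esub> z) y = g x y \<oplus>\<^bsub>P\<^esub> g z y" if "x \<in> carrier M" "z \<in> carrier M" for x z
      using D(2) that y by (simp flip: eq)
    show "g (r \<odot>\<^bsub>M\<^esub> x) y = r \<odot>\<^bsub>P\<^esub> g x y" if "r \<in> carrier k" "x \<in> carrier M" for r x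
      using D(3) that y by (simp flip: eq)
  qed
  show ?thesis
    by (rule linear_eqI[OF tensor_lift_linear[OF P f] tensor_lift_linear[OF P g] _ X])
      (simp add: tensor_lift_tensor[OF P f] tensor_lift_tensor[OF P g] eq)
qed

lemma tensor_lift_hom:
  assumes "module k P" "module k Q" "bilinear_map k M N P f" "g \<in> linear_maps k P Q" "X \<in> carrier T"
  shows "g (tensor_lift k P f X) = tensor_lift k Q (\<lambda>x y. g (f x y)) X"
proof -
  note b = bilinear_map_comp[OF assms(3,4)]
  show ?thesis
    by (rule linear_eqI[OF linear_maps_comp[OF assms(4) tensor_lift_linear[OF assms(1,3)]]
          tensor_lift_linear[OF assms(2) b] _ assms(5)])
      (simp add: tensor_lift_tensor[OF assms(1,3)] tensor_lift_tensor[OF assms(2) b])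
qed

text \<open>Makes a Sweedler sum linear in an outer variable as soon as its summand is, which is
  what nested sums require.\<close>

lemma tensor_lift_linear_param:
  assumes P: "module k P" and f: "\<And>q. q \<in> carrier Q \<Longrightarrow> bilinear_map k M N P (f q)"
    and lin: "\<And>x y. \<lbrakk>x \<in> carrier M; y \<in> carrier N\<rbrakk> \<Longrightarrow> (\<lambda>q. f q x y) \<in> linear_maps k Q P"
    and Q: "module k Q" and X: "X \<in> carrier T"
  shows "(\<lambda>q. tensor_lift k P (f q) X) \<in> linear_maps k Q P"
proof -
  interpret P: module k P by (rule P)
  interpret Q: module k Q by (rule Q)
  note L = linear_mapsD[OF tensor_lift_linear[OF P f]]
  show ?thesis
    using X
  proof (induction X rule: tensor_induct)
    case (tensor x y)
    note D = linear_mapsD[OF lin[OF tensor]]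
    show ?case
      by (rule linear_mapsI) (simp_all add: tensor_lift_tensor[OF P f] tensor D)
  next
    case (add X Y)
    note DX = linear_mapsD[OF add.IH(1)] and DY = linear_mapsD[OF add.IH(2)]
    show ?case
      by (rule linear_mapsI) (simp_all add: L add.hyps DX DY P.smult_r_distr P.M.a_ac)
  qed
qed

end

text \<open>Fubini for two independent Sweedler sums: both sides are linear in \<open>X\<close>, and
  on a pure tensor the inner sum over \<open>X\<close> disappears.\<close>

lemma tensor_lift_swap:
  assumes "two_modules k M N" "two_modules k M' N'" and P: "module k P"
    and f: "\<And>x y. \<lbrakk>x \<in> carrier M; y \<in> carrier N\<rbrakk> \<Longrightarrow> bilinear_map k M' N' P (f x y)"
    and g: "\<And>u v. \<lbrakk>u \<in> carrier M'; v \<in> carrier N'\<rbrakk> \<Longrightarrow> bilinear_map k M N P (\<lambda>x y. f x y u v)"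
    and X: "X \<in> carrier (tensor_module k M N)" and Y: "Y \<in> carrier (tensor_module k M' N')"
  shows "tensor_lift k P (\<lambda>x y. tensor_lift k P (f x y) Y) X =
    tensor_lift k P (\<lambda>u v. tensor_lift k P (\<lambda>x y. f x y u v) X) Y"
proof -
  interpret A: two_modules k M N by fact
  interpret B: two_modules k M' N' by fact
  interpret P: module k P by (rule P)
  have bl: "bilinear_map k M N P (\<lambda>x y. tensor_lift k P (f x y) Y)"
    by (intro bilinear_mapI B.tensor_lift_linear_param f bilinear_mapD[OF g] Y P A.M.module_axioms A.N.module_axioms)
  have br: "bilinear_map k M' N' P (\<lambda>u v. tensor_lift k P (\<lambda>x y. f x y u v) X)"
    by (intro bilinear_mapI A.tensor_lift_linear_param g bilinear_mapD[OF f] X P B.M.module_axioms B.N.module_axioms)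
  have "tensor_lift k P (\<lambda>x y. tensor_lift k P (f x y) (B.tensor_elem u v)) Z =
      tensor_lift k P (\<lambda>x y. f x y u v) Z"
    if "u \<in> carrier M'" "v \<in> carrier N'" "Z \<in> carrier A.T" for u v Z
    by (rule A.tensor_lift_cong[OF P g[OF that(1,2)] that(3), symmetric])
      (simp add: B.tensor_lift_tensor[OF P f] that)
  have "tensor_lift k P (\<lambda>u v. tensor_lift k P (\<lambda>x y. f x y u v) (A.tensor_elem x y)) Y =
      tensor_lift k P (f x y) Y"
    if "x \<in> carrier M" "y \<in> carrier N" for x y
    by (rule B.tensor_lift_cong[OF P f[OF that] Y, symmetric])
      (simp add: A.tensor_lift_tensor[OF P g] that)
  note pure = this
  show ?thesis
  proof (rule A.linear_eqI[OF A.tensor_lift_linear[OF P bl] _ _ X])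
    show "(\<lambda>X. tensor_lift k P (\<lambda>u v. tensor_lift k P (\<lambda>x y. f x y u v) X) Y) \<in> linear_maps k A.T P"
      by (intro B.tensor_lift_linear_param P Y A.T.module_axioms A.tensor_lift_linear bilinear_mapI
          A.tensor_lift_linear_param B.M.module_axioms B.N.module_axioms g bilinear_mapD[OF f])
  qed (simp add: A.tensor_lift_tensor[OF P bl] pure)
qed

lemma linear_maps_sum:
  assumes "module k N" "\<And>i. i \<in> I \<Longrightarrow> f i \<in> linear_maps k M N"
  shows "(\<lambda>x. \<Oplus>\<^bsub>N\<^esub>i\<in>I. f i x) \<in> linear_maps k M N"
proof -
  interpret N: module k N by fact
  note D = linear_mapsD[OF assms(2)]
  show ?thesis
  proof (rule linear_mapsI)
    show "(\<Oplus>\<^bsub>N\<^esub>i\<in>I. f i x) \<in> carrier N" if "x \<in> carrier M" for x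
      using D(1) that by (intro N.finsum_closed) auto
    show "(\<Oplus>\<^bsub>N\<^esub>i\<in>I. f i (x \<oplus>\<^bsub>M\<^esub> y)) = (\<Oplus>\<^bsub>N\<^esub>i\<in>I. f i x) \<oplus>\<^bsub>N\<^esub> (\<Oplus>\<^bsub>N\<^esub>i\<in>I. f i y)"
      if "x \<in> carrier M" "y \<in> carrier M" for x y
    proof -
      have "(\<Oplus>\<^bsub>N\<^esub>i\<in>I. f i (x \<oplus>\<^bsub>M\<^esub> y)) = (\<Oplus>\<^bsub>N\<^esub>i\<in>I. f i x \<oplus>\<^bsub>N\<^esub> f i y)"
        using D that by (intro N.finsum_cong') auto
      then show ?thesis using D(1) that by (subst (asm) N.finsum_addf) auto
    qed
    show "(\<Oplus>\<^bsub>N\<^esub>i\<in>I. f i (r \<odot>\<^bsub>M\<^esub> x)) = r \<odot>\<^bsub>N\<^esub> (\<Oplus>\<^bsub>N\<^esub>i\<in>I. f i x)"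
      if "r \<in> carrier k" "x \<in> carrier M" for r x
    proof -
      have r: "(\<lambda>y. r \<odot>\<^bsub>N\<^esub> y) \<in> linear_maps k N N"
        by (rule linear_mapsI) (simp_all add: that N.smult_r_distr N.R.m_comm flip: N.smult_assoc1)
      have "(\<Oplus>\<^bsub>N\<^esub>i\<in>I. f i (r \<odot>\<^bsub>M\<^esub> x)) = (\<Oplus>\<^bsub>N\<^esub>i\<in>I. r \<odot>\<^bsub>N\<^esub> f i x)"
        using D that by (intro N.finsum_cong') auto
      also have "\<dots> = r \<odot>\<^bsub>N\<^esub> (\<Oplus>\<^bsub>N\<^esub>i\<in>I. f i x)"
        using D(1) that by (intro linear_maps_finsum[OF assms(1,1) r, symmetric]) auto
      finally show ?thesis .
    qed
  qed
qed

lemma (in two_modules) tensor_lift_finsum: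
  assumes P: "module k P" and f: "\<And>i. i \<in> I \<Longrightarrow> bilinear_map k M N P (f i)" and X: "X \<in> carrier T"
  shows "tensor_lift k P (\<lambda>x y. \<Oplus>\<^bsub>P\<^esub>i\<in>I. f i x y) X = (\<Oplus>\<^bsub>P\<^esub>i\<in>I. tensor_lift k P (f i) X)"
proof -
  interpret P: module k P by fact
  have b: "bilinear_map k M N P (\<lambda>x y. \<Oplus>\<^bsub>P\<^esub>i\<in>I. f i x y)"
    by (intro bilinear_mapI linear_maps_sum P bilinear_mapD[OF f])
  show ?thesis
    by (rule linear_eqI[OF tensor_lift_linear[OF P b] linear_maps_sum[OF P tensor_lift_linear[OF P f]] _ X])
      (auto simp: tensor_lift_tensor[OF P b] tensor_lift_tensor[OF P f] bilinear_mapD(3)[OF f]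
        intro!: P.finsum_cong')
qed

section \<open>Rules by which linearity of nested expressions is found automatically\<close>

declare bilinear_mapI [intro!]

lemma linear_maps_ident [intro!]: "(\<lambda>x. x) \<in> linear_maps k M M"
  by (rule linear_mapsI) auto

lemma linear_maps_smult [intro!]:
  assumes "module k N" "r \<in> carrier k" "f \<in> linear_maps k M N"
  shows "(\<lambda>x. r \<odot>\<^bsub>N\<^esub> f x) \<in> linear_maps k M N"
proof -
  interpret N: module k N by fact
  note D = linear_mapsD[OF assms(3)]
  show ?thesis
    by (rule linear_mapsI)
      (use assms(2) in \<open>simp_all add: D N.smult_r_distr N.R.m_comm flip: N.smult_assoc1\<close>)
qed

lemma (in assoc_algebra) linear_maps_mult [intro!]:
  "\<lbrakk>c \<in> carrier M; f \<in> linear_maps R L M\<rbrakk> \<Longrightarrow> (\<lambda>x. f x \<otimes>\<^bsub>M\<^esub> c) \<in> linear_maps R L M"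
  "\<lbrakk>c \<in> carrier M; f \<in> linear_maps R L M\<rbrakk> \<Longrightarrow> (\<lambda>x. c \<otimes>\<^bsub>M\<^esub> f x) \<in> linear_maps R L M"
  by (rule linear_mapsI; simp add: linear_mapsD l_distr r_distr smult_mult_left smult_mult_right)+

text \<open>The ring \<open>k\<close> carries no \<open>smult\<close> and cannot be a target of
  \<open>linear_maps\<close>. Functionals therefore enter linear maps only as coefficients of a
  fixed vector.\<close>

definition functional :: "('k, 'l) ring_scheme \<Rightarrow> ('k, 'a, 'm) module_scheme \<Rightarrow> ('a \<Rightarrow> 'k) \<Rightarrow> bool" where
  "functional k M f \<longleftrightarrow> f \<in> carrier M \<rightarrow> carrier k \<and>
     (\<forall>x\<in>carrier M. \<forall>y\<in>carrier M. f (x \<oplus>\<^bsub>M\<^esub> y) = f x \<oplus>\<^bsub>k\<^esub> f y) \<and>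
     (\<forall>r\<in>carrier k. \<forall>x\<in>carrier M. f (r \<odot>\<^bsub>M\<^esub> x) = r \<otimes>\<^bsub>k\<^esub> f x)"

lemma functionalD:
  assumes "functional k M f"
  shows "x \<in> carrier M \<Longrightarrow> f x \<in> carrier k"
    "x \<in> carrier M \<Longrightarrow> y \<in> carrier M \<Longrightarrow> f (x \<oplus>\<^bsub>M\<^esub> y) = f x \<oplus>\<^bsub>k\<^esub> f y"
    "r \<in> carrier k \<Longrightarrow> x \<in> carrier M \<Longrightarrow> f (r \<odot>\<^bsub>M\<^esub> x) = r \<otimes>\<^bsub>k\<^esub> f x"
  using assms unfolding functional_def by auto

lemma linear_maps_functional:
  assumes "module k P" "functional k N \<phi>" "f \<in> linear_maps k M N" "v \<in> carrier P"
  shows "(\<lambda>x. \<phi> (f x) \<odot>\<^bsub>P\<^esub> v) \<in> linear_maps k M P"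
proof -
  interpret P: module k P by fact
  show ?thesis
    by (rule linear_mapsI)
      (use assms(4) in \<open>simp_all add: linear_mapsD[OF assms(3)] functionalD[OF assms(2)]
          P.smult_l_distr P.smult_assoc1\<close>)
qed

section \<open>Sweedler calculus in a Hopf algebra\<close>

context hopf_algebra
begin

abbreviation "HT \<equiv> tensor_module k H H"

sublocale HH: two_modules k H H ..

lemma comult_linear_comp [intro!]:
  "f \<in> linear_maps k M H \<Longrightarrow> (\<lambda>x. \<Delta> (f x)) \<in> linear_maps k M HT"
  by (rule linear_maps_comp[OF comult_linear])

lemma comult_closed [simp, intro]: "h \<in> carrier H \<Longrightarrow> \<Delta> h \<in> carrier HT"
  by (rule linear_mapsD(1)[OF comult_linear])

lemma antipode_linear_comp [intro!]:
  "f \<in> linear_maps k M H \<Longrightarrow> (\<lambda>x. S (f x)) \<in> linear_maps k M H"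
  by (rule linear_maps_comp[OF antipode_linear])

lemma antipode_closed [simp, intro]: "h \<in> carrier H \<Longrightarrow> S h \<in> carrier H"
  by (rule linear_mapsD(1)[OF antipode_linear])

lemma counit_functional: "functional k H \<epsilon>"
  unfolding functional_def
  using ring_hom_closed[OF counit_ring_hom] ring_hom_add[OF counit_ring_hom] counit_linear by auto

lemmas [intro!] = linear_maps_functional[OF _ counit_functional]

lemma counit_closed [simp, intro]: "h \<in> carrier H \<Longrightarrow> \<epsilon> h \<in> carrier k"
  by (rule functionalD(1)[OF counit_functional])

lemma tensor_lift_comp [intro!]:
  "\<lbrakk>module k P; bilinear_map k H H P F; X \<in> linear_maps k M HT\<rbrakk> \<Longrightarrow>
    (\<lambda>x. tensor_lift k P F (X x)) \<in> linear_maps k M P"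
  by (rule linear_maps_comp[OF HH.tensor_lift_linear])

lemmas [intro!] = HH.tensor_lift_linear_param HH.tensor_lift_closed HH.tensor_linear

lemmas modules [simp, intro!] = module_axioms HH.T.module_axioms

text \<open>\<open>sw P f h\<close> is \<open>\<Sum> f h\<^sub>1 h\<^sub>2\<close> in Sweedler notation.\<close>

abbreviation sw :: "('k, 'p, 'q) module_scheme \<Rightarrow> ('h \<Rightarrow> 'h \<Rightarrow> 'p) \<Rightarrow> 'h \<Rightarrow> 'p" where
  "sw P f h \<equiv> tensor_lift k P f (\<Delta> h)"

lemmas sw_cong = HH.tensor_lift_cong[OF _ _ comult_closed]
  and sw_hom = HH.tensor_lift_hom[OF _ _ _ _ comult_closed]
  and sw_finsum = HH.tensor_lift_finsum[OF _ _ comult_closed]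
  and sw_swap = tensor_lift_swap[OF HH.two_modules_axioms HH.two_modules_axioms _ _ _ comult_closed comult_closed]

text \<open>The axiom is one equation in the module of triple tensors. A trilinear \<open>F\<close>
  induces a linear map on that module, and applying this map to both sides gives the rule in the
  form in which Sweedler sums are rebracketed.\<close>

lemma coassoc_lift:
  assumes P: "module k P"
    and F1: "\<And>y z. \<lbrakk>y \<in> carrier H; z \<in> carrier H\<rbrakk> \<Longrightarrow> (\<lambda>x. F x y z) \<in> linear_maps k H P"
    and F2: "\<And>x z. \<lbrakk>x \<in> carrier H; z \<in> carrier H\<rbrakk> \<Longrightarrow> (\<lambda>y. F x y z) \<in> linear_maps k H P"
    and F3: "\<And>x y. \<lbrakk>x \<in> carrier H; y \<in> carrier H\<rbrakk> \<Longrightarrow> (\<lambda>z. F x y z) \<in> linear_maps k H P"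
    and h: "h \<in> carrier H"
  shows "sw P (\<lambda>x y. sw P (\<lambda>u v. F u v y) x) h =
    sw P (\<lambda>x y. sw P (\<lambda>u v. F x u v) y) h"
proof -
  let ?T3 = "tensor_module k H HT"
  interpret T3: two_modules k H HT ..
  have m: "module k H" "module k HT" "module k ?T3"
    by (rule module_axioms HH.T.module_axioms T3.T.module_axioms)+
  have bF: "bilinear_map k H H P (F x)" if "x \<in> carrier H" for x
    by (auto intro!: F2 F3 that)
  have \<Phi>: "bilinear_map k H HT P (\<lambda>u w. tensor_lift k P (\<lambda>v y. F u v y) w)"
    by (auto intro!: bF P m F1 F2 F3)
  let ?\<Phi> = "tensor_lift k P (\<lambda>u w. tensor_lift k P (\<lambda>v y. F u v y) w)"
  note \<Phi>lin = T3.tensor_lift_linear[OF P \<Phi>] and \<Phi>ten = T3.tensor_lift_tensor[OF P \<Phi>]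
  have b1: "bilinear_map k H H ?T3 (\<lambda>x y. sw ?T3 (\<lambda>u v. tensor k H HT u (tensor k H H v y)) x)"
    by (auto intro!: m T3.tensor_linear)
  have b1': "bilinear_map k H H ?T3 (\<lambda>u v. tensor k H HT u (tensor k H H v y))" if "y \<in> carrier H" for y
    using that by (auto intro!: m T3.tensor_linear)
  have b2: "bilinear_map k H H ?T3 (\<lambda>x y. tensor k H HT x (\<Delta> y))"
    by (auto intro!: m T3.tensor_linear)
  have "?\<Phi> (sw ?T3 (\<lambda>x y. sw ?T3 (\<lambda>u v. tensor k H HT u (tensor k H H v y)) x) h)
      = sw P (\<lambda>x y. sw P (\<lambda>u v. F u v y) x) h"
  proof (subst HH.tensor_lift_hom[OF m(3) P b1 \<Phi>lin], simp add: h, rule HH.tensor_lift_cong[symmetric])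
    fix x y assume xy: "x \<in> carrier H" "y \<in> carrier H"
    have b3: "bilinear_map k H H P (\<lambda>u v. F u v y)" by (intro bilinear_mapI F1 F2 xy)
    show "sw P (\<lambda>u v. F u v y) x =
        ?\<Phi> (sw ?T3 (\<lambda>u v. tensor k H HT u (tensor k H H v y)) x)"
      using xy by (subst HH.tensor_lift_hom[OF m(3) P b1'[OF xy(2)] \<Phi>lin], simp)
        (auto intro!: HH.tensor_lift_cong P b3 simp: \<Phi>ten HH.tensor_lift_tensor[OF P bF])
  qed (auto intro!: P F1 F2 F3 h)
  moreover have "?\<Phi> (sw ?T3 (\<lambda>x y. tensor k H HT x (\<Delta> y)) h)
      = sw P (\<lambda>x y. sw P (\<lambda>u v. F x u v) y) h"
    by (subst HH.tensor_lift_hom[OF m(3) P b2 \<Phi>lin], simp add: h, rule HH.tensor_lift_cong[symmetric])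
      (auto intro!: P F1 F2 F3 h simp: \<Phi>ten)
  ultimately show ?thesis using coassoc[OF h] by (simp add: Let_def)
qed

text \<open>Multiplicativity of \<open>\<Delta>\<close> seen through the linear map induced by
  \<open>f\<close>.\<close>

lemma mult_lift:
  assumes P: "module k P" and f: "bilinear_map k H H P f" and "h \<in> carrier H" "g \<in> carrier H"
  shows "sw P f (h \<otimes> g) =
    sw P (\<lambda>x y. sw P (\<lambda>u v. f (x \<otimes> u) (y \<otimes> v)) g) h"
proof -
  note fl = HH.tensor_lift_linear[OF P f]
  have b: "bilinear_map k H H HT (\<lambda>u v. tensor k H H (x \<otimes> u) (y \<otimes> v))"
    if "x \<in> carrier H" "y \<in> carrier H" for x y
    using that by auto
  have b': "bilinear_map k H H HT (\<lambda>x y. sw HT (\<lambda>u v. tensor k H H (x \<otimes> u) (y \<otimes> v)) g)"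
    using assms(4) by auto
  have f1: "(\<lambda>x. f (r x) y) \<in> linear_maps k H P" if "r \<in> linear_maps k H H" "y \<in> carrier H" for r y
    by (rule linear_maps_comp[OF bilinear_mapD(2)[OF f] that(1)]) (rule that)
  have f2: "(\<lambda>x. f y (r x)) \<in> linear_maps k H P" if "r \<in> linear_maps k H H" "y \<in> carrier H" for r y
    by (rule linear_maps_comp[OF bilinear_mapD(1)[OF f] that(1)]) (rule that)
  have "\<Delta> (h \<otimes> g) = sw HT (\<lambda>x y. sw HT (\<lambda>u v. tensor k H H (x \<otimes> u) (y \<otimes> v)) g) h"
    using ring_hom_mult[OF comult_ring_hom assms(3,4)] by (simp add: tensor_algebra_def)
  also have "tensor_lift k P f \<dots> =
      sw P (\<lambda>x y. tensor_lift k P f (sw HT (\<lambda>u v. tensor k H H (x \<otimes> u) (y \<otimes> v)) g)) h"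
    by (rule HH.tensor_lift_hom[OF _ P b' fl]) (simp_all add: assms)
  also have "\<dots> = sw P (\<lambda>x y. sw P (\<lambda>u v. f (x \<otimes> u) (y \<otimes> v)) g) h"
  proof (rule HH.tensor_lift_cong[symmetric])
    fix x y assume xy: "x \<in> carrier H" "y \<in> carrier H"
    show "sw P (\<lambda>u v. f (x \<otimes> u) (y \<otimes> v)) g =
        tensor_lift k P f (sw HT (\<lambda>u v. tensor k H H (x \<otimes> u) (y \<otimes> v)) g)"
      using xy assms(4)
      by (subst HH.tensor_lift_hom[OF _ P b[OF xy] fl], simp, simp)
        (auto intro!: HH.tensor_lift_cong P f1 f2 simp: HH.tensor_lift_tensor[OF P f])
  qed (use assms in \<open>auto intro!: f1 f2\<close>)
  finally show ?thesis .
qed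

lemma one_lift:
  assumes "module k P" "bilinear_map k H H P f"
  shows "sw P f \<one> = f \<one> \<one>"
  using ring_hom_one[OF comult_ring_hom] HH.tensor_lift_tensor[OF assms, of \<one> \<one>]
  by (simp add: tensor_algebra_def)

lemma counit_mult: "\<lbrakk>x \<in> carrier H; y \<in> carrier H\<rbrakk> \<Longrightarrow> \<epsilon> (x \<otimes> y) = \<epsilon> x \<otimes>\<^bsub>k\<^esub> \<epsilon> y"
  and counit_one: "\<epsilon> \<one> = \<one>\<^bsub>k\<^esub>"
  using ring_hom_mult[OF counit_ring_hom] ring_hom_one[OF counit_ring_hom] by auto

end

section \<open>Identities for counit and antipode\<close>

context hopf_algebra
begin

lemma smult_one_mult: "\<lbrakk>r \<in> carrier k; x \<in> carrier H\<rbrakk> \<Longrightarrow> (r \<odot> \<one>) \<otimes> x = r \<odot> x"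
  "\<lbrakk>r \<in> carrier k; x \<in> carrier H\<rbrakk> \<Longrightarrow> x \<otimes> (r \<odot> \<one>) = r \<odot> x"
  by (simp_all add: smult_mult_left smult_mult_right)

lemma linear_counit_right:
  assumes P: "module k P" and G: "G \<in> linear_maps k H P" and h: "h \<in> carrier H"
  shows "sw P (\<lambda>x y. \<epsilon> y \<odot>\<^bsub>P\<^esub> G x) h = G h"
proof -
  have b: "bilinear_map k H H H (\<lambda>x y. \<epsilon> y \<odot> x)" by auto
  have "G (sw H (\<lambda>x y. \<epsilon> y \<odot> x) h) = sw P (\<lambda>x y. G (\<epsilon> y \<odot> x)) h"
    by (rule sw_hom) (use b P G h in auto)
  also have "\<dots> = sw P (\<lambda>x y. \<epsilon> y \<odot>\<^bsub>P\<^esub> G x) h"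
    by (rule sw_cong) (use P bilinear_map_comp[OF b G] h in \<open>auto simp: linear_mapsD[OF G]\<close>)
  finally show ?thesis using counit_right[OF h] by simp
qed

lemma linear_counit_left:
  assumes P: "module k P" and G: "G \<in> linear_maps k H P" and h: "h \<in> carrier H"
  shows "sw P (\<lambda>x y. \<epsilon> x \<odot>\<^bsub>P\<^esub> G y) h = G h"
proof -
  have b: "bilinear_map k H H H (\<lambda>x y. \<epsilon> x \<odot> y)" by auto
  have "G (sw H (\<lambda>x y. \<epsilon> x \<odot> y) h) = sw P (\<lambda>x y. G (\<epsilon> x \<odot> y)) h"
    by (rule sw_hom) (use b P G h in auto)
  also have "\<dots> = sw P (\<lambda>x y. \<epsilon> x \<odot>\<^bsub>P\<^esub> G y) h"
    by (rule sw_cong) (use P bilinear_map_comp[OF b G] h in \<open>auto simp: linear_mapsD[OF G]\<close>)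
  finally show ?thesis using counit_left[OF h] by simp
qed

lemma linear_antipode_right:
  assumes P: "module k P" and G: "G \<in> linear_maps k H P" and h: "h \<in> carrier H"
  shows "sw P (\<lambda>x y. G (x \<otimes> S y)) h = \<epsilon> h \<odot>\<^bsub>P\<^esub> G \<one>"
proof -
  have b: "bilinear_map k H H H (\<lambda>x y. x \<otimes> S y)" by auto
  show ?thesis
    using sw_hom[OF _ P b G, of h] antipode_right[OF h] h by (simp add: linear_mapsD[OF G])
qed

lemma linear_antipode_left:
  assumes P: "module k P" and G: "G \<in> linear_maps k H P" and h: "h \<in> carrier H"
  shows "sw P (\<lambda>x y. G (S x \<otimes> y)) h = \<epsilon> h \<odot>\<^bsub>P\<^esub> G \<one>"
proof -
  have b: "bilinear_map k H H H (\<lambda>x y. S x \<otimes> y)" by auto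
  show ?thesis
    using sw_hom[OF _ P b G, of h] antipode_left[OF h] h by (simp add: linear_mapsD[OF G])
qed

lemma mult_left_lin: "c \<in> carrier H \<Longrightarrow> (\<lambda>x. c \<otimes> x) \<in> linear_maps k H H"
  and mult_right_lin: "c \<in> carrier H \<Longrightarrow> (\<lambda>x. x \<otimes> c) \<in> linear_maps k H H"
  by auto

text \<open>\<open>S (h\<^sub>1 m) h\<^sub>2 = \<epsilon> h S m\<close>: insert \<open>m\<^sub>2 S m\<^sub>3\<close> on the right and use
  the antipode axiom for \<open>h m\<^sub>1\<close>.\<close>

lemma antipode_mult_cancel_left:
  assumes h: "h \<in> carrier H" and m: "m \<in> carrier H"
  shows "sw H (\<lambda>x y. S (x \<otimes> m) \<otimes> y) h = \<epsilon> h \<odot> S m"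
proof -
  define G where "G u = sw H (\<lambda>x y. S (x \<otimes> u) \<otimes> y) h" for u
  have G: "G \<in> linear_maps k H H"
    unfolding G_def using h by auto
  have Gc [simp]: "G u \<in> carrier H" if "u \<in> carrier H" for u by (rule linear_mapsD(1)[OF G that])
  have Gl [intro!]: "(\<lambda>x. G (f x)) \<in> linear_maps k H H" if "f \<in> linear_maps k H H" for f
    by (rule linear_maps_comp[OF G that])
  have inner: "sw H (\<lambda>u p. G u \<otimes> p) w = (\<epsilon> h \<otimes>\<^bsub>k\<^esub> \<epsilon> w) \<odot> \<one>" if w: "w \<in> carrier H" for w
  proof -
    have "sw H (\<lambda>u p. G u \<otimes> p) w =
        sw H (\<lambda>u p. sw H (\<lambda>x y. S (x \<otimes> u) \<otimes> (y \<otimes> p)) h) w"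
    proof (rule sw_cong)
      fix u p assume up: "u \<in> carrier H" "p \<in> carrier H"
      show "G u \<otimes> p = sw H (\<lambda>x y. S (x \<otimes> u) \<otimes> (y \<otimes> p)) h"
        unfolding G_def using up h
        by (subst sw_hom[OF _ _ _ mult_right_lin])
          (auto intro!: sw_cong simp: m_assoc)
    qed (use w in auto)
    also have "\<dots> = sw H (\<lambda>x y. sw H (\<lambda>u p. S (x \<otimes> u) \<otimes> (y \<otimes> p)) w) h"
      by (rule sw_swap)
        (use h w in auto)
    also have "\<dots> = sw H (\<lambda>x y. S x \<otimes> y) (h \<otimes> w)"
      by (rule mult_lift[symmetric]) (use h w in auto)
    finally show ?thesis using h w by (simp add: antipode_left counit_mult)
  qed
  have "G m = sw H (\<lambda>u v. \<epsilon> v \<odot> G u) m"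
    by (rule linear_counit_right[symmetric]) (use G m in auto)
  also have "\<dots> = sw H (\<lambda>u v. sw H (\<lambda>p q. G u \<otimes> (p \<otimes> S q)) v) m"
    by (rule sw_cong)
      (use m in \<open>auto simp: linear_antipode_right[OF _ mult_left_lin]\<close>)
  also have "\<dots> = sw H (\<lambda>w q. sw H (\<lambda>u p. G u \<otimes> (p \<otimes> S q)) w) m"
    by (rule coassoc_lift[symmetric]) (use m in auto)
  also have "\<dots> = sw H (\<lambda>w q. \<epsilon> w \<odot> (\<epsilon> h \<odot> S q)) m"
  proof (rule sw_cong)
    fix w q assume wq: "w \<in> carrier H" "q \<in> carrier H"
    have "sw H (\<lambda>u p. G u \<otimes> (p \<otimes> S q)) w = sw H (\<lambda>u p. G u \<otimes> p) w \<otimes> S q"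
      using wq by (subst sw_hom[OF _ _ _ mult_right_lin])
          (auto intro!: sw_cong simp: m_assoc)
    also have "\<dots> = \<epsilon> w \<odot> (\<epsilon> h \<odot> S q)"
      using wq h by (simp add: inner smult_one_mult R.m_comm flip: smult_assoc1)
    finally show "sw H (\<lambda>u p. G u \<otimes> (p \<otimes> S q)) w = \<epsilon> w \<odot> (\<epsilon> h \<odot> S q)" .
  qed (use m in auto)
  also have "\<dots> = \<epsilon> h \<odot> S m"
    by (rule linear_counit_left) (use m h in auto)
  finally show ?thesis by (simp add: G_def)
qed

text \<open>The mirror image of the previous argument: insert \<open>S m\<^sub>1 m\<^sub>2\<close>
  on the left and use the antipode axiom for \<open>m\<^sub>3 h\<close>.\<close>

lemma antipode_mult_cancel_right:
  assumes h: "h \<in> carrier H" and m: "m \<in> carrier H"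
  shows "sw H (\<lambda>x y. x \<otimes> S (m \<otimes> y)) h = \<epsilon> h \<odot> S m"
proof -
  define G where "G v = sw H (\<lambda>x y. x \<otimes> S (v \<otimes> y)) h" for v
  have G: "G \<in> linear_maps k H H"
    unfolding G_def using h by auto
  have Gc [simp]: "G u \<in> carrier H" if "u \<in> carrier H" for u by (rule linear_mapsD(1)[OF G that])
  have Gl [intro!]: "(\<lambda>x. G (f x)) \<in> linear_maps k H H" if "f \<in> linear_maps k H H" for f
    by (rule linear_maps_comp[OF G that])
  have inner: "sw H (\<lambda>q v. q \<otimes> G v) w = (\<epsilon> h \<otimes>\<^bsub>k\<^esub> \<epsilon> w) \<odot> \<one>" if w: "w \<in> carrier H" for w
  proof -
    have "sw H (\<lambda>q v. q \<otimes> G v) w =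
        sw H (\<lambda>q v. sw H (\<lambda>x y. (q \<otimes> x) \<otimes> S (v \<otimes> y)) h) w"
    proof (rule sw_cong)
      fix q v assume qv: "q \<in> carrier H" "v \<in> carrier H"
      show "q \<otimes> G v = sw H (\<lambda>x y. (q \<otimes> x) \<otimes> S (v \<otimes> y)) h"
        unfolding G_def using qv h
        by (subst sw_hom[OF _ _ _ mult_left_lin])
          (auto intro!: sw_cong simp: m_assoc)
    qed (use w in auto)
    also have "\<dots> = sw H (\<lambda>x y. x \<otimes> S y) (w \<otimes> h)"
      by (rule mult_lift[symmetric]) (use h w in auto)
    finally show ?thesis using h w by (simp add: antipode_right counit_mult R.m_comm)
  qed
  have "G m = sw H (\<lambda>u v. \<epsilon> u \<odot> G v) m"
    by (rule linear_counit_left[symmetric]) (use G m in auto)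
  also have "\<dots> = sw H (\<lambda>u v. sw H (\<lambda>p q. (S p \<otimes> q) \<otimes> G v) u) m"
    by (rule sw_cong)
      (use m in \<open>auto simp: linear_antipode_left[OF _ mult_right_lin]\<close>)
  also have "\<dots> = sw H (\<lambda>p w. sw H (\<lambda>q v. (S p \<otimes> q) \<otimes> G v) w) m"
    by (rule coassoc_lift) (use m in auto)
  also have "\<dots> = sw H (\<lambda>p w. \<epsilon> w \<odot> (\<epsilon> h \<odot> S p)) m"
  proof (rule sw_cong)
    fix p w assume wp: "p \<in> carrier H" "w \<in> carrier H"
    have "sw H (\<lambda>q v. (S p \<otimes> q) \<otimes> G v) w = S p \<otimes> sw H (\<lambda>q v. q \<otimes> G v) w"
      using wp by (subst sw_hom[OF _ _ _ mult_left_lin])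
          (auto intro!: sw_cong simp: m_assoc)
    also have "\<dots> = \<epsilon> w \<odot> (\<epsilon> h \<odot> S p)"
      using wp h by (simp add: inner smult_one_mult R.m_comm flip: smult_assoc1)
    finally show "sw H (\<lambda>q v. (S p \<otimes> q) \<otimes> G v) w = \<epsilon> w \<odot> (\<epsilon> h \<odot> S p)" .
  qed (use m in auto)
  also have "\<dots> = \<epsilon> h \<odot> S m"
    by (rule linear_counit_right) (use m h in auto)
  finally show ?thesis by (simp add: G_def)
qed

text \<open>A direct form of the uniqueness of convolution inverses: insert
  \<open>h\<^sub>2 S h\<^sub>3\<close> after \<open>S (h\<^sub>1 m)\<close> and collapse
  \<open>S (h\<^sub>1 m) h\<^sub>2\<close> to \<open>\<epsilon> h\<^sub>1 S m\<close>.\<close>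

lemma antipode_mult:
  assumes h: "h \<in> carrier H" and m: "m \<in> carrier H"
  shows "S (h \<otimes> m) = S m \<otimes> S h"
proof -
  have "S (h \<otimes> m) = sw H (\<lambda>u v. \<epsilon> v \<odot> S (u \<otimes> m)) h"
    by (rule linear_counit_right[symmetric]) (use h m in auto)
  also have "\<dots> = sw H (\<lambda>u v. sw H (\<lambda>p q. S (u \<otimes> m) \<otimes> (p \<otimes> S q)) v) h"
    by (rule sw_cong)
      (use h m in \<open>auto simp: linear_antipode_right[OF _ mult_left_lin]\<close>)
  also have "\<dots> = sw H (\<lambda>w q. sw H (\<lambda>u p. S (u \<otimes> m) \<otimes> (p \<otimes> S q)) w) h"
    by (rule coassoc_lift[symmetric]) (use h m in auto)
  also have "\<dots> = sw H (\<lambda>w q. \<epsilon> w \<odot> (S m \<otimes> S q)) h"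
  proof (rule sw_cong)
    fix w q assume wq: "w \<in> carrier H" "q \<in> carrier H"
    have "sw H (\<lambda>u p. S (u \<otimes> m) \<otimes> (p \<otimes> S q)) w =
        sw H (\<lambda>u p. S (u \<otimes> m) \<otimes> p) w \<otimes> S q"
      using wq m by (subst sw_hom[OF _ _ _ mult_right_lin])
          (auto intro!: sw_cong simp: m_assoc)
    then show "sw H (\<lambda>u p. S (u \<otimes> m) \<otimes> (p \<otimes> S q)) w = \<epsilon> w \<odot> (S m \<otimes> S q)"
      using wq m by (simp add: antipode_mult_cancel_left smult_mult_left)
  qed (use h m in auto)
  also have "\<dots> = S m \<otimes> S h"
    by (rule linear_counit_left) (use m h in auto)
  finally show ?thesis .
qed

lemma antipode_one: "S \<one> = \<one>"
proof -
  have "sw H (\<lambda>x y. S x \<otimes> y) \<one> = S \<one> \<otimes> \<one>"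
    by (rule one_lift) auto
  then show ?thesis by (simp add: antipode_left counit_one)
qed

end

section \<open>Integrals from a dual basis\<close>

text \<open>The coordinates of the embedding into a free module serve as functionals. Finite
  generation bounds their number, since the elements supported on a fixed index set form a
  submodule.\<close>

lemma (in module) finite_dual_basis:
  assumes fg: "finitely_generated_module R M" and proj: "projective_module R M"
  obtains I :: "'c set" and e \<phi> where "finite I" "\<And>i. i \<in> I \<Longrightarrow> e i \<in> carrier M"
    "\<And>i. i \<in> I \<Longrightarrow> functional R M (\<phi> i)"
    "\<And>x. x \<in> carrier M \<Longrightarrow> (\<Oplus>\<^bsub>M\<^esub>i\<in>I. \<phi> i x \<odot>\<^bsub>M\<^esub> e i) = x"
proof -
  obtain X :: "'c set" and i p where i: "i \<in> linear_maps R M (free_module R X)"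
    and p: "p \<in> linear_maps R (free_module R X) M" and pi: "\<And>x. x \<in> carrier M \<Longrightarrow> p (i x) = x"
    using proj unfolding projective_module_def by blast
  let ?F = "free_module R X"
  interpret F: module R ?F by (rule R.free_module_is_module)
  note iD = linear_mapsD[OF i] and pD = linear_mapsD[OF p]
  obtain G where G: "G \<subseteq> carrier M" "finite G" "carrier M = gen_submodule R M G"
    using fg unfolding finitely_generated_module_def by blast
  \<comment> \<open>The supports of the generators alone; all other elements of the module are then
    supported in this finite set as well.\<close>
  define I where "I = (\<Union>g\<in>G. {z. i g z \<noteq> \<zero>})"
  have c: "finite {z. i x z \<noteq> \<zero>}" "{z. i x z \<noteq> \<zero>} \<subseteq> X" "i x z \<in> carrier R" if "x \<in> carrier M" for x z
    using iD(1)[OF that] by (auto simp: free_module_def)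
  have I: "finite I" "I \<subseteq> X" using G(1,2) c by (auto simp: I_def)
  let ?N = "{x \<in> carrier M. \<forall>z. z \<notin> I \<longrightarrow> i x z = \<zero>}"
  have iz: "i \<zero>\<^bsub>M\<^esub> = (\<lambda>_. \<zero>)"
    using linear_maps_zero[OF module_axioms F.module_axioms i] by (simp add: free_module_def)
  have ia: "i (x \<oplus>\<^bsub>M\<^esub> y) z = i x z \<oplus> i y z" if "x \<in> carrier M" "y \<in> carrier M" for x y z
    using iD(2)[OF that] by (simp add: free_module_def)
  have ism: "i (r \<odot>\<^bsub>M\<^esub> x) z = r \<otimes> i x z" if "r \<in> carrier R" "x \<in> carrier M" for r x z
    using iD(3)[OF that] by (simp add: free_module_def)
  have "submodule ?N R M"
  proof (rule submoduleI)
    show "\<ominus>\<^bsub>M\<^esub> x \<in> ?N" if "x \<in> ?N" for x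
      using that ism[of "\<ominus> \<one>" x] c(3)[of x] by (simp add: smult_l_minus)
  qed (auto simp: iz ia ism)
  moreover have "G \<subseteq> ?N" using G(1) by (auto simp: I_def)
  ultimately have MN: "carrier M \<subseteq> ?N" unfolding G(3) gen_submodule_def by blast
  define e where "e z = p (free_basis R z)" for z
  have e: "e z \<in> carrier M" if "z \<in> X" for z
    unfolding e_def by (rule pD(1)[OF R.free_basis_in_carrier[OF that]])
  then have eX: "e \<in> X \<rightarrow> carrier M" by auto
  note LD = linear_mapsD[OF free_lift_linear[OF eX]]
  have pu: "p u = free_lift R M e u" if "u \<in> carrier ?F" for u
    using that
  proof (induction u rule: R.free_module_induct)
    case zero
    show ?case
      using linear_maps_zero[OF F.module_axioms module_axioms p]
        linear_maps_zero[OF F.module_axioms module_axioms free_lift_linear[OF eX]] by simp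
  next
    case (add r x u)
    then show ?case
      by (simp add: pD LD R.free_basis_in_carrier free_lift_basis[OF eX] flip: e_def)
  qed
  show ?thesis
  proof (rule that[of I e "\<lambda>z x. i x z"])
    show "(\<Oplus>\<^bsub>M\<^esub>z\<in>I. i x z \<odot>\<^bsub>M\<^esub> e z) = x" if x: "x \<in> carrier M" for x
    proof -
      have "{z. i x z \<noteq> \<zero>} \<subseteq> I" using MN x by blast
      then have "free_lift R M e (i x) = (\<Oplus>\<^bsub>M\<^esub>z\<in>I. i x z \<odot>\<^bsub>M\<^esub> e z)"
        by (intro free_lift_superset[OF eX iD(1)[OF x]] I)
      then show ?thesis using pu[OF iD(1)[OF x]] pi[OF x] by simp
    qed
    show "functional R M (\<lambda>x. i x z)" if "z \<in> I" for z
      unfolding functional_def using c(3) ia ism by auto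
  qed (use I e in auto)
qed

lemma (in abelian_monoid) finsum_swap:
  assumes "finite I" "finite J" "\<And>i j. i \<in> I \<Longrightarrow> j \<in> J \<Longrightarrow> f i j \<in> carrier G"
  shows "(\<Oplus>i\<in>I. \<Oplus>j\<in>J. f i j) = (\<Oplus>j\<in>J. \<Oplus>i\<in>I. f i j)"
  using assms(1,3)
proof (induction I)
  case (insert i I)
  have fi: "(\<lambda>j. f i j) \<in> J \<rightarrow> carrier G" and fI: "(\<lambda>j. \<Oplus>i\<in>I. f i j) \<in> J \<rightarrow> carrier G"
    using insert.prems by (auto intro!: finsum_closed)
  have "(\<Oplus>j\<in>J. \<Oplus>i\<in>insert i I. f i j) = (\<Oplus>j\<in>J. f i j \<oplus> (\<Oplus>i\<in>I. f i j))"
    using insert fi fI by (intro finsum_cong') (auto simp: Pi_iff)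
  also have "\<dots> = (\<Oplus>j\<in>J. f i j) \<oplus> (\<Oplus>j\<in>J. \<Oplus>i\<in>I. f i j)"
    by (rule finsum_addf[OF fi fI])
  also have "\<dots> = (\<Oplus>i\<in>insert i I. \<Oplus>j\<in>J. f i j)"
    using insert by (subst finsum_insert) (auto intro!: finsum_closed)
  finally show ?case by simp
qed simp

locale hopf_algebra_dual_basis = hopf_algebra k H \<Delta> \<epsilon> S
  for k :: "('k, 'l) ring_scheme" and H :: "('k, 'h, 'm) module_scheme" (structure) and \<Delta> \<epsilon> S +
  fixes I :: "'i set" and e :: "'i \<Rightarrow> 'h" and \<phi> :: "'i \<Rightarrow> 'h \<Rightarrow> 'k"
  assumes finite_I: "finite I" and e_closed [simp]: "i \<in> I \<Longrightarrow> e i \<in> carrier H"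
    and \<phi>_functional: "i \<in> I \<Longrightarrow> functional k H (\<phi> i)"
    and dual_basis: "x \<in> carrier H \<Longrightarrow> (\<Oplus>i\<in>I. \<phi> i x \<odot> e i) = x"
begin

lemma \<phi>_closed [simp]: "\<lbrakk>i \<in> I; x \<in> carrier H\<rbrakk> \<Longrightarrow> \<phi> i x \<in> carrier k"
  by (rule functionalD(1)[OF \<phi>_functional])

lemmas [intro!] = linear_maps_functional[OF _ \<phi>_functional]

lemma linear_dual_basis:
  assumes P: "module k P" and G: "G \<in> linear_maps k H P" and y: "y \<in> carrier H"
  shows "G y = (\<Oplus>\<^bsub>P\<^esub>i\<in>I. \<phi> i y \<odot>\<^bsub>P\<^esub> G (e i))"
proof -
  interpret P: module k P by (rule P)
  have "G (\<Oplus>i\<in>I. \<phi> i y \<odot> e i) = (\<Oplus>\<^bsub>P\<^esub>i\<in>I. G (\<phi> i y \<odot> e i))"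
    by (rule linear_maps_finsum[OF module_axioms P G]) (use y in auto)
  also have "\<dots> = (\<Oplus>\<^bsub>P\<^esub>i\<in>I. \<phi> i y \<odot>\<^bsub>P\<^esub> G (e i))"
    by (rule P.finsum_cong') (use y in \<open>auto simp: linear_mapsD[OF G]\<close>)
  finally show ?thesis by (simp add: dual_basis y)
qed

abbreviation contract :: "('h \<Rightarrow> 'k) \<Rightarrow> ('h \<times> 'h \<Rightarrow> 'k) set \<Rightarrow> 'h" where
  "contract g X \<equiv> tensor_lift k H (\<lambda>x y. g y \<odot> x) X"

text \<open>Cyclicity of the trace, with the second tensor factor traced out: expand
  \<open>\<alpha> (e j)\<close> in the dual basis, exchange the sums, and reassemble
  \<open>\<alpha>\<close> on the other side of \<open>W\<close>.\<close>

lemma dual_basis_trace: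
  assumes W: "W \<in> linear_maps k H HT" and \<alpha>: "\<alpha> \<in> linear_maps k H H"
  shows "(\<Oplus>j\<in>I. contract (\<phi> j) (W (\<alpha> (e j)))) = (\<Oplus>l\<in>I. contract (\<lambda>z. \<phi> l (\<alpha> z)) (W (e l)))"
proof -
  note [simp] = linear_mapsD(1)[OF W] linear_mapsD(1)[OF \<alpha>]
  have \<alpha>c: "(\<lambda>x. \<alpha> (f x)) \<in> linear_maps k M H" if "f \<in> linear_maps k M H"
    for M :: "('k, 'h, 'm) module_scheme" and f by (rule linear_maps_comp[OF \<alpha> that])
  have b: "bilinear_map k H H H (\<lambda>x y. \<phi> l y \<odot> x)" if "l \<in> I" for l
    using that by auto
  have b\<alpha>: "bilinear_map k H H H (\<lambda>x y. \<phi> l (\<alpha> y) \<odot> x)" if "l \<in> I" for l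
    using that by (auto intro!: \<alpha>c)
  have c [simp]: "contract (\<phi> j) X \<in> carrier H" if "j \<in> I" "X \<in> carrier HT" for j X
    by (rule HH.tensor_lift_closed[OF _ b[OF that(1)] that(2)]) simp
  have "(\<Oplus>j\<in>I. contract (\<phi> j) (W (\<alpha> (e j)))) =
      (\<Oplus>j\<in>I. \<Oplus>l\<in>I. \<phi> l (\<alpha> (e j)) \<odot> contract (\<phi> j) (W (e l)))"
  proof (rule finsum_cong')
    fix j assume j: "j \<in> I"
    have "(\<lambda>z. contract (\<phi> j) (W z)) \<in> linear_maps k H H"
      by (intro linear_maps_comp[OF _ W] HH.tensor_lift_linear b j) simp
    then show "contract (\<phi> j) (W (\<alpha> (e j))) = (\<Oplus>l\<in>I. \<phi> l (\<alpha> (e j)) \<odot> contract (\<phi> j) (W (e l)))"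
      by (rule linear_dual_basis[rotated]) (use j in auto)
  qed (auto intro!: finsum_closed)
  also have "\<dots> = (\<Oplus>l\<in>I. \<Oplus>j\<in>I. \<phi> l (\<alpha> (e j)) \<odot> contract (\<phi> j) (W (e l)))"
    by (rule finsum_swap) (auto simp: finite_I)
  also have "\<dots> = (\<Oplus>l\<in>I. contract (\<lambda>z. \<phi> l (\<alpha> z)) (W (e l)))"
  proof (rule finsum_cong')
    fix l assume l: "l \<in> I"
    show "(\<Oplus>j\<in>I. \<phi> l (\<alpha> (e j)) \<odot> contract (\<phi> j) (W (e l))) = contract (\<lambda>z. \<phi> l (\<alpha> z)) (W (e l))"
    proof (rule HH.linear_eqI[where f = "\<lambda>X. \<Oplus>j\<in>I. \<phi> l (\<alpha> (e j)) \<odot> contract (\<phi> j) X"])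
      fix x y assume xy: "x \<in> carrier H" "y \<in> carrier H"
      have "(\<Oplus>j\<in>I. \<phi> l (\<alpha> (e j)) \<odot> contract (\<phi> j) (tensor k H H x y)) =
          (\<Oplus>j\<in>I. \<phi> j y \<odot> (\<phi> l (\<alpha> (e j)) \<odot> x))"
        by (rule finsum_cong')
          (use xy l in \<open>auto simp: HH.tensor_lift_tensor[OF _ b] R.m_comm simp flip: smult_assoc1\<close>)
      also have "\<dots> = \<phi> l (\<alpha> y) \<odot> x"
        by (rule linear_dual_basis[symmetric]) (use xy l in \<open>auto intro!: \<alpha>c linear_maps_ident\<close>)
      finally show "(\<Oplus>j\<in>I. \<phi> l (\<alpha> (e j)) \<odot> contract (\<phi> j) (tensor k H H x y)) =
          contract (\<lambda>z. \<phi> l (\<alpha> z)) (tensor k H H x y)"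
        using xy l by (simp add: HH.tensor_lift_tensor[OF _ b\<alpha>])
    next
      show "contract (\<lambda>z. \<phi> l (\<alpha> z)) \<in> linear_maps k HT H"
        by (rule HH.tensor_lift_linear[OF _ b\<alpha>[OF l]]) simp
      show "(\<lambda>X. \<Oplus>j\<in>I. \<phi> l (\<alpha> (e j)) \<odot> contract (\<phi> j) X) \<in> linear_maps k HT H"
        by (intro linear_maps_sum linear_maps_smult HH.tensor_lift_linear b) (use l in auto)
    qed (use l in auto)
  qed (auto intro!: HH.tensor_lift_closed b\<alpha>)
  finally show ?thesis .
qed

abbreviation hit (infixr \<open>\<rightharpoonup>\<close> 75) where "g \<rightharpoonup> h \<equiv> contract g (\<Delta> h)"

text \<open>Moves left multiplication by \<open>h\<close> inside a contraction. Expanding the right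
  side gives \<open>h\<^sub>1 m\<^sub>1\<close> weighted by
  \<open>f (S (h\<^sub>2 m\<^sub>2) h\<^sub>3)\<close>, and \<open>antipode_mult_cancel_left\<close>
  removes \<open>h\<^sub>2\<close> and \<open>h\<^sub>3\<close> from the weight.\<close>

lemma mult_contract_antipode:
  assumes f: "functional k H f" and h: "h \<in> carrier H" and m: "m \<in> carrier H"
  shows "h \<otimes> (\<lambda>y. f (S y)) \<rightharpoonup> m =
    sw H (\<lambda>a b. (\<lambda>y. f (S y \<otimes> b)) \<rightharpoonup> (a \<otimes> m)) h"
proof -
  note [intro!] = linear_maps_functional[OF _ f] and [simp] = functionalD(1)[OF f]
  let ?Z = "(\<lambda>y. f (S y)) \<rightharpoonup> m"
  have Z: "?Z \<in> carrier H" using m by auto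
  let ?K = "\<lambda>p q b. sw H (\<lambda>x y. f (S (q \<otimes> y) \<otimes> b) \<odot> (p \<otimes> x)) m"
  have "sw H (\<lambda>a b. (\<lambda>y. f (S y \<otimes> b)) \<rightharpoonup> (a \<otimes> m)) h =
      sw H (\<lambda>a b. sw H (\<lambda>p q. ?K p q b) a) h"
    by (rule sw_cong) (use h m in \<open>auto intro!: mult_lift\<close>)
  also have "\<dots> = sw H (\<lambda>p c. sw H (\<lambda>q b. ?K p q b) c) h"
    by (rule coassoc_lift) (use h m in auto)
  also have "\<dots> = sw H (\<lambda>p c. \<epsilon> c \<odot> (p \<otimes> ?Z)) h"
  proof (rule sw_cong)
    fix p c assume pc: "p \<in> carrier H" "c \<in> carrier H"
    have "sw H (\<lambda>q b. ?K p q b) c =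
        sw H (\<lambda>x y. sw H (\<lambda>q b. f (S (q \<otimes> y) \<otimes> b) \<odot> (p \<otimes> x)) c) m"
      by (rule sw_swap)
        (use pc m in auto)
    also have "\<dots> = sw H (\<lambda>x y. \<epsilon> c \<odot> (p \<otimes> (f (S y) \<odot> x))) m"
    proof (rule sw_cong)
      fix x y assume xy: "x \<in> carrier H" "y \<in> carrier H"
      have G: "(\<lambda>z. f z \<odot> (p \<otimes> x)) \<in> linear_maps k H H"
        using xy pc by auto
      have b: "bilinear_map k H H H (\<lambda>q b. S (q \<otimes> y) \<otimes> b)" using xy by auto
      have "sw H (\<lambda>q b. f (S (q \<otimes> y) \<otimes> b) \<odot> (p \<otimes> x)) c =
          f (sw H (\<lambda>q b. S (q \<otimes> y) \<otimes> b) c) \<odot> (p \<otimes> x)"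
        by (rule sw_hom[OF _ _ b G, symmetric]) (use pc in auto)
      also have "\<dots> = \<epsilon> c \<odot> (p \<otimes> (f (S y) \<odot> x))"
        using xy pc by (simp add: antipode_mult_cancel_left functionalD[OF f] smult_assoc1 smult_mult_right)
      finally show "sw H (\<lambda>q b. f (S (q \<otimes> y) \<otimes> b) \<odot> (p \<otimes> x)) c =
          \<epsilon> c \<odot> (p \<otimes> (f (S y) \<odot> x))" .
    qed (use pc m in auto)
    also have "\<dots> = \<epsilon> c \<odot> (p \<otimes> ?Z)"
      by (rule sw_hom[symmetric]) (use pc m in auto)
    finally show "sw H (\<lambda>q b. ?K p q b) c = \<epsilon> c \<odot> (p \<otimes> ?Z)" .
  qed (use h m in auto)
  also have "\<dots> = h \<otimes> ?Z"
    by (rule linear_counit_right) (use h Z in auto)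
  finally show ?thesis by simp
qed

text \<open>The partial trace, over the second tensor factor, of the map
  \<open>z \<mapsto> z\<^sub>1 \<otimes> S (S z\<^sub>2) m\<close>. The parameter \<open>m\<close>
  provides enough integrals to recover the unit of \<open>H\<close>.\<close>

definition integral :: "'h \<Rightarrow> 'h" where
  "integral m = (\<Oplus>l\<in>I. (\<lambda>q. \<phi> l (S (S q) \<otimes> m)) \<rightharpoonup> e l)"

lemma integral_bilinear:
  "\<lbrakk>l \<in> I; m \<in> carrier H\<rbrakk> \<Longrightarrow> bilinear_map k H H H (\<lambda>p q. \<phi> l (S (S q) \<otimes> m) \<odot> p)"
  by auto

lemma integral_closed: "m \<in> carrier H \<Longrightarrow> integral m \<in> carrier H"
  unfolding integral_def
  by (intro finsum_closed funcsetI HH.tensor_lift_closed integral_bilinear) auto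

text \<open>Multiplication by \<open>h\<close> is moved into the trace as multiplication of the
  argument by \<open>h\<^sub>1\<close>, with \<open>h\<^sub>2\<close> left in the weight. Cyclicity
  carries \<open>h\<^sub>1\<close> to the other end of the traced factor, where it meets
  \<open>h\<^sub>2\<close> and cancels to \<open>\<epsilon> h\<close>.\<close>

lemma integral_in_left_integrals:
  assumes m: "m \<in> carrier H"
  shows "integral m \<in> left_integrals H \<epsilon>"
proof -
  let ?c = "\<lambda>l. (\<lambda>q. \<phi> l (S (S q) \<otimes> m)) \<rightharpoonup> e l"
  let ?F = "\<lambda>l a b. (\<lambda>y. \<phi> l (S (S y \<otimes> b) \<otimes> m)) \<rightharpoonup> (a \<otimes> e l)"
  let ?G = "\<lambda>l a b. (\<lambda>y. \<phi> l (a \<otimes> (S (S y \<otimes> b) \<otimes> m))) \<rightharpoonup> e l"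
  have "h \<otimes> integral m = \<epsilon> h \<odot> integral m" if h: "h \<in> carrier H" for h
  proof -
    have "h \<otimes> integral m = (\<Oplus>l\<in>I. h \<otimes> ?c l)"
      unfolding integral_def
      by (rule linear_maps_finsum[OF module_axioms module_axioms mult_left_lin])
        (use h m in \<open>auto intro!: HH.tensor_lift_closed integral_bilinear\<close>)
    also have "\<dots> = (\<Oplus>l\<in>I. sw H (\<lambda>a b. ?F l a b) h)"
    proof (rule finsum_cong')
      fix l assume l: "l \<in> I"
      have "functional k H (\<lambda>z. \<phi> l (S z \<otimes> m))"
        unfolding functional_def using l m
        by (auto simp: linear_mapsD[OF antipode_linear] functionalD[OF \<phi>_functional] l_distr smult_mult_left)
      from mult_contract_antipode[OF this h, of "e l"]
      show "h \<otimes> ?c l =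
          sw H (\<lambda>a b. ?F l a b) h"
        using l by simp
    qed (use h m in auto)
    also have "\<dots> = sw H (\<lambda>a b. \<Oplus>l\<in>I. ?F l a b) h"
      by (rule sw_finsum[symmetric]) (use h m in auto)
    also have "\<dots> = sw H (\<lambda>a b. \<Oplus>l\<in>I. ?G l a b) h"
    proof (rule sw_cong)
      fix a b assume ab: "a \<in> carrier H" "b \<in> carrier H"
      \<comment> \<open>With this \<open>W\<close>, the sum of \<open>?F\<close> is the trace of
        \<open>W\<close> after multiplication by \<open>a\<close>, and the sum of \<open>?G\<close>
        the trace of \<open>W\<close> followed by multiplication by \<open>a\<close> in the second
        factor.\<close>
      define W where "W z = sw HT (\<lambda>x y. tensor k H H x (S (S y \<otimes> b) \<otimes> m)) z" for z
      have bW: "bilinear_map k H H HT (\<lambda>x y. tensor k H H x (S (S y \<otimes> b) \<otimes> m))"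
        using ab m by auto
      have W: "W \<in> linear_maps k H HT"
        unfolding W_def by (intro tensor_lift_comp bW comult_linear) simp
      have contr: "contract g (W z) = (\<lambda>y. g (S (S y \<otimes> b) \<otimes> m)) \<rightharpoonup> z"
        if g: "functional k H g" and z: "z \<in> carrier H" for g z
      proof -
        note [intro!] = linear_maps_functional[OF _ g]
        have bg: "bilinear_map k H H H (\<lambda>x y. g y \<odot> x)"
          using functionalD(1)[OF g] by auto
        have b2: "bilinear_map k H H H (\<lambda>x y. g (S (S y \<otimes> b) \<otimes> m) \<odot> x)"
          using functionalD(1)[OF g] ab m by auto
        have "contract g (W z) = sw H (\<lambda>x y. contract g (tensor k H H x (S (S y \<otimes> b) \<otimes> m))) z"
          unfolding W_def
          by (rule sw_hom[OF _ _ bW HH.tensor_lift_linear[OF _ bg]]) (use z in auto)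
        also have "\<dots> = (\<lambda>y. g (S (S y \<otimes> b) \<otimes> m)) \<rightharpoonup> z"
          by (rule sw_cong[OF _ b2, symmetric])
            (use z ab m in \<open>auto simp: HH.tensor_lift_tensor[OF _ bg]\<close>)
        finally show ?thesis .
      qed
      have fa: "functional k H (\<lambda>z. \<phi> l (a \<otimes> z))" if "l \<in> I" for l
        unfolding functional_def using that ab
        by (auto simp: functionalD[OF \<phi>_functional] r_distr smult_mult_right)
      have "(\<Oplus>l\<in>I. ?F l a b) =
          (\<Oplus>l\<in>I. contract (\<phi> l) (W (a \<otimes> e l)))"
        by (rule finsum_cong')
          (use ab m in \<open>auto simp: contr[OF \<phi>_functional] linear_mapsD(1)[OF W]\<close>)
      also have "\<dots> = (\<Oplus>l\<in>I. contract (\<lambda>z. \<phi> l (a \<otimes> z)) (W (e l)))"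
        by (rule dual_basis_trace[OF W mult_left_lin[OF ab(1)]])
      also have "\<dots> = (\<Oplus>l\<in>I. ?G l a b)"
        by (rule finsum_cong') (use ab m in \<open>auto simp: contr[OF fa]\<close>)
      finally show "(\<Oplus>l\<in>I. ?F l a b) =
          (\<Oplus>l\<in>I. ?G l a b)" .
    qed (use h m in \<open>auto intro!: linear_maps_sum\<close>)
    also have "\<dots> = (\<Oplus>l\<in>I. sw H (\<lambda>a b. ?G l a b) h)"
      by (rule sw_finsum) (use h m in auto)
    also have "\<dots> = (\<Oplus>l\<in>I. \<epsilon> h \<odot> ?c l)"
    proof (rule finsum_cong')
      fix l assume l: "l \<in> I"
      \<comment> \<open>The exchange makes the sum over \<open>h\<close> the inner one, where
        \<open>h\<^sub>1 S (S y h\<^sub>2)\<close> collapses to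
        \<open>\<epsilon> h S (S y)\<close>.\<close>
      have "sw H (\<lambda>a b. ?G l a b) h =
          sw H (\<lambda>x y. sw H (\<lambda>a b. \<phi> l (a \<otimes> (S (S y \<otimes> b) \<otimes> m)) \<odot> x) h) (e l)"
        by (rule sw_swap)
          (use h m l in auto)
      also have "\<dots> = sw H (\<lambda>x y. \<epsilon> h \<odot> (\<phi> l (S (S y) \<otimes> m) \<odot> x)) (e l)"
      proof (rule sw_cong)
        fix x y assume xy: "x \<in> carrier H" "y \<in> carrier H"
        have G: "(\<lambda>z. \<phi> l (z \<otimes> m) \<odot> x) \<in> linear_maps k H H"
          using xy l m by auto
        have b: "bilinear_map k H H H (\<lambda>a b. a \<otimes> S (S y \<otimes> b))" using xy by auto
        have "\<phi> l (sw H (\<lambda>a b. a \<otimes> S (S y \<otimes> b)) h \<otimes> m) \<odot> x =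
            sw H (\<lambda>a b. \<phi> l (a \<otimes> S (S y \<otimes> b) \<otimes> m) \<odot> x) h"
          by (rule sw_hom[OF _ _ b G]) (use h in auto)
        also have "\<dots> = sw H (\<lambda>a b. \<phi> l (a \<otimes> (S (S y \<otimes> b) \<otimes> m)) \<odot> x) h"
          by (rule sw_cong) (use xy l m h in \<open>auto simp: m_assoc\<close>)
        finally show "sw H (\<lambda>a b. \<phi> l (a \<otimes> (S (S y \<otimes> b) \<otimes> m)) \<odot> x) h =
            \<epsilon> h \<odot> (\<phi> l (S (S y) \<otimes> m) \<odot> x)"
          using xy h m l
          by (simp add: antipode_mult_cancel_right smult_mult_left functionalD[OF \<phi>_functional] smult_assoc1)
      qed (use h m l in auto)
      also have "\<dots> = \<epsilon> h \<odot> ?c l"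
        by (rule sw_hom[symmetric]) (use h m l in auto)
      finally show "sw H (\<lambda>a b. ?G l a b) h =
          \<epsilon> h \<odot> ?c l" .
    qed (use h m in auto)
    also have "\<dots> = \<epsilon> h \<odot> integral m"
      unfolding integral_def
      by (rule finsum_smult_ldistr[symmetric]) (use h m finite_I in auto)
    finally show ?thesis .
  qed
  then show ?thesis using integral_closed[OF m] by (simp add: left_integrals_def)
qed

text \<open>The integrals \<open>t\<^sub>i = integral (e i)\<close> generate \<open>H\<close> as an \<open>H\<^sup>*\<close>-module: this is the
  surjectivity half of the fundamental theorem of Hopf modules.\<close>

lemma integrals_generate_one: "(\<Oplus>i\<in>I. (\<lambda>y. \<phi> i (S y)) \<rightharpoonup> integral (e i)) = \<one>"
proof -
  let ?c = "\<lambda>i p. (\<lambda>y. \<phi> i (S y)) \<rightharpoonup> p"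
  let ?t = "\<lambda>i l. (\<lambda>q. \<phi> l (S (S q) \<otimes> e i)) \<rightharpoonup> e l"
  let ?s = "\<lambda>i l. sw H (\<lambda>p q. \<phi> l (S (S q) \<otimes> e i) \<odot> ?c i p) (e l)"
  have b: "bilinear_map k H H H (\<lambda>x y. \<phi> i (S y) \<odot> x)" if "i \<in> I" for i
    using that by auto
  have cl: "(\<lambda>z. ?c i z) \<in> linear_maps k H H" if "i \<in> I" for i
    using b[OF that] by (intro tensor_lift_comp comult_linear) simp_all
  note cc [simp] = linear_mapsD(1)[OF cl]
  have "(\<Oplus>i\<in>I. ?c i (integral (e i))) =
      (\<Oplus>i\<in>I. \<Oplus>l\<in>I. ?s i l)"
  proof (rule finsum_cong')
    fix i assume i: "i \<in> I"
    have "?c i (integral (e i)) =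
        (\<Oplus>l\<in>I. ?c i (?t i l))"
      unfolding integral_def
      by (rule linear_maps_finsum[OF module_axioms module_axioms cl[OF i]])
        (use i in \<open>auto intro!: HH.tensor_lift_closed integral_bilinear\<close>)
    also have "\<dots> = (\<Oplus>l\<in>I. ?s i l)"
    proof (rule finsum_cong')
      fix l assume l: "l \<in> I"
      have "?c i (?t i l) =
          sw H (\<lambda>p q. ?c i (\<phi> l (S (S q) \<otimes> e i) \<odot> p)) (e l)"
        by (rule sw_hom[OF _ _ integral_bilinear cl]) (use i l in auto)
      also have "\<dots> = ?s i l"
        by (rule sw_cong[symmetric])
          (use i l in \<open>auto simp: linear_mapsD(3)[OF cl]\<close>)
      finally show "?c i (?t i l) =
          ?s i l" .
    qed (use i in auto)
    finally show "?c i (integral (e i)) =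
        (\<Oplus>l\<in>I. ?s i l)" .
  qed (auto intro!: finsum_closed)
  \<comment> \<open>Summing over \<open>i\<close> first removes one dual basis: it replaces
    \<open>e i\<close> by \<open>S y\<close>. Since \<open>S\<close> reverses products, the weight
    becomes \<open>\<phi> l (S (y \<otimes> S q))\<close>. Coassociativity then makes
    \<open>y\<close> and \<open>q\<close> the two parts of one element, so that the antipode axiom
    leaves the coordinates of the unit.\<close>
  also have "\<dots> = (\<Oplus>l\<in>I. \<Oplus>i\<in>I. ?s i l)"
    by (rule finsum_swap) (use finite_I in auto)
  also have "\<dots> = (\<Oplus>l\<in>I. \<phi> l \<one> \<odot> e l)"
  proof (rule finsum_cong')
    fix l assume l: "l \<in> I"
    have "(\<Oplus>i\<in>I. ?s i l) =
        sw H (\<lambda>p q. \<Oplus>i\<in>I. \<phi> l (S (S q) \<otimes> e i) \<odot> ?c i p) (e l)"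
      by (rule sw_finsum[symmetric]) (use l in auto)
    also have "\<dots> = sw H (\<lambda>p q. sw H (\<lambda>x y. \<phi> l (S (y \<otimes> S q)) \<odot> x) p) (e l)"
    proof (rule sw_cong)
      fix p q assume pq: "p \<in> carrier H" "q \<in> carrier H"
      have "(\<Oplus>i\<in>I. \<phi> l (S (S q) \<otimes> e i) \<odot> ?c i p) =
          (\<Oplus>i\<in>I. sw H (\<lambda>x y. \<phi> i (S y) \<odot> (\<phi> l (S (S q) \<otimes> e i) \<odot> x)) p)"
      proof (rule finsum_cong')
        fix i assume i: "i \<in> I"
        have "\<phi> l (S (S q) \<otimes> e i) \<odot> ?c i p =
            sw H (\<lambda>x y. \<phi> l (S (S q) \<otimes> e i) \<odot> (\<phi> i (S y) \<odot> x)) p"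
          by (rule sw_hom[OF _ _ b]) (use pq i l in auto)
        also have "\<dots> = sw H (\<lambda>x y. \<phi> i (S y) \<odot> (\<phi> l (S (S q) \<otimes> e i) \<odot> x)) p"
          by (rule sw_cong)
            (use pq i l in \<open>auto simp: R.m_comm simp flip: smult_assoc1\<close>)
        finally show "\<phi> l (S (S q) \<otimes> e i) \<odot> ?c i p =
            sw H (\<lambda>x y. \<phi> i (S y) \<odot> (\<phi> l (S (S q) \<otimes> e i) \<odot> x)) p" .
      qed (use pq l in auto)
      also have "\<dots> = sw H (\<lambda>x y. \<Oplus>i\<in>I. \<phi> i (S y) \<odot> (\<phi> l (S (S q) \<otimes> e i) \<odot> x)) p"
        by (rule sw_finsum[symmetric]) (use pq l in auto)
      also have "\<dots> = sw H (\<lambda>x y. \<phi> l (S (y \<otimes> S q)) \<odot> x) p"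
      proof (rule sw_cong)
        fix x y assume xy: "x \<in> carrier H" "y \<in> carrier H"
        have G: "(\<lambda>z. \<phi> l (S (S q) \<otimes> z) \<odot> x) \<in> linear_maps k H H"
          using xy l pq by auto
        show "(\<Oplus>i\<in>I. \<phi> i (S y) \<odot> (\<phi> l (S (S q) \<otimes> e i) \<odot> x)) = \<phi> l (S (y \<otimes> S q)) \<odot> x"
          using linear_dual_basis[OF _ G, of "S y"] xy pq by (simp add: antipode_mult)
      qed (use pq l in \<open>auto intro!: linear_maps_sum\<close>)
      finally show "(\<Oplus>i\<in>I. \<phi> l (S (S q) \<otimes> e i) \<odot> ?c i p) =
          sw H (\<lambda>x y. \<phi> l (S (y \<otimes> S q)) \<odot> x) p" .
    qed (use l in \<open>auto intro!: linear_maps_sum\<close>)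
    also have "\<dots> = sw H (\<lambda>x r. sw H (\<lambda>y q. \<phi> l (S (y \<otimes> S q)) \<odot> x) r) (e l)"
      by (rule coassoc_lift) (use l in auto)
    also have "\<dots> = sw H (\<lambda>x r. \<epsilon> r \<odot> (\<phi> l \<one> \<odot> x)) (e l)"
    proof (rule sw_cong)
      fix x r assume xr: "x \<in> carrier H" "r \<in> carrier H"
      have G: "(\<lambda>z. \<phi> l (S z) \<odot> x) \<in> linear_maps k H H"
        using xr l by auto
      show "sw H (\<lambda>y q. \<phi> l (S (y \<otimes> S q)) \<odot> x) r = \<epsilon> r \<odot> (\<phi> l \<one> \<odot> x)"
        using linear_antipode_right[OF _ G xr(2)] by (simp add: antipode_one)
    qed (use l in auto)
    also have "\<dots> = \<phi> l \<one> \<odot> e l"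
      by (rule linear_counit_right) (use l in auto)
    finally show "(\<Oplus>i\<in>I. ?s i l) =
        \<phi> l \<one> \<odot> e l" .
  qed auto
  also have "\<dots> = \<one>" by (rule dual_basis) simp
  finally show ?thesis .
qed

end

section \<open>The smash product\<close>

context left_module_algebra
begin

abbreviation "AH \<equiv> tensor_module k A H"
abbreviation smash_elem (infixl \<open>\<sharp>\<close> 68) where "a \<sharp> h \<equiv> tensor k A H a h"
abbreviation "R \<equiv> smash_product k A H \<Delta> act"

sublocale AH: two_modules k A H ..

lemma act_linear [intro!]:
  "\<lbrakk>h \<in> carrier H; f \<in> linear_maps k M A\<rbrakk> \<Longrightarrow> (\<lambda>x. act h (f x)) \<in> linear_maps k M A"
  "\<lbrakk>g \<in> linear_maps k M H; a \<in> carrier A\<rbrakk> \<Longrightarrow> (\<lambda>x. act (g x) a) \<in> linear_maps k M A"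
  by (rule linear_mapsI; simp add: linear_mapsD act_closed act_add_left act_add_right act_smult_left act_smult_right)+

declare act_closed [simp, intro]

lemma AH_tensor_lift_comp [intro!]:
  "\<lbrakk>module k P; bilinear_map k A H P F; X \<in> linear_maps k M AH\<rbrakk> \<Longrightarrow>
    (\<lambda>x. tensor_lift k P F (X x)) \<in> linear_maps k M P"
  by (rule linear_maps_comp[OF AH.tensor_lift_linear])

lemmas [intro!] = AH.tensor_lift_linear_param AH.tensor_lift_closed AH.tensor_linear
lemmas [simp, intro!] = A.module_axioms AH.T.module_axioms

lemma smash_simps [simp]:
  "carrier R = carrier AH" "add R = add AH" "zero R = zero AH" "smult R = smult AH"
  "\<one>\<^bsub>R\<^esub> = \<one>\<^bsub>A\<^esub> \<sharp> \<one>\<^bsub>H\<^esub>"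
  by (simp_all add: smash_product_def)

abbreviation mult_A (infixl \<open>\<cdot>\<close> 70) where "x \<cdot> y \<equiv> x \<otimes>\<^bsub>A\<^esub> y"
abbreviation mult_R (infixl \<open>\<star>\<close> 70) where "x \<star> y \<equiv> x \<otimes>\<^bsub>R\<^esub> y"
abbreviation one_A (\<open>\<one>\<^sub>A\<close>) where "\<one>\<^sub>A \<equiv> \<one>\<^bsub>A\<^esub>"
abbreviation one_H (\<open>\<one>\<^sub>H\<close>) where "\<one>\<^sub>H \<equiv> \<one>\<^bsub>H\<^esub>"

lemma smash_mult_def: "X \<star> Y = tensor_lift k AH (\<lambda>a h. tensor_lift k AH (\<lambda>b g.
    H.sw AH (\<lambda>x y. (a \<cdot> act x b) \<sharp> (y \<otimes>\<^bsub>H\<^esub> g)) h) Y) X"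
  by (simp add: smash_product_def)

lemma smash_mult_bilinear: "bilinear_map k AH AH AH (mult R)"
  unfolding smash_mult_def[abs_def] by auto

lemma smash_mult_linear [intro!]:
  "\<lbrakk>f \<in> linear_maps k M AH; Y \<in> carrier AH\<rbrakk> \<Longrightarrow> (\<lambda>x. f x \<star> Y) \<in> linear_maps k M AH"
  "\<lbrakk>Y \<in> carrier AH; f \<in> linear_maps k M AH\<rbrakk> \<Longrightarrow> (\<lambda>x. Y \<star> f x) \<in> linear_maps k M AH"
  using linear_maps_comp[OF bilinear_mapD(2)[OF smash_mult_bilinear]]
    linear_maps_comp[OF bilinear_mapD(1)[OF smash_mult_bilinear]] by blast+

lemma smash_mult_closed [simp]: "\<lbrakk>X \<in> carrier AH; Y \<in> carrier AH\<rbrakk> \<Longrightarrow> X \<star> Y \<in> carrier AH"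
  by (rule bilinear_mapD(3)[OF smash_mult_bilinear])

lemma smash_mult_tensor:
  assumes "a \<in> carrier A" "b \<in> carrier A" "h \<in> carrier H" "g \<in> carrier H"
  shows "(a \<sharp> h) \<star> (b \<sharp> g) = H.sw AH (\<lambda>x y. (a \<cdot> act x b) \<sharp> (y \<otimes>\<^bsub>H\<^esub> g)) h"
proof -
  have "(a \<sharp> h) \<star> (b \<sharp> g) = tensor_lift k AH (\<lambda>b g.
      H.sw AH (\<lambda>x y. (a \<cdot> act x b) \<sharp> (y \<otimes>\<^bsub>H\<^esub> g)) h) (b \<sharp> g)"
    unfolding smash_mult_def by (rule AH.tensor_lift_tensor) (use assms in auto)
  also have "\<dots> = H.sw AH (\<lambda>x y. (a \<cdot> act x b) \<sharp> (y \<otimes>\<^bsub>H\<^esub> g)) h"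
    by (rule AH.tensor_lift_tensor) (use assms in auto)
  finally show ?thesis .
qed

text \<open>Both sides are brought to sums of \<open>?E\<close>: the left one by multiplicativity of
  \<open>\<Delta>\<close>, the right one by the action on a product followed by coassociativity. In
  between only independent sums over \<open>h\<close> and \<open>g\<close> change places.\<close>

lemma smash_assoc_tensor:
  assumes [simp]: "a \<in> carrier A" "b \<in> carrier A" "c \<in> carrier A"
    "h \<in> carrier H" "g \<in> carrier H" "l \<in> carrier H"
  shows "((a \<sharp> h) \<star> (b \<sharp> g)) \<star> (c \<sharp> l) = (a \<sharp> h) \<star> ((b \<sharp> g) \<star> (c \<sharp> l))"
proof -
  let ?E = "\<lambda>x p q u v. ((a \<cdot> act x b) \<cdot> act (p \<otimes>\<^bsub>H\<^esub> u) c) \<sharp> ((q \<otimes>\<^bsub>H\<^esub> v) \<otimes>\<^bsub>H\<^esub> l)"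
  have "((a \<sharp> h) \<star> (b \<sharp> g)) \<star> (c \<sharp> l) =
      H.sw AH (\<lambda>x y. (a \<cdot> act x b) \<sharp> (y \<otimes>\<^bsub>H\<^esub> g)) h \<star> (c \<sharp> l)"
    by (simp add: smash_mult_tensor)
  also have "\<dots> = H.sw AH (\<lambda>x y. ((a \<cdot> act x b) \<sharp> (y \<otimes>\<^bsub>H\<^esub> g)) \<star> (c \<sharp> l)) h"
    by (rule H.sw_hom) auto
  also have "\<dots> = H.sw AH (\<lambda>x y. H.sw AH (\<lambda>p q. H.sw AH (\<lambda>u v. ?E x p q u v) g) y) h"
  proof (rule H.sw_cong)
    fix x y assume [simp]: "x \<in> carrier H" "y \<in> carrier H"
    have "((a \<cdot> act x b) \<sharp> (y \<otimes>\<^bsub>H\<^esub> g)) \<star> (c \<sharp> l) =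
        H.sw AH (\<lambda>p q. ((a \<cdot> act x b) \<cdot> act p c) \<sharp> (q \<otimes>\<^bsub>H\<^esub> l)) (y \<otimes>\<^bsub>H\<^esub> g)"
      by (simp add: smash_mult_tensor)
    also have "\<dots> = H.sw AH (\<lambda>p q. H.sw AH (\<lambda>u v. ?E x p q u v) g) y"
      by (rule H.mult_lift) auto
    finally show "((a \<cdot> act x b) \<sharp> (y \<otimes>\<^bsub>H\<^esub> g)) \<star> (c \<sharp> l) =
        H.sw AH (\<lambda>p q. H.sw AH (\<lambda>u v. ?E x p q u v) g) y" .
  qed auto
  also have "\<dots> = H.sw AH (\<lambda>x y. H.sw AH (\<lambda>u v. H.sw AH (\<lambda>p q. ?E x p q u v) y) g) h"
    by (rule H.sw_cong; (rule H.sw_swap)?)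
      auto
  also have "\<dots> = H.sw AH (\<lambda>u v. H.sw AH (\<lambda>x y. H.sw AH (\<lambda>p q. ?E x p q u v) y) h) g"
    by (rule H.sw_swap) auto
  also have "\<dots> = H.sw AH (\<lambda>u v. (a \<sharp> h) \<star> ((b \<cdot> act u c) \<sharp> (v \<otimes>\<^bsub>H\<^esub> l))) g"
  proof (rule H.sw_cong)
    fix u v assume [simp]: "u \<in> carrier H" "v \<in> carrier H"
    have "H.sw AH (\<lambda>x y. H.sw AH (\<lambda>p q. ?E x p q u v) y) h =
        H.sw AH (\<lambda>w q. H.sw AH (\<lambda>x p. ?E x p q u v) w) h"
      by (rule H.coassoc_lift[symmetric]) auto
    also have "\<dots> = H.sw AH (\<lambda>w q. (a \<cdot> act w (b \<cdot> act u c)) \<sharp> (q \<otimes>\<^bsub>H\<^esub> (v \<otimes>\<^bsub>H\<^esub> l))) h"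
    proof (rule H.sw_cong)
      fix w q assume [simp]: "w \<in> carrier H" "q \<in> carrier H"
      have b: "bilinear_map k H H A (\<lambda>x y. act x b \<cdot> act y (act u c))"
        by auto
      have G: "(\<lambda>z. (a \<cdot> z) \<sharp> (q \<otimes>\<^bsub>H\<^esub> (v \<otimes>\<^bsub>H\<^esub> l))) \<in> linear_maps k A AH"
        by auto
      have "(a \<cdot> act w (b \<cdot> act u c)) \<sharp> (q \<otimes>\<^bsub>H\<^esub> (v \<otimes>\<^bsub>H\<^esub> l)) =
          H.sw AH (\<lambda>x p. (a \<cdot> (act x b \<cdot> act p (act u c))) \<sharp> (q \<otimes>\<^bsub>H\<^esub> (v \<otimes>\<^bsub>H\<^esub> l))) w"
        using H.sw_hom[OF _ _ b G, of w] by (simp add: act_on_mult)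
      also have "\<dots> = H.sw AH (\<lambda>x p. ?E x p q u v) w"
        by (rule H.sw_cong) (auto simp: act_mult A.m_assoc H.m_assoc)
      finally show "H.sw AH (\<lambda>x p. ?E x p q u v) w =
          (a \<cdot> act w (b \<cdot> act u c)) \<sharp> (q \<otimes>\<^bsub>H\<^esub> (v \<otimes>\<^bsub>H\<^esub> l))" by simp
    qed auto
    finally show "H.sw AH (\<lambda>x y. H.sw AH (\<lambda>p q. ?E x p q u v) y) h =
        (a \<sharp> h) \<star> ((b \<cdot> act u c) \<sharp> (v \<otimes>\<^bsub>H\<^esub> l))" by (simp add: smash_mult_tensor)
  qed auto
  also have "\<dots> = (a \<sharp> h) \<star> H.sw AH (\<lambda>u v. (b \<cdot> act u c) \<sharp> (v \<otimes>\<^bsub>H\<^esub> l)) g"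
    by (rule H.sw_hom[symmetric]) auto
  also have "\<dots> = (a \<sharp> h) \<star> ((b \<sharp> g) \<star> (c \<sharp> l))"
    by (simp add: smash_mult_tensor)
  finally show ?thesis .
qed

lemma smash_assoc:
  assumes "X \<in> carrier AH" "Y \<in> carrier AH" "Z \<in> carrier AH"
  shows "(X \<star> Y) \<star> Z = X \<star> (Y \<star> Z)"
proof (rule AH.linear_eqI[OF _ _ _ assms(1), where f = "\<lambda>X. (X \<star> Y) \<star> Z"])
  fix a h assume ah: "a \<in> carrier A" "h \<in> carrier H"
  show "((a \<sharp> h) \<star> Y) \<star> Z = (a \<sharp> h) \<star> (Y \<star> Z)"
  proof (rule AH.linear_eqI[OF _ _ _ assms(2), where f = "\<lambda>Y. ((a \<sharp> h) \<star> Y) \<star> Z"])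
    fix b g assume bg: "b \<in> carrier A" "g \<in> carrier H"
    show "((a \<sharp> h) \<star> (b \<sharp> g)) \<star> Z = (a \<sharp> h) \<star> ((b \<sharp> g) \<star> Z)"
      by (rule AH.linear_eqI[OF _ _ _ assms(3), where f = "\<lambda>Z. ((a \<sharp> h) \<star> (b \<sharp> g)) \<star> Z"])
        (use ah bg in \<open>auto simp: smash_assoc_tensor\<close>)
  qed (use ah assms in auto)
qed (use assms in auto)

lemma smash_one_mult_tensor:
  assumes "a \<in> carrier A" "b \<in> carrier A" "g \<in> carrier H"
  shows "(a \<sharp> \<one>\<^sub>H) \<star> (b \<sharp> g) = (a \<cdot> b) \<sharp> g"
proof -
  have "H.sw AH (\<lambda>x y. (a \<cdot> act x b) \<sharp> (y \<otimes>\<^bsub>H\<^esub> g)) \<one>\<^sub>H =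
      (a \<cdot> act \<one>\<^sub>H b) \<sharp> (\<one>\<^sub>H \<otimes>\<^bsub>H\<^esub> g)"
    by (rule H.one_lift) (use assms in auto)
  then show ?thesis using assms by (simp add: smash_mult_tensor act_one)
qed

lemma smash_tensor_one_mult:
  assumes "a \<in> carrier A" "h \<in> carrier H" "g \<in> carrier H"
  shows "(a \<sharp> h) \<star> (\<one>\<^sub>A \<sharp> g) = a \<sharp> (h \<otimes>\<^bsub>H\<^esub> g)"
proof -
  have l: "(\<lambda>y. a \<sharp> (y \<otimes>\<^bsub>H\<^esub> g)) \<in> linear_maps k H AH"
    using assms by auto
  have "(a \<sharp> h) \<star> (\<one>\<^sub>A \<sharp> g) = H.sw AH (\<lambda>x y. (a \<cdot> act x \<one>\<^sub>A) \<sharp> (y \<otimes>\<^bsub>H\<^esub> g)) h"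
    using assms by (simp add: smash_mult_tensor)
  also have "\<dots> = H.sw AH (\<lambda>x y. \<epsilon> x \<odot>\<^bsub>AH\<^esub> (a \<sharp> (y \<otimes>\<^bsub>H\<^esub> g))) h"
  proof (rule H.sw_cong)
    fix x y assume xy: "x \<in> carrier H" "y \<in> carrier H"
    have "(\<epsilon> x \<odot>\<^bsub>A\<^esub> a) \<sharp> (y \<otimes>\<^bsub>H\<^esub> g) = \<epsilon> x \<odot>\<^bsub>AH\<^esub> (a \<sharp> (y \<otimes>\<^bsub>H\<^esub> g))"
      using linear_mapsD(3)[OF bilinear_mapD(2)[OF AH.tensor_bilinear]] xy assms by simp
    then show "(a \<cdot> act x \<one>\<^sub>A) \<sharp> (y \<otimes>\<^bsub>H\<^esub> g) = \<epsilon> x \<odot>\<^bsub>AH\<^esub> (a \<sharp> (y \<otimes>\<^bsub>H\<^esub> g))"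
      using xy assms by (simp add: act_on_one A.smult_mult_right)
  qed (use assms in auto)
  also have "\<dots> = a \<sharp> (h \<otimes>\<^bsub>H\<^esub> g)"
    by (rule H.linear_counit_left[OF _ l]) (use assms in auto)
  finally show ?thesis .
qed

lemma smash_ring: "ring R"
proof (rule ringI)
  show "abelian_group R"
  proof (rule abelian_groupI)
    show "\<exists>Y\<in>carrier R. Y \<oplus>\<^bsub>R\<^esub> X = \<zero>\<^bsub>R\<^esub>" if "X \<in> carrier R" for X
      using that AH.T.M.l_neg[of X] AH.T.M.a_inv_closed[of X] by auto
  qed (auto simp: AH.T.M.a_ac AH.T.M.a_closed)
  show "monoid R"
  proof (rule monoidI)
    show "\<one>\<^bsub>R\<^esub> \<star> X = X" if "X \<in> carrier R" for X
      by (rule AH.linear_eqI[where g = "\<lambda>x. x"])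
        (use that in \<open>auto simp: smash_one_mult_tensor\<close>)
    show "X \<star> \<one>\<^bsub>R\<^esub> = X" if "X \<in> carrier R" for X
      by (rule AH.linear_eqI[where g = "\<lambda>x. x"])
        (use that in \<open>auto simp: smash_tensor_one_mult\<close>)
  qed (auto simp: smash_assoc)
qed (auto simp: linear_mapsD(2)[OF bilinear_mapD(1)[OF smash_mult_bilinear]]
    linear_mapsD(2)[OF bilinear_mapD(2)[OF smash_mult_bilinear]])

sublocale R: ring R by (rule smash_ring)

section \<open>The left module \<open>A\<close> over the smash product\<close>

definition smash_act :: "('a \<times> 'h \<Rightarrow> 'k) set \<Rightarrow> 'a \<Rightarrow> 'a" where
  "smash_act r c = tensor_lift k A (\<lambda>a h. a \<cdot> act h c) r"

lemma smash_act_bilinear: "bilinear_map k AH A A smash_act"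
  unfolding smash_act_def[abs_def] by auto

lemma smash_act_linear [intro!]:
  "\<lbrakk>f \<in> linear_maps k M AH; c \<in> carrier A\<rbrakk> \<Longrightarrow> (\<lambda>x. smash_act (f x) c) \<in> linear_maps k M A"
  "\<lbrakk>r \<in> carrier AH; g \<in> linear_maps k L A\<rbrakk> \<Longrightarrow> (\<lambda>x. smash_act r (g x)) \<in> linear_maps k L A"
  using linear_maps_comp[OF bilinear_mapD(2)[OF smash_act_bilinear]]
    linear_maps_comp[OF bilinear_mapD(1)[OF smash_act_bilinear]] by blast+

lemma smash_act_closed [simp]: "\<lbrakk>r \<in> carrier AH; c \<in> carrier A\<rbrakk> \<Longrightarrow> smash_act r c \<in> carrier A"
  by (rule bilinear_mapD(3)[OF smash_act_bilinear])

lemma smash_act_tensor: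
  "\<lbrakk>a \<in> carrier A; h \<in> carrier H; c \<in> carrier A\<rbrakk> \<Longrightarrow> smash_act (a \<sharp> h) c = a \<cdot> act h c"
  unfolding smash_act_def by (rule AH.tensor_lift_tensor) auto

lemma smash_act_mult:
  assumes "X \<in> carrier AH" "Y \<in> carrier AH" "c \<in> carrier A"
  shows "smash_act (X \<star> Y) c = smash_act X (smash_act Y c)"
proof (rule AH.linear_eqI[OF _ _ _ assms(1), where f = "\<lambda>X. smash_act (X \<star> Y) c"])
  fix a h assume ah: "a \<in> carrier A" "h \<in> carrier H"
  show "smash_act ((a \<sharp> h) \<star> Y) c = smash_act (a \<sharp> h) (smash_act Y c)"
  proof (rule AH.linear_eqI[OF _ _ _ assms(2), where f = "\<lambda>Y. smash_act ((a \<sharp> h) \<star> Y) c"])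
    fix b g assume bg: "b \<in> carrier A" "g \<in> carrier H"
    have b: "bilinear_map k H H A (\<lambda>x y. act x b \<cdot> act y (act g c))"
      using ah bg assms(3) by auto
    have bA: "bilinear_map k H H AH (\<lambda>x y. (a \<cdot> act x b) \<sharp> (y \<otimes>\<^bsub>H\<^esub> g))"
      using ah bg by auto
    have l: "(\<lambda>r. smash_act r c) \<in> linear_maps k AH A" using assms(3) by auto
    have lA: "(\<lambda>z. a \<cdot> z) \<in> linear_maps k A A" using ah by auto
    have "smash_act ((a \<sharp> h) \<star> (b \<sharp> g)) c =
        H.sw A (\<lambda>x y. smash_act ((a \<cdot> act x b) \<sharp> (y \<otimes>\<^bsub>H\<^esub> g)) c) h"
      using H.sw_hom[OF _ _ bA l, of h] ah bg by (simp add: smash_mult_tensor)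
    also have "\<dots> = H.sw A (\<lambda>x y. a \<cdot> (act x b \<cdot> act y (act g c))) h"
      by (rule H.sw_cong)
        (use ah bg assms(3) in \<open>auto simp: smash_act_tensor act_mult A.m_assoc\<close>)
    also have "\<dots> = smash_act (a \<sharp> h) (smash_act (b \<sharp> g) c)"
      using H.sw_hom[OF _ _ b lA, of h] ah bg assms(3)
      by (simp add: smash_act_tensor act_on_mult)
    finally show "smash_act ((a \<sharp> h) \<star> (b \<sharp> g)) c = smash_act (a \<sharp> h) (smash_act (b \<sharp> g) c)" .
  qed (use ah assms in auto)
qed (use assms in auto)

end

section \<open>Invariants and the trace\<close>

lemma (in abelian_monoid) finsum_in_additive_set:
  assumes "finite I" "N \<subseteq> carrier G" "\<zero> \<in> N" "\<And>x y. x \<in> N \<Longrightarrow> y \<in> N \<Longrightarrow> x \<oplus> y \<in> N" "\<And>i. i \<in> I \<Longrightarrow> f i \<in> N"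
  shows "(\<Oplus>i\<in>I. f i) \<in> N"
  using assms(1,5)
proof (induction I)
  case (insert i I)
  then have "f i \<in> carrier G" "f \<in> I \<rightarrow> carrier G" using assms(2) by auto
  then show ?case using insert assms(4) by simp
qed (simp add: assms(3))

context left_module_algebra
begin

abbreviation "B \<equiv> invariants H \<epsilon> A act"
abbreviation "\<iota> a \<equiv> a \<sharp> \<one>\<^sub>H"
abbreviation "\<eta> h \<equiv> \<one>\<^sub>A \<sharp> h"

lemma invariants_simps [simp]:
  "add B = add A" "zero B = zero A" "mult B = mult A" "one B = one A"
  by (simp_all add: invariants_def)

lemma invariantsI:
  "\<lbrakk>b \<in> carrier A; \<And>h. h \<in> carrier H \<Longrightarrow> act h b = \<epsilon> h \<odot>\<^bsub>A\<^esub> b\<rbrakk> \<Longrightarrow> b \<in> carrier B"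
  by (simp add: invariants_def)

lemma act_invariant: "\<lbrakk>b \<in> carrier B; h \<in> carrier H\<rbrakk> \<Longrightarrow> act h b = \<epsilon> h \<odot>\<^bsub>A\<^esub> b"
  by (simp add: invariants_def)

lemma invariants_closed [simp]: "b \<in> carrier B \<Longrightarrow> b \<in> carrier A"
  by (simp add: invariants_def)

lemma act_mult_invariant_right:
  assumes "b \<in> carrier B" "x \<in> carrier A" "h \<in> carrier H"
  shows "act h (x \<cdot> b) = act h x \<cdot> b"
proof -
  have b: "b \<in> carrier A" "\<And>h. h \<in> carrier H \<Longrightarrow> act h b = \<epsilon> h \<odot>\<^bsub>A\<^esub> b"
    using assms(1) by (auto simp: act_invariant)
  have G: "(\<lambda>p. act p x \<cdot> b) \<in> linear_maps k H A"
    using assms b by auto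
  have "act h (x \<cdot> b) = H.sw A (\<lambda>p q. act p x \<cdot> act q b) h"
    using assms b by (simp add: act_on_mult)
  also have "\<dots> = H.sw A (\<lambda>p q. \<epsilon> q \<odot>\<^bsub>A\<^esub> (act p x \<cdot> b)) h"
    by (rule H.sw_cong) (use assms b in \<open>auto simp: A.smult_mult_right\<close>)
  also have "\<dots> = act h x \<cdot> b"
    by (rule H.linear_counit_right[OF _ G]) (use assms in auto)
  finally show ?thesis .
qed

lemma invariants_ring: "ring B"
proof -
  let ?N = "carrier B"
  have lin: "(\<lambda>x. act h x) \<in> linear_maps k A A" if "h \<in> carrier H" for h
    using that by auto
  have "subring ?N A"
  proof (rule A.subringI)
    show "?N \<subseteq> carrier A" by auto
    show "\<one>\<^sub>A \<in> ?N" by (rule invariantsI) (auto simp: act_on_one)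
    show "\<ominus>\<^bsub>A\<^esub> x \<in> ?N" if x: "x \<in> ?N" for x
    proof -
      have "act h (\<ominus>\<^bsub>A\<^esub> x) = \<epsilon> h \<odot>\<^bsub>A\<^esub> (\<ominus>\<^bsub>A\<^esub> x)" if h: "h \<in> carrier H" for h
      proof -
        have "act h (\<zero>\<^bsub>A\<^esub> \<ominus>\<^bsub>A\<^esub> x) = \<zero>\<^bsub>A\<^esub> \<ominus>\<^bsub>A\<^esub> act h x"
          using linear_maps_minus[OF _ _ lin[OF h], of "\<zero>\<^bsub>A\<^esub>" x] linear_maps_zero[OF _ _ lin[OF h]] x
          by simp
        then show ?thesis using x h by (simp add: act_invariant a_minus_def A.smult_r_minus)
      qed
      then show ?thesis using x by (intro invariantsI) auto
    qed
    show "x \<cdot> y \<in> ?N" if "x \<in> ?N" "y \<in> ?N" for x y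
      by (rule invariantsI) (use that in \<open>auto simp: act_mult_invariant_right act_invariant A.smult_mult_left\<close>)
    show "x \<oplus>\<^bsub>A\<^esub> y \<in> ?N" if "x \<in> ?N" "y \<in> ?N" for x y
      by (rule invariantsI) (use that in \<open>auto simp: act_invariant act_add_right A.smult_r_distr\<close>)
  qed
  then have "ring (A\<lparr>carrier := ?N\<rparr>)" by (rule A.subring_is_ring)
  moreover have "A\<lparr>carrier := ?N\<rparr> = B" unfolding invariants_def by simp
  ultimately show ?thesis by simp
qed

sublocale B: ring B by (rule invariants_ring)

sublocale BA: ring_hom_ring B A id
  by (rule ring_hom_ringI) (auto simp: B.ring_axioms A.ring_axioms)

sublocale AR: ring_hom_ring A R \<iota>
  by (rule ring_hom_ringI)
    (auto simp: A.ring_axioms R.ring_axioms smash_one_mult_tensor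
      linear_mapsD(2)[OF bilinear_mapD(2)[OF AH.tensor_bilinear]])

abbreviation "integrals \<equiv> left_integrals H \<epsilon>"

lemma mult_integral: "\<lbrakk>t \<in> integrals; h \<in> carrier H\<rbrakk> \<Longrightarrow> h \<otimes>\<^bsub>H\<^esub> t = \<epsilon> h \<odot>\<^bsub>H\<^esub> t"
  by (simp add: left_integrals_def)

lemma integrals_closed [simp]: "t \<in> integrals \<Longrightarrow> t \<in> carrier H"
  by (simp add: left_integrals_def)

lemma integral_act_invariant:
  assumes "t \<in> integrals" "x \<in> carrier A"
  shows "act t x \<in> carrier B"
  by (rule invariantsI) (use assms in \<open>auto simp: mult_integral act_smult_left simp flip: act_mult\<close>)

text \<open>Right multiplication by an invariant commutes with the module structure, so
  \<open>r\<close> acts on \<open>b\<close> through its value at the unit.\<close>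

lemma smash_act_invariant:
  assumes "r \<in> carrier AH" "b \<in> carrier B"
  shows "smash_act r b = smash_act r \<one>\<^sub>A \<cdot> b"
proof (rule AH.linear_eqI[OF _ _ _ assms(1), where f = "\<lambda>r. smash_act r b"])
  fix a h assume ah: "a \<in> carrier A" "h \<in> carrier H"
  have "act h b = \<epsilon> h \<odot>\<^bsub>A\<^esub> b" using assms ah by (simp add: act_invariant)
  then show "smash_act (a \<sharp> h) b = smash_act (a \<sharp> h) \<one>\<^sub>A \<cdot> b"
    using ah assms by (simp add: smash_act_tensor act_on_one A.smult_mult_right A.smult_mult_left)
qed (use assms in auto)

text \<open>Before an integral, \<open>h\<close> acts by the scalar \<open>\<epsilon> h\<close>,
  exactly as it does on the unit of \<open>A\<close>. Only the value of \<open>r\<close> at the unit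
  survives.\<close>

lemma smash_mult_integral:
  assumes "r \<in> carrier AH" "t \<in> integrals"
  shows "r \<star> \<eta> t = smash_act r \<one>\<^sub>A \<sharp> t"
proof (rule AH.linear_eqI[OF _ _ _ assms(1), where f = "\<lambda>r. r \<star> \<eta> t"])
  fix a h assume ah: "a \<in> carrier A" "h \<in> carrier H"
  have "h \<otimes>\<^bsub>H\<^esub> t = \<epsilon> h \<odot>\<^bsub>H\<^esub> t" using ah assms by (simp add: mult_integral)
  then show "(a \<sharp> h) \<star> \<eta> t = smash_act (a \<sharp> h) \<one>\<^sub>A \<sharp> t"
    using ah assms linear_mapsD(3)[OF bilinear_mapD(1)[OF AH.tensor_bilinear]]
      linear_mapsD(3)[OF bilinear_mapD(2)[OF AH.tensor_bilinear]]
    by (simp add: smash_tensor_one_mult smash_act_tensor act_on_one A.smult_mult_right)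
qed (use assms in auto)

text \<open>A coefficient \<open>r\<close> from \<open>A # H\<close> standing between two integrals
  is replaced by an invariant. The tail \<open>w\<close> is kept so that the rule applies to the
  generators \<open>\<eta> t' \<star> \<iota> x\<close>.\<close>

lemma integral_smash_mult_integral:
  assumes "t \<in> integrals" "t' \<in> integrals" "r \<in> carrier AH" "w \<in> carrier AH"
  shows "\<eta> t \<star> (r \<star> (\<eta> t' \<star> w)) =
    \<iota> (act t (smash_act r \<one>\<^sub>A)) \<star> (\<eta> t' \<star> w)"
proof -
  let ?c = "act t (smash_act r \<one>\<^sub>A)"
  have c: "?c \<in> carrier A" using assms by simp
  have "\<eta> t \<star> (r \<star> \<eta> t') = (\<eta> t \<star> r) \<star> \<eta> t'"
    using assms by (simp add: smash_assoc)
  also have "\<dots> = smash_act (\<eta> t \<star> r) \<one>\<^sub>A \<sharp> t'"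
    using assms by (intro smash_mult_integral) auto
  also have "\<dots> = ?c \<sharp> t'"
    using assms by (simp add: smash_act_mult smash_act_tensor)
  also have "\<dots> = \<iota> ?c \<star> \<eta> t'"
    using assms c by (simp add: smash_one_mult_tensor)
  finally have "(\<eta> t \<star> (r \<star> \<eta> t')) \<star> w = (\<iota> ?c \<star> \<eta> t') \<star> w" by simp
  then show ?thesis using assms c by (simp add: smash_assoc)
qed

end

section \<open>Descent to the invariants by means of the trace\<close>

locale trace_one_module_algebra = left_module_algebra k H \<Delta> \<epsilon> S A act
  for k :: "('k, 'l) ring_scheme" and H :: "('k, 'h, 'm) module_scheme" and \<Delta> \<epsilon> S
    and A :: "('k, 'a, 'n) module_scheme" and act +
  fixes n :: nat and a :: "nat \<Rightarrow> 'a" and t :: "nat \<Rightarrow> 'h"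
  assumes a_closed [simp]: "i < n \<Longrightarrow> a i \<in> carrier A" and t_integral [simp]: "i < n \<Longrightarrow> t i \<in> integrals"
    and trace_one: "(\<Oplus>\<^bsub>A\<^esub>i\<in>{..<n}. act (t i) (a i)) = \<one>\<^bsub>A\<^esub>"
begin

text \<open>The retraction of \<open>A\<close> onto \<open>A\<^sup>H\<close>, linear for right
  multiplication by invariants. It fixes invariants because it sends the unit to the given sum of
  trace one.\<close>

definition \<tau> :: "'a \<Rightarrow> 'a" where
  "\<tau> z = (\<Oplus>\<^bsub>A\<^esub>i\<in>{..<n}. act (t i) (a i \<cdot> z))"

lemma trace_linear: "\<tau> \<in> linear_maps k A A"
  unfolding \<tau>_def by (rule linear_maps_sum) auto

lemma finsum_in_invariants:
  assumes N: "hom_submodule B B id N" and "\<And>i. i < n \<Longrightarrow> f i \<in> N"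
  shows "(\<Oplus>\<^bsub>A\<^esub>i\<in>{..<n}. f i) \<in> N"
  using hom_submoduleD[OF N] assms(2) by (intro A.finsum_in_additive_set) auto

lemma trace_closed: "z \<in> carrier A \<Longrightarrow> \<tau> z \<in> carrier B"
  unfolding \<tau>_def
  by (intro finsum_in_invariants ring_hom_ring.hom_submodule_carrier B.id_ring_hom_ring integral_act_invariant) auto

lemma trace_mult_invariant:
  assumes "z \<in> carrier A" "b \<in> carrier B"
  shows "\<tau> (z \<cdot> b) = \<tau> z \<cdot> b"
proof -
  have "\<tau> z \<cdot> b = (\<Oplus>\<^bsub>A\<^esub>i\<in>{..<n}. act (t i) (a i \<cdot> z) \<cdot> b)"
    unfolding \<tau>_def using assms by (intro A.finsum_ldistr) auto
  also have "\<dots> = \<tau> (z \<cdot> b)"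
    unfolding \<tau>_def using assms
    by (intro A.finsum_cong') (auto simp: act_mult_invariant_right A.m_assoc simp flip: act_mult_invariant_right)
  finally show ?thesis by simp
qed

lemma trace_invariant:
  assumes "b \<in> carrier B" shows "\<tau> b = b"
proof -
  have "\<tau> \<one>\<^sub>A = (\<Oplus>\<^bsub>A\<^esub>i\<in>{..<n}. act (t i) (a i))"
    unfolding \<tau>_def by (intro A.finsum_cong') auto
  then have "\<tau> \<one>\<^sub>A = \<one>\<^sub>A" using trace_one by simp
  then show ?thesis using trace_mult_invariant[of "\<one>\<^sub>A" b] assms by simp
qed

text \<open>A left ideal \<open>X\<close> of \<open>A\<^sup>H\<close> is recovered from the left
  ideal it generates in \<open>A\<close>: \<open>\<tau>\<close> sends \<open>c \<cdot> f\<close> to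
  \<open>\<tau> c \<cdot> f\<close> for invariant \<open>f\<close>, so generators over
  \<open>A\<close> chosen inside \<open>X\<close> still generate \<open>X\<close> over
  \<open>A\<^sup>H\<close>.\<close>

lemma invariants_noetherian:
  assumes "hom_noetherian A A id"
  shows "hom_noetherian B B id"
  unfolding hom_noetherian_def
proof (intro allI impI)
  fix X assume X: "hom_submodule B B id X"
  note DX = hom_submoduleD[OF X]
  interpret AA: ring_hom_ring A A id by (rule A.id_ring_hom_ring)
  have XA: "X \<subseteq> carrier A" using DX(1) by auto
  obtain F where F: "F \<subseteq> X" "finite F" "hom_generates A A id F (hom_span A A id X)"
    using AA.hom_noetherian_finite_subset[OF assms XA AA.hom_span_properties(3)[OF XA]] by blast
  note D\<tau> = linear_mapsD[OF trace_linear]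
  have "hom_generates B B id F X"
    unfolding hom_generates_def
  proof (intro allI impI subsetI, elim conjE)
    fix X' x assume X': "hom_submodule B B id X'" and FX: "F \<subseteq> X'" and x: "x \<in> X"
    note DX' = hom_submoduleD[OF X', simplified]
    \<comment> \<open>The multiplier \<open>c\<close> makes this set a left ideal of
      \<open>A\<close>, although \<open>\<tau>\<close> is not left linear over
      \<open>A\<close>.\<close>
    let ?D = "{z \<in> carrier A. \<forall>c\<in>carrier A. \<tau> (c \<cdot> z) \<in> X'}"
    have "hom_submodule A A id ?D"
    proof (rule hom_submoduleI)
      show "\<zero>\<^bsub>A\<^esub> \<in> ?D" using DX'(2) linear_maps_zero[OF _ _ trace_linear] by simp
      show "y \<oplus>\<^bsub>A\<^esub> z \<in> ?D" if "y \<in> ?D" "z \<in> ?D" for y z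
        using that DX'(3) by (simp add: A.r_distr D\<tau>)
      show "id b \<cdot> z \<in> ?D" if "b \<in> carrier A" "z \<in> ?D" for b z
        using that by (simp flip: A.m_assoc)
    qed auto
    moreover have "F \<subseteq> ?D"
    proof
      fix f assume f: "f \<in> F"
      then have fB: "f \<in> carrier B" using F(1) DX(1) by blast
      then have "\<tau> (c \<cdot> f) \<in> X'" if "c \<in> carrier A" for c
        using that DX'(4)[OF trace_closed[OF that], of f] f FX by (auto simp: trace_mult_invariant)
      then show "f \<in> ?D" using fB by simp
    qed
    ultimately have "hom_span A A id X \<subseteq> ?D" using F(3) unfolding hom_generates_def by blast
    then have "x \<in> ?D" using x AA.hom_span_properties(2)[OF XA] by blast
    then have "\<tau> (\<one>\<^sub>A \<cdot> x) \<in> X'" by blast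
    then show "x \<in> X'" using x DX(5)[OF x] by (simp add: trace_invariant)
  qed
  then show "\<exists>F\<subseteq>X. finite F \<and> hom_generates B B id F X" using F by blast
qed

text \<open>The left ideal \<open>X\<close> is encoded by a left ideal \<open>Y\<close> of
  \<open>A # H\<close>. The finite set found there is turned into invariants by the integrals
  \<open>t i\<close>, and the condition on \<open>X\<close> is read back through the trace.\<close>

lemma gabriel_condition_invariants:
  assumes "gabriel_condition R"
  shows "gabriel_condition B"
  unfolding gabriel_condition_def
proof (intro allI impI)
  fix X assume X: "hom_submodule B B id X"
  note DX = hom_submoduleD[OF X, simplified]
  \<comment> \<open>The largest \<open>A # H\<close>-submodule of \<open>A\<close> that every
    integral sends into \<open>X\<close>. It contains \<open>X\<close>, and its intersection with
    \<open>A\<^sup>H\<close> is exactly \<open>X\<close>.\<close>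
  define Z where "Z = {z \<in> carrier A. \<forall>r\<in>carrier AH. \<forall>s\<in>integrals. act s (smash_act r z) \<in> X}"
  note sr = linear_mapsD[OF bilinear_mapD(1)[OF smash_act_bilinear]]
    and sl = linear_mapsD[OF bilinear_mapD(2)[OF smash_act_bilinear]]
  have XZ: "x \<in> Z" if x: "x \<in> X" for x
  proof -
    have xB: "x \<in> carrier B" by (rule DX(5)[OF x])
    have "act s (smash_act r x) \<in> X" if "r \<in> carrier AH" "s \<in> integrals" for r s
    proof -
      have "act s (smash_act r x) = act s (smash_act r \<one>\<^sub>A) \<cdot> x"
        using that xB by (simp add: smash_act_invariant[OF that(1) xB] act_mult_invariant_right)
      then show ?thesis
        using DX(4)[OF integral_act_invariant[OF that(2)] x] that(1) by simp
    qed
    then show ?thesis using xB by (simp add: Z_def)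
  qed
  have ZX: "z \<in> X" if z: "z \<in> Z" "z \<in> carrier B" for z
  proof -
    have "act (t i) (a i \<cdot> z) \<in> X" if i: "i < n" for i
    proof -
      have "act (t i) (smash_act (\<iota> (a i)) z) \<in> X"
        using z(1) i unfolding Z_def by simp
      then show ?thesis using i z by (simp add: smash_act_tensor act_one)
    qed
    then have "\<tau> z \<in> X" unfolding \<tau>_def by (intro finsum_in_invariants[OF X])
    then show ?thesis using z by (simp add: trace_invariant)
  qed
  \<comment> \<open>The preimage of \<open>Z\<close> under evaluation at the unit, which makes
    \<open>(A # H) / Y\<close> a copy of \<open>A / Z\<close>.\<close>
  define Y where "Y = {s \<in> carrier AH. smash_act s \<one>\<^sub>A \<in> Z}"
  have "hom_submodule R R id Y"
  proof (rule hom_submoduleI)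
    show "\<zero>\<^bsub>R\<^esub> \<in> Y"
      using XZ[OF DX(2)] linear_maps_zero[OF _ _ bilinear_mapD(2)[OF smash_act_bilinear]]
      by (simp add: Y_def)
    show "x \<oplus>\<^bsub>R\<^esub> y \<in> Y" if "x \<in> Y" "y \<in> Y" for x y
      using that DX(3) by (simp add: Y_def Z_def sl sr act_add_right AH.T.M.a_closed)
    show "id b \<star> x \<in> Y" if "b \<in> carrier R" "x \<in> Y" for b x
    proof -
      have bx: "b \<in> carrier AH" "x \<in> carrier AH" using that by (auto simp: Y_def)
      have "act s (smash_act r (smash_act (b \<star> x) \<one>\<^sub>A)) \<in> X"
        if rs: "r \<in> carrier AH" "s \<in> integrals" for r s
      proof -
        have "smash_act r (smash_act (b \<star> x) \<one>\<^sub>A) = smash_act (r \<star> b) (smash_act x \<one>\<^sub>A)"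
          using rs bx by (simp add: smash_act_mult)
        moreover have "act s (smash_act (r \<star> b) (smash_act x \<one>\<^sub>A)) \<in> X"
          using \<open>x \<in> Y\<close> rs bx by (simp add: Y_def Z_def)
        ultimately show ?thesis by simp
      qed
      then show ?thesis using bx by (simp add: Y_def Z_def)
    qed
  qed (auto simp: Y_def)
  from assms[unfolded gabriel_condition_def, rule_format, OF this]
  obtain F where F: "F \<subseteq> carrier AH" "finite F"
    and FY: "\<And>s r. s \<in> carrier AH \<Longrightarrow> (\<And>f. f \<in> F \<Longrightarrow> s \<star> f \<in> Y) \<Longrightarrow> r \<in> carrier AH \<Longrightarrow> s \<star> r \<in> Y"
    unfolding smash_simps by metis
  \<comment> \<open>These are the values at the unit of \<open>t i\<close> times \<open>a i\<close>
    times \<open>f\<close>, hence invariants.\<close>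
  define G where "G = (\<lambda>(i, f). act (t i) (a i \<cdot> smash_act f \<one>\<^sub>A)) ` ({..<n} \<times> F)"
  have "finite G" unfolding G_def using F(2) by simp
  moreover have "G \<subseteq> carrier B" unfolding G_def using F(1) by (auto intro!: integral_act_invariant)
  moreover have "b \<otimes>\<^bsub>B\<^esub> c \<in> X" if b: "b \<in> carrier B" and bG: "\<forall>g\<in>G. b \<otimes>\<^bsub>B\<^esub> g \<in> X" and c: "c \<in> carrier B" for b c
  proof -
    have "b \<cdot> act (t i) (a i \<cdot> c) \<in> X" if i: "i < n" for i
    proof -
      \<comment> \<open>The element \<open>b (t i) (a i)\<close> of \<open>A # H\<close> is the test
        element: its products with \<open>F\<close> evaluate to \<open>b \<cdot> g\<close> with
        \<open>g \<in> G\<close>, and its product with \<open>c\<close> evaluates to the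
        \<open>i\<close>-th summand of \<open>b \<cdot> \<tau> c\<close>.\<close>
      let ?s = "(\<iota> b \<star> (\<one>\<^sub>A \<sharp> t i)) \<star> \<iota> (a i)"
      have s: "?s \<in> carrier AH" using i b by simp
      have sc: "smash_act ?s z = b \<cdot> act (t i) (a i \<cdot> z)" if "z \<in> carrier A" for z
        using that i b by (simp add: smash_act_mult smash_act_tensor act_one)
      have "?s \<star> f \<in> Y" if f: "f \<in> F" for f
      proof -
        have fA: "f \<in> carrier AH" using F(1) f by blast
        have "act (t i) (a i \<cdot> smash_act f \<one>\<^sub>A) \<in> G" using i f unfolding G_def by force
        then have "smash_act (?s \<star> f) \<one>\<^sub>A \<in> X"
          using bG s fA by (simp add: smash_act_mult[OF s] sc)
        then show ?thesis using XZ s fA by (simp add: Y_def)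
      qed
      then have "?s \<star> \<iota> c \<in> Y" using FY[OF s] c by simp
      then have "smash_act (?s \<star> \<iota> c) \<one>\<^sub>A \<in> Z" by (simp add: Y_def)
      then have "b \<cdot> act (t i) (a i \<cdot> c) \<in> Z"
        using s c by (simp add: smash_act_mult[OF s] sc smash_act_tensor act_one)
      moreover have "b \<cdot> act (t i) (a i \<cdot> c) \<in> carrier B"
        using B.m_closed[OF b integral_act_invariant[OF t_integral[OF i]], of "a i \<cdot> c"] i c by simp
      ultimately show ?thesis by (rule ZX)
    qed
    then have "(\<Oplus>\<^bsub>A\<^esub>i\<in>{..<n}. b \<cdot> act (t i) (a i \<cdot> c)) \<in> X" by (intro finsum_in_invariants[OF X])
    moreover have "(\<Oplus>\<^bsub>A\<^esub>i\<in>{..<n}. b \<cdot> act (t i) (a i \<cdot> c)) = b \<cdot> \<tau> c"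
      unfolding \<tau>_def using b c by (intro A.finsum_rdistr[symmetric]) auto
    ultimately show ?thesis using c by (simp add: trace_invariant)
  qed
  ultimately show "\<exists>F\<subseteq>carrier B. finite F \<and>
      (\<forall>s\<in>carrier B. (\<forall>f\<in>F. s \<otimes>\<^bsub>B\<^esub> f \<in> X) \<longrightarrow> (\<forall>t\<in>carrier B. s \<otimes>\<^bsub>B\<^esub> t \<in> X))"
    by blast
qed

end

section \<open>Finite generation of the three extensions\<close>

locale trace_one_finite_module_algebra =
  trace_one_module_algebra k H \<Delta> \<epsilon> S A act n a t + D: hopf_algebra_dual_basis k H \<Delta> \<epsilon> S I e \<phi>
  for k :: "('k, 'l) ring_scheme" and H :: "('k, 'h, 'm) module_scheme" and \<Delta> \<epsilon> S
    and A :: "('k, 'a, 'n) module_scheme" and act n a t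
    and I :: "'i set" and e and \<phi>
begin

text \<open>The scalars \<open>\<phi> i h\<close> in the dual basis expansion of \<open>h\<close>
  pass to the left factor, where they become coefficients from \<open>A\<close>.\<close>

lemma smash_noetherian:
  assumes "hom_noetherian A A id"
  shows "hom_noetherian A R \<iota>"
proof (rule AR.hom_noetherian_of_finite[OF assms])
  let ?G = "(\<lambda>i. \<one>\<^sub>A \<sharp> e i) ` I"
  show "finite ?G" using D.finite_I by simp
  show "?G \<subseteq> carrier R" by auto
  show "hom_generates A R \<iota> ?G (carrier R)"
    unfolding hom_generates_def
  proof (intro allI impI subsetI, elim conjE)
    fix N X assume N: "hom_submodule A R \<iota> N" and G: "?G \<subseteq> N" and X: "X \<in> carrier R"
    note DN = hom_submoduleD[OF N, simplified]
    from X have "X \<in> carrier AH" by simp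
    then show "X \<in> N"
    proof (induction X rule: AH.tensor_induct)
      case (tensor c h)
      have "c \<sharp> h = (\<Oplus>\<^bsub>AH\<^esub>i\<in>I. \<phi> i h \<odot>\<^bsub>AH\<^esub> (c \<sharp> e i))"
        by (rule D.linear_dual_basis[OF _ bilinear_mapD(1)[OF AH.tensor_bilinear]]) (use tensor in auto)
      also have "\<dots> \<in> N"
      proof (rule AH.T.M.finsum_in_additive_set[OF D.finite_I])
        fix i assume i: "i \<in> I"
        have "\<phi> i h \<odot>\<^bsub>AH\<^esub> (c \<sharp> e i) = (\<phi> i h \<odot>\<^bsub>A\<^esub> c) \<sharp> e i"
          using linear_mapsD(3)[OF bilinear_mapD(2)[OF AH.tensor_bilinear]] tensor i by simp
        also have "\<dots> = \<iota> (\<phi> i h \<odot>\<^bsub>A\<^esub> c) \<star> (\<one>\<^sub>A \<sharp> e i)"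
          using tensor i by (simp add: smash_one_mult_tensor)
        also have "\<dots> \<in> N" by (rule DN(4)) (use tensor i G in auto)
        finally show "\<phi> i h \<odot>\<^bsub>AH\<^esub> (c \<sharp> e i) \<in> N" .
      qed (use DN in auto)
      finally show ?case .
    next
      case (add X Y) then show ?case using DN(3) by simp
    qed
  qed
qed

text \<open>Coordinates of \<open>A # H\<close>, left linear over \<open>A\<close>. The antipode is
  built in to match the functionals in \<open>integrals_generate_one\<close>.\<close>

definition \<psi> :: "'i \<Rightarrow> ('a \<times> 'h \<Rightarrow> 'k) set \<Rightarrow> 'a" where
  "\<psi> i = tensor_lift k A (\<lambda>c h. \<phi> i (S h) \<odot>\<^bsub>A\<^esub> c)"

lemma \<psi>_bilinear: "i \<in> I \<Longrightarrow> bilinear_map k A H A (\<lambda>c h. \<phi> i (S h) \<odot>\<^bsub>A\<^esub> c)"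
  by auto

lemma \<psi>_linear: "i \<in> I \<Longrightarrow> \<psi> i \<in> linear_maps k AH A"
  unfolding \<psi>_def by (rule AH.tensor_lift_linear[OF _ \<psi>_bilinear]) auto

lemma \<psi>_tensor: "\<lbrakk>i \<in> I; c \<in> carrier A; h \<in> carrier H\<rbrakk> \<Longrightarrow> \<psi> i (c \<sharp> h) = \<phi> i (S h) \<odot>\<^bsub>A\<^esub> c"
  unfolding \<psi>_def by (rule AH.tensor_lift_tensor[OF _ \<psi>_bilinear]) auto

lemma \<psi>_mult:
  assumes "i \<in> I" "b \<in> carrier A" "r \<in> carrier AH"
  shows "\<psi> i (\<iota> b \<star> r) = b \<cdot> \<psi> i r"
  by (rule AH.linear_eqI[OF _ _ _ assms(3), where f = "\<lambda>r. \<psi> i (\<iota> b \<star> r)"])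
    (use assms in \<open>auto intro!: linear_maps_comp[OF \<psi>_linear] \<psi>_linear
      simp: smash_one_mult_tensor \<psi>_tensor A.smult_mult_right\<close>)

text \<open>In \<open>A # H\<close> the product of an integral \<open>t\<close> with
  \<open>y\<close> is the sum of \<open>(t\<^sub>1 \<cdot> y) # t\<^sub>2\<close>, so
  \<open>\<psi> i\<close> turns it into \<open>(\<phi> i (S t\<^sub>2) t\<^sub>1) \<cdot> y\<close>.
  Summed over the chosen integrals, the acting element is the unit.\<close>

lemma sum_\<psi>_integral:
  assumes y: "y \<in> carrier A"
  shows "(\<Oplus>\<^bsub>A\<^esub>i\<in>I. \<psi> i ((\<one>\<^sub>A \<sharp> D.integral (e i)) \<star> \<iota> y)) = y"
proof -
  have [simp]: "D.integral (e i) \<in> carrier H" if "i \<in> I" for i using that by (simp add: D.integral_closed)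
  have act_y: "(\<lambda>h. act h y) \<in> linear_maps k H A" using y by auto
  have b: "bilinear_map k H H H (\<lambda>p q. \<phi> i (S q) \<odot>\<^bsub>H\<^esub> p)" if "i \<in> I" for i
    using that by auto
  have c: "D.hit (\<lambda>q. \<phi> i (S q)) h \<in> carrier H" if "i \<in> I" "h \<in> carrier H" for i h
    using b[OF that(1)] that(2) by (intro H.HH.tensor_lift_closed) auto
  have "\<psi> i (\<eta> h \<star> \<iota> y) = act (D.hit (\<lambda>q. \<phi> i (S q)) h) y"
    if i: "i \<in> I" and h: "h \<in> carrier H" for i h
  proof -
    have bA: "bilinear_map k H H AH (\<lambda>p q. (\<one>\<^sub>A \<cdot> act p y) \<sharp> (q \<otimes>\<^bsub>H\<^esub> \<one>\<^sub>H))"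
      using y by auto
    have "\<psi> i (\<eta> h \<star> \<iota> y) =
        H.sw A (\<lambda>p q. \<psi> i ((\<one>\<^sub>A \<cdot> act p y) \<sharp> (q \<otimes>\<^bsub>H\<^esub> \<one>\<^sub>H))) h"
      using H.sw_hom[OF _ _ bA \<psi>_linear[OF i], of h] h y by (simp add: smash_mult_tensor)
    also have "\<dots> = H.sw A (\<lambda>p q. act (\<phi> i (S q) \<odot>\<^bsub>H\<^esub> p) y) h"
      by (rule H.sw_cong[OF _ bilinear_map_comp[OF bA \<psi>_linear[OF i]]])
        (use i h y in \<open>auto simp: \<psi>_tensor act_smult_left\<close>)
    also have "\<dots> = act (D.hit (\<lambda>q. \<phi> i (S q)) h) y"
      by (rule H.sw_hom[OF _ _ b[OF i] act_y, symmetric]) (use h in auto)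
    finally show ?thesis .
  qed
  then have "(\<Oplus>\<^bsub>A\<^esub>i\<in>I. \<psi> i ((\<one>\<^sub>A \<sharp> D.integral (e i)) \<star> \<iota> y)) =
      (\<Oplus>\<^bsub>A\<^esub>i\<in>I. act (D.hit (\<lambda>q. \<phi> i (S q)) (D.integral (e i))) y)"
    using y c by (intro A.finsum_cong') auto
  also have "\<dots> = act (\<Oplus>\<^bsub>H\<^esub>i\<in>I. D.hit (\<lambda>q. \<phi> i (S q)) (D.integral (e i))) y"
    by (rule linear_maps_finsum[OF _ _ act_y, symmetric]) (use c in auto)
  also have "\<dots> = y" by (simp add: D.integrals_generate_one act_one y)
  finally show ?thesis .
qed

text \<open>Left noetherianness of \<open>A # H\<close> gives finitely many generators
  \<open>G\<close>, but with coefficients in \<open>A # H\<close>. A further integral on the left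
  makes these coefficients invariants, and the trace one condition removes that integral again. The
  coordinates \<open>\<psi> i\<close> then bring everything into \<open>A\<close>.\<close>

lemma noetherian_over_invariants:
  assumes "hom_noetherian A A id"
  shows "hom_noetherian B A id"
proof -
  interpret RR: ring_hom_ring R R id by (rule R.id_ring_hom_ring)
  have noethR: "hom_noetherian R R id"
    by (rule AR.hom_noetherian_imp_left_noetherian[OF smash_noetherian[OF assms]])
  let ?Z = "{\<eta> s \<star> \<iota> x | s x. s \<in> integrals \<and> x \<in> carrier A}"
  have Z: "?Z \<subseteq> carrier R" by auto
  obtain G where G: "G \<subseteq> ?Z" "finite G" "hom_generates R R id G (hom_span R R id ?Z)"
    using RR.hom_noetherian_finite_subset[OF noethR Z RR.hom_span_properties(3)[OF Z]] by blast
  let ?F = "(\<lambda>(i, g). \<psi> i g) ` (I \<times> G)"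
  note D\<psi> = linear_mapsD[OF \<psi>_linear]
  have GA: "g \<in> carrier AH" if "g \<in> G" for g using that G(1) by auto
  show ?thesis
  proof (rule BA.hom_noetherian_of_finite[OF invariants_noetherian[OF assms]])
    show "finite ?F" using D.finite_I G(2) by simp
    show "?F \<subseteq> carrier A" using GA D\<psi>(1) by auto
    show "hom_generates B A id ?F (carrier A)"
      unfolding hom_generates_def
    proof (intro allI impI subsetI, elim conjE)
      fix N y assume N: "hom_submodule B A id N" and FN: "?F \<subseteq> N" and y: "y \<in> carrier A"
      note DN = hom_submoduleD[OF N, simplified]
      \<comment> \<open>Quantifying over \<open>r\<close> makes this a left ideal of
        \<open>A # H\<close>, and the integral \<open>s\<close> in front makes it contain
        \<open>G\<close>, where the coefficient of \<open>\<psi> i g\<close> becomes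
        invariant.\<close>
      let ?K = "{z \<in> carrier AH. \<forall>r\<in>carrier AH. \<forall>s\<in>integrals. \<forall>i\<in>I. \<psi> i (\<eta> s \<star> (r \<star> z)) \<in> N}"
      note mr = linear_mapsD[OF bilinear_mapD(1)[OF smash_mult_bilinear]]
      have "hom_submodule R R id ?K"
      proof (rule hom_submoduleI)
        have "x \<star> \<zero>\<^bsub>AH\<^esub> = \<zero>\<^bsub>AH\<^esub>" if "x \<in> carrier AH" for x
          using that linear_maps_zero[OF _ _ bilinear_mapD(1)[OF smash_mult_bilinear]] by simp
        then show "\<zero>\<^bsub>R\<^esub> \<in> ?K" using linear_maps_zero[OF _ _ \<psi>_linear] DN(2) by simp
        show "w \<oplus>\<^bsub>R\<^esub> z \<in> ?K" if "w \<in> ?K" "z \<in> ?K" for w z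
          using that DN(3) by (simp add: mr D\<psi> AH.T.M.a_closed)
        show "id b \<star> z \<in> ?K" if "b \<in> carrier R" "z \<in> ?K" for b z
        proof -
          have "r \<star> (b \<star> z) = (r \<star> b) \<star> z" if "r \<in> carrier AH" for r
            using that \<open>b \<in> carrier R\<close> \<open>z \<in> ?K\<close> by (simp add: smash_assoc)
          then show ?thesis using that by simp
        qed
      qed auto
      moreover have "G \<subseteq> ?K"
      proof
        fix g assume g: "g \<in> G"
        then obtain s' x where sx: "g = \<eta> s' \<star> \<iota> x" "s' \<in> integrals" "x \<in> carrier A"
          using G(1) by blast
        have "\<psi> i (\<eta> s \<star> (r \<star> g)) \<in> N"
          if "r \<in> carrier AH" "s \<in> integrals" "i \<in> I" for r s i
        proof -
          let ?c = "act s (smash_act r \<one>\<^sub>A)"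
          have c: "?c \<in> carrier B" by (rule integral_act_invariant) (use that in auto)
          have "\<psi> i (\<eta> s \<star> (r \<star> g)) = ?c \<cdot> \<psi> i g"
            using integral_smash_mult_integral[OF that(2) sx(2) that(1), of "\<iota> x"] sx
              \<psi>_mult[OF that(3) invariants_closed[OF c] GA[OF g]] by simp
          moreover have "\<psi> i g \<in> N" using FN that(3) g by force
          ultimately show ?thesis using DN(4)[OF c] by simp
        qed
        then show "g \<in> ?K" using GA[OF g] by simp
      qed
      ultimately have "hom_span R R id ?Z \<subseteq> ?K" using G(3) unfolding hom_generates_def by blast
      then have ZK: "?Z \<subseteq> ?K" using RR.hom_span_properties(2)[OF Z] by blast
      have "\<psi> i (\<eta> s \<star> \<iota> y) \<in> N" if i: "i \<in> I" and s: "s \<in> integrals" for i s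
      proof -
        let ?z = "\<eta> s \<star> \<iota> y"
        have z: "?z \<in> carrier AH" using s y by simp
        have "?z \<in> ?K" using ZK s y by blast
        then have mem: "\<psi> i ((\<one>\<^sub>A \<sharp> t j) \<star> (\<iota> (a j) \<star> ?z)) \<in> N" if "j < n" for j
          using i that by simp
        \<comment> \<open>Membership in \<open>?K\<close> is used with \<open>s = t j\<close> and
          \<open>r = \<iota> (a j)\<close>. The resulting factor is the \<open>j\<close>-th term of
          the sum of trace one, so adding over \<open>j\<close> leaves \<open>\<psi> i ?z\<close>
          itself.\<close>
        have "act (t j) (a j) \<cdot> \<psi> i ?z \<in> N" if j: "j < n" for j
        proof -
          have "\<psi> i ((\<one>\<^sub>A \<sharp> t j) \<star> (\<iota> (a j) \<star> ?z)) = act (t j) (a j) \<cdot> \<psi> i ?z"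
            using integral_smash_mult_integral[OF t_integral[OF j] s, of "\<iota> (a j)" "\<iota> y"] j y i z
            by (simp add: smash_act_tensor act_one \<psi>_mult)
          then show ?thesis using mem[OF j] by simp
        qed
        then have "(\<Oplus>\<^bsub>A\<^esub>j\<in>{..<n}. act (t j) (a j) \<cdot> \<psi> i ?z) \<in> N"
          using DN by (intro A.finsum_in_additive_set) auto
        moreover have "(\<Oplus>\<^bsub>A\<^esub>j\<in>{..<n}. act (t j) (a j) \<cdot> \<psi> i ?z) =
            (\<Oplus>\<^bsub>A\<^esub>j\<in>{..<n}. act (t j) (a j)) \<cdot> \<psi> i ?z"
          by (rule A.finsum_ldistr[symmetric]) (use D\<psi>(1)[OF i z] in auto)
        ultimately show ?thesis using D\<psi>(1)[OF i z] trace_one by simp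
      qed
      then have "(\<Oplus>\<^bsub>A\<^esub>i\<in>I. \<psi> i ((\<one>\<^sub>A \<sharp> D.integral (e i)) \<star> \<iota> y)) \<in> N"
        using DN D.integral_in_left_integrals by (intro A.finsum_in_additive_set D.finite_I) auto
      then show "y \<in> N" by (simp add: sum_\<psi>_integral y)
    qed
  qed
qed

end

theorem corollary6p4:
  fixes k :: "('k, 'l) ring_scheme"
    and H :: "('k, 'h, 'm) module_scheme"
    and \<Delta> :: "'h \<Rightarrow> ('h \<times> 'h \<Rightarrow> 'k) set" and \<epsilon> :: "'h \<Rightarrow> 'k" and S :: "'h \<Rightarrow> 'h"
    and A :: "('k, 'a, 'n) module_scheme"
    and act :: "'h \<Rightarrow> 'a \<Rightarrow> 'a"
  assumes "cring k"
    and "hopf_algebra k H \<Delta> \<epsilon> S"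
    and "finitely_generated_module k H" and "projective_module k H"
    and "left_module_algebra k H \<Delta> \<epsilon> S A act"
    and "\<exists>(n::nat) a t. (\<forall>i<n. a i \<in> carrier A \<and> t i \<in> left_integrals H \<epsilon>) \<and>
           (\<Oplus>\<^bsub>A\<^esub>i\<in>{..<n}. act (t i) (a i)) = \<one>\<^bsub>A\<^esub>"
  shows "(left_FBN A
            \<longleftrightarrow> left_FBN (smash_product k A H \<Delta> act) \<and> left_noetherian_ring A) \<and>
         (left_FBN (smash_product k A H \<Delta> act) \<and> left_noetherian_ring A
            \<longleftrightarrow> left_FBN (invariants H \<epsilon> A act) \<and> left_noetherian_ring A)"
proof -
  interpret left_module_algebra k H \<Delta> \<epsilon> S A act by fact
  obtain n :: nat and a t where trace: "\<And>i. i < n \<Longrightarrow> a i \<in> carrier A" "\<And>i. i < n \<Longrightarrow> t i \<in> left_integrals H \<epsilon>"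
      "(\<Oplus>\<^bsub>A\<^esub>i\<in>{..<n}. act (t i) (a i)) = \<one>\<^bsub>A\<^esub>"
    using assms(6) by blast
  obtain I :: "'h set" and e \<phi> where dual: "finite I" "\<And>i. i \<in> I \<Longrightarrow> e i \<in> carrier H"
      "\<And>i. i \<in> I \<Longrightarrow> functional k H (\<phi> i)"
      "\<And>x. x \<in> carrier H \<Longrightarrow> (\<Oplus>\<^bsub>H\<^esub>i\<in>I. \<phi> i x \<odot>\<^bsub>H\<^esub> e i) = x"
    by (rule H.finite_dual_basis[OF assms(3,4)]) (rule that)
  interpret trace_one_finite_module_algebra k H \<Delta> \<epsilon> S A act n a t I e \<phi>
    by unfold_locales (use trace dual in auto)
  have noeth: "hom_noetherian A R \<iota>" "hom_noetherian R R id" "hom_noetherian B B id" "hom_noetherian B A id"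
    if "hom_noetherian A A id"
    by (rule smash_noetherian AR.hom_noetherian_imp_left_noetherian[OF smash_noetherian]
        invariants_noetherian noetherian_over_invariants; rule that)+
  \<comment> \<open>Left noetherianness of \<open>A\<close> is part of each assertion and passes to
    the other rings, so only full boundedness remains to be carried around the cycle from
    \<open>A\<close> to \<open>R\<close>, from \<open>R\<close> to \<open>B\<close> and back to
    \<open>A\<close>.\<close>
  have AR: "left_fully_bounded R" if "hom_noetherian A A id" "left_fully_bounded A"
    by (rule R.gabriel_condition_imp_left_fully_bounded[OF
          AR.left_fully_bounded_imp_gabriel_condition[OF that noeth(1)[OF that(1)]]])
  \<comment> \<open>Here the homomorphism is the identity of \<open>R\<close>: it serves to produce
    Gabriel's condition for \<open>R\<close>, and it is this condition that descends to
    \<open>B\<close>.\<close>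
  have RB: "left_fully_bounded B" if "hom_noetherian A A id" "left_fully_bounded R"
    by (rule B.gabriel_condition_imp_left_fully_bounded[OF gabriel_condition_invariants[OF
          ring_hom_ring.left_fully_bounded_imp_gabriel_condition[OF R.id_ring_hom_ring
            noeth(2)[OF that(1)] that(2) noeth(2)[OF that(1)]]]])
  have BA: "left_fully_bounded A" if "hom_noetherian A A id" "left_fully_bounded B"
    by (rule A.gabriel_condition_imp_left_fully_bounded[OF
          BA.left_fully_bounded_imp_gabriel_condition[OF noeth(3)[OF that(1)] that(2) noeth(4)[OF that(1)]]])
  show ?thesis
    unfolding left_FBN_def A.left_noetherian_iff R.left_noetherian_iff B.left_noetherian_iff
    using noeth AR RB BA by blast
qed

end
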